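(* Let $\mathbf{T}=\{(z,w)\in\mathbf{C}^2 : |z|<|w|<1\}$ be the Hartogs triangle. On $\mathbf{T}$, $\mathrm{Ker}(\overline\partial_s)=\mathrm{Ker}(\overline\partial)$ on functions; that is, the operators $\overline\partial_s,\overline\partial:L^2(\mathbf{T})\dashrightarrow L^2_{0,1}(\mathbf{T})$ have the same kernel.
   Context: $L^2_{0,1}(\mathbf{T})$ is the space of $(0,1)$-forms with square-integrable coefficients. $C^\infty(\overline{\mathbf{T}})$ denotes functions smooth up to the boundary (restrictions of smooth functions on $\mathbf{C}^2$). Weak maximal extension $\overline\partial$: $f\in\mathrm{Dom}(\overline\partial)$ if and only if $f\in L^2(\mathbf{T})$ and the distributional $\overline\partial f$ on $\mathbf{T}$ lies in $L^2_{0,1}(\mathbf{T})$. Strong maximal extension $\overline\partial_s$: the closure in the graph norm of $\overline\partial$ restricted to $C^\infty(\overline{\mathbf{T}})$; i.e. $f\in\mathrm{Dom}(\overline\partial_s)$ if and only if there is a sequence $f_\nu\in C^\infty(\overline{\mathbf{T}})$ with $f_\nu\to f$ and $\overline\partial f_\nu\to\overline\partial f$ in $L^2$, and then $\overline\partial_s f=\overline\partial f$. *)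

theory Defs
  imports "HOL-Analysis.Analysis"
begin

text \<open>
  \<open>L\<^sup>2\<close> functions on \<open>\<Omega>\<close> are represented by functions on the whole space; values off \<open>\<Omega>\<close> are
  irrelevant, and functions that agree almost everywhere on \<open>\<Omega>\<close> are not identified.  Membership in
  \<open>L2\<close>, in the graphs \<open>dbar\<close> and \<open>dbar_s\<close>, and in their kernels is unaffected by changing a function
  off \<open>\<Omega>\<close> or on a null subset of \<open>\<Omega>\<close>, so equality of kernels as sets of representatives is equality
  of the kernels in the quotient.
\<close>

definition L2 :: "'a::euclidean_space set \<Rightarrow> ('a \<Rightarrow> 'b::euclidean_space) set" where
  "L2 \<Omega> = {f. f \<in> borel_measurable (lebesgue_on \<Omega>) \<and>
               integrable (lebesgue_on \<Omega>) (\<lambda>x. (norm (f x))\<^sup>2)}"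

definition L2_norm :: "'a::euclidean_space set \<Rightarrow> ('a \<Rightarrow> 'b::euclidean_space) \<Rightarrow> real" where
  "L2_norm \<Omega> f = sqrt (LINT x|lebesgue_on \<Omega>. (norm (f x))\<^sup>2)"

definition L2_tendsto ::
    "'a::euclidean_space set \<Rightarrow> (nat \<Rightarrow> 'a \<Rightarrow> 'b::euclidean_space) \<Rightarrow> ('a \<Rightarrow> 'b) \<Rightarrow> bool" where
  "L2_tendsto \<Omega> F f \<longleftrightarrow> (\<lambda>n. L2_norm \<Omega> (\<lambda>x. F n x - f x)) \<longlonglongrightarrow> 0"

primrec Ck :: "nat \<Rightarrow> ('a::euclidean_space \<Rightarrow> 'b::euclidean_space) \<Rightarrow> bool" where
  "Ck 0 f \<longleftrightarrow> continuous_on UNIV f"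
| "Ck (Suc k) f \<longleftrightarrow> (\<forall>x. f differentiable (at x)) \<and>
                  (\<forall>v. Ck k (\<lambda>x. frechet_derivative f (at x) v))"

definition smooth :: "('a::euclidean_space \<Rightarrow> 'b::euclidean_space) \<Rightarrow> bool" where
  "smooth f \<longleftrightarrow> (\<forall>k. Ck k f)"

definition smooth_up_to_boundary ::
    "'a::euclidean_space set \<Rightarrow> ('a \<Rightarrow> 'b::euclidean_space) set" where
  "smooth_up_to_boundary \<Omega> = {f. \<exists>F. smooth F \<and> (\<forall>x\<in>\<Omega>. f x = F x)}"

definition test_functions ::
    "'a::euclidean_space set \<Rightarrow> ('a \<Rightarrow> 'b::euclidean_space) set" where
  "test_functions \<Omega> = {\<phi>. smooth \<phi> \<and> (\<exists>K. compact K \<and> K \<subseteq> \<Omega> \<and> (\<forall>x. x \<notin> K \<longrightarrow> \<phi> x = 0))}"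

text \<open>The Wirtinger derivatives \<open>\<partial>/\<partial>z\<^sup>*\<close> and \<open>\<partial>/\<partial>w\<^sup>*\<close> (conjugate variables) on \<open>\<complex>\<^sup>2\<close>, each
  \<open>(\<partial>\<^sub>x + \<i> \<partial>\<^sub>y) / 2\<close> in the respective coordinate.\<close>

definition dzbar :: "(complex \<times> complex \<Rightarrow> complex) \<Rightarrow> complex \<times> complex \<Rightarrow> complex" where
  "dzbar f p = (frechet_derivative f (at p) (1, 0) + \<i> * frechet_derivative f (at p) (\<i>, 0)) / 2"

definition dwbar :: "(complex \<times> complex \<Rightarrow> complex) \<Rightarrow> complex \<times> complex \<Rightarrow> complex" where
  "dwbar f p = (frechet_derivative f (at p) (0, 1) + \<i> * frechet_derivative f (at p) (0, \<i>)) / 2"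

text \<open>A \<open>(0,1)\<close>-form \<open>a dz\<^sup>* + b dw\<^sup>*\<close> is encoded by its pair of coefficients \<open>p \<mapsto> (a p, b p)\<close>, so
  that \<open>L2\<close> at value type \<open>complex \<times> complex\<close> is the space of forms with square-integrable
  coefficients.  Partially defined operators are given by their graphs.\<close>

type_synonym form01 = "complex \<times> complex \<Rightarrow> complex \<times> complex"

type_synonym dbar_graph = "((complex \<times> complex \<Rightarrow> complex) \<times> form01) set"

definition distributional_dbar ::
    "(complex \<times> complex) set \<Rightarrow> (complex \<times> complex \<Rightarrow> complex) \<Rightarrow> form01 \<Rightarrow> bool" where
  "distributional_dbar \<Omega> f g \<longleftrightarrow>
     (\<forall>\<phi> \<in> test_functions \<Omega>.
        (LINT p|lebesgue_on \<Omega>. fst (g p) * \<phi> p) = - (LINT p|lebesgue_on \<Omega>. f p * dzbar \<phi> p) \<and>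
        (LINT p|lebesgue_on \<Omega>. snd (g p) * \<phi> p) = - (LINT p|lebesgue_on \<Omega>. f p * dwbar \<phi> p))"

definition dbar :: "(complex \<times> complex) set \<Rightarrow> dbar_graph" where
  "dbar \<Omega> = {(f, g). f \<in> L2 \<Omega> \<and> g \<in> L2 \<Omega> \<and> distributional_dbar \<Omega> f g}"

definition dbar_s :: "(complex \<times> complex) set \<Rightarrow> dbar_graph" where
  "dbar_s \<Omega> = {(f, g). f \<in> L2 \<Omega> \<and> g \<in> L2 \<Omega> \<and>
     (\<exists>F G. (\<forall>n. F n \<in> smooth_up_to_boundary \<Omega> \<and> (F n, G n) \<in> dbar \<Omega>) \<and>
            L2_tendsto \<Omega> F f \<and> L2_tendsto \<Omega> G g)}"

definition Ker :: "dbar_graph \<Rightarrow> (complex \<times> complex \<Rightarrow> complex) set" where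
  "Ker A = {f. (f, \<lambda>_. 0) \<in> A}"

definition hartogs_triangle :: "(complex \<times> complex) set" where
  "hartogs_triangle = {(z, w). cmod z < cmod w \<and> cmod w < 1}"

end

theory Submission
  imports Defs
begin

text \<open>
  Let \<open>T\<close> be the Hartogs triangle, \<open>D\<close> the unit disc and \<open>D\<^sup>* = D - {0}\<close>.  One inclusion is soft: the
  weak equation passes to \<open>L\<^sup>2\<close> limits, on any bounded Borel set (\<open>Ker_dbar_s_subset\<close>).  For the other one,
  a function \<open>f\<close> in \<open>L\<^sup>2(T)\<close> with weak \<open>\<partial>\<^sup>*f = 0\<close> (here \<open>\<partial>\<^sup>*\<close> is the Cauchy-Riemann operator) has to be
  approximated by smooth functions on \<open>\<complex>\<^sup>2\<close> whose \<open>\<partial>\<^sup>*\<close> tends to \<open>0\<close> in \<open>L\<^sup>2(T)\<close>.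

  The chart \<open>(\<zeta>, w) \<mapsto> (\<zeta>w, w)\<close> maps \<open>D \<times> D\<^sup>*\<close> onto \<open>T\<close> biholomorphically with real Jacobian \<open>|w|\<^sup>2\<close>.  Hence
  \<open>H(\<zeta>, w) = w f(\<zeta>w, w)\<close> has the same \<open>L\<^sup>2\<close> norm on the bidisc as \<open>f\<close> has on \<open>T\<close>, and it satisfies the weak
  Cauchy-Riemann equations on \<open>D \<times> D\<^sup>*\<close>.  The hyperplane \<open>w = 0\<close> is removable for such a function: a point of
  the plane has capacity zero, so there are cutoffs \<open>X\<^sub>N(w)\<close> vanishing near \<open>0\<close>, tending to \<open>1\<close> elsewhere, with
  \<open>\<parallel>\<partial>\<^sup>*X\<^sub>N\<parallel> \<rightarrow> 0\<close> in \<open>L\<^sup>2\<close> (\<open>small_energy_cutoffs\<close>), and Cauchy-Schwarz kills the term with \<open>\<partial>\<^sup>*X\<^sub>N\<close>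
  (\<open>weakly_dbar_closed_chart_coefficient\<close>).

  On the bidisc \<open>H\<close> can be smoothed in the usual way.  For \<open>x\<close> in the bidisc, averaging \<open>H\<close> over a ball of radius
  \<open>\<delta>\<close> around the contracted point \<open>(1 - \<delta>)x\<close> never leaves the bidisc; this gives a function \<open>K\<close> that is smooth on all of \<open>\<complex>\<^sup>2\<close>, holomorphic
  on the bidisc (\<open>smoothing_dbar_closed\<close>) and close to \<open>H\<close> in \<open>L\<^sup>2\<close> (\<open>smoothing_tendsto_L2\<close>).

  Going back, \<open>w\<^sup>-\<^sup>1 K(z/w, w)\<close> is close to \<open>f\<close> in \<open>L\<^sup>2(T)\<close>, holomorphic on \<open>T\<close>, and of size \<open>O(1/|w|)\<close>; it is
  smooth up to every boundary point but the origin.  Multiplying it by the same cutoffs \<open>X\<^sub>N(w)\<close> makes it smooth on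
  \<open>\<complex>\<^sup>2\<close>.  The growth \<open>1/|w|\<close> is the borderline case: the Jacobian \<open>|w|\<^sup>2\<close> cancels it exactly, so the error
  \<open>K \<partial>\<^sup>*X\<^sub>N / w\<close> has \<open>L\<^sup>2(T)\<close> norm at most \<open>sup |K|\<close> times the norm of \<open>\<partial>\<^sup>*X\<^sub>N\<close>, which tends to \<open>0\<close>
  (\<open>dbar_approximants\<close>).
\<close>

text \<open>The square of the \<open>L\<^sup>2\<close> norm, possibly infinite.\<close>

abbreviation sqint :: "'a measure \<Rightarrow> ('a \<Rightarrow> 'b::real_normed_vector) \<Rightarrow> ennreal" where
  "sqint M f \<equiv> \<integral>\<^sup>+x. ennreal ((norm (f x))\<^sup>2) \<partial>M"

section \<open>Smooth functions on open sets\<close>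

text \<open>The local form of \<open>Ck\<close>: rational functions of the coordinates are smooth on open pieces, and the pieces
  have to be glued.\<close>

primrec Ck_on :: "nat \<Rightarrow> 'a::euclidean_space set \<Rightarrow> ('a \<Rightarrow> 'b::euclidean_space) \<Rightarrow> bool" where
  "Ck_on 0 S f \<longleftrightarrow> continuous_on S f"
| "Ck_on (Suc k) S f \<longleftrightarrow> (\<forall>x\<in>S. f differentiable (at x)) \<and>
                       (\<forall>v. Ck_on k S (\<lambda>x. frechet_derivative f (at x) v))"

definition smooth_on :: "'a::euclidean_space set \<Rightarrow> ('a \<Rightarrow> 'b::euclidean_space) \<Rightarrow> bool" where
  "smooth_on S f \<longleftrightarrow> (\<forall>k. Ck_on k S f)"

lemma Ck_on_UNIV_iff: "Ck k f \<longleftrightarrow> Ck_on k UNIV f"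
  by (induction k arbitrary: f) auto

lemma smooth_on_UNIV_iff: "smooth f \<longleftrightarrow> smooth_on UNIV f"
  by (simp add: smooth_def smooth_on_def Ck_on_UNIV_iff)

lemma frechet_derivative_cong_open:
  assumes "open S" "x \<in> S" "\<And>y. y \<in> S \<Longrightarrow> f y = g y"
  shows "frechet_derivative f (at x) = frechet_derivative g (at x)"
proof -
  have "(f has_derivative D) (at x) \<longleftrightarrow> (g has_derivative D) (at x)" for D
    using has_derivative_transform_within_open[of f D x UNIV S g] has_derivative_transform_within_open[of g D x UNIV S f]
      assms by auto
  then show ?thesis by (simp add: frechet_derivative_def)
qed

lemma differentiable_cong_open:
  assumes "open S" "x \<in> S" "\<And>y. y \<in> S \<Longrightarrow> f y = g y" "f differentiable (at x)"
  shows "g differentiable (at x)"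
  using assms has_derivative_transform_within_open[of f _ x UNIV S g] by (auto simp: differentiable_def)

lemma Ck_on_cong:
  assumes "open S" "\<And>x. x \<in> S \<Longrightarrow> f x = g x" "Ck_on k S f"
  shows "Ck_on k S g"
  using assms(2,3)
proof (induction k arbitrary: f g)
  case 0
  then show ?case
    unfolding Ck_on.simps by (metis continuous_on_eq)
next
  case (Suc k)
  have "Ck_on k S (\<lambda>x. frechet_derivative g (at x) v)" for v
  proof (rule Suc.IH)
    show "Ck_on k S (\<lambda>x. frechet_derivative f (at x) v)" using Suc.prems(2) by simp
    show "frechet_derivative f (at x) v = frechet_derivative g (at x) v" if "x \<in> S" for x
      by (simp only: frechet_derivative_cong_open[OF assms(1) that Suc.prems(1)])
  qed
  moreover have "\<forall>x\<in>S. g differentiable (at x)"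
  proof
    fix x assume x: "x \<in> S"
    have "f differentiable (at x)" using Suc.prems(2) x by simp
    then show "g differentiable (at x)"
      by (intro differentiable_cong_open[where f = f and g = g, OF assms(1) x Suc.prems(1)])
  qed
  ultimately show ?case by simp
qed

text \<open>Any explicit formula for the derivative may be used in place of \<open>frechet_derivative\<close>; this is the induction step of
  all closure properties below.\<close>

lemma Ck_on_SucI:
  assumes "open S" "\<And>x. x \<in> S \<Longrightarrow> (f has_derivative f' x) (at x)" "\<And>v. Ck_on k S (\<lambda>x. f' x v)"
  shows "Ck_on (Suc k) S f"
proof -
  have "frechet_derivative f (at x) = f' x" if "x \<in> S" for x
    using frechet_derivative_at[OF assms(2)[OF that]] by simp
  then have "Ck_on k S (\<lambda>x. frechet_derivative f (at x) v)" for v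
    by (intro Ck_on_cong[OF assms(1) _ assms(3)[of v]]) simp
  then show ?thesis using assms(2) by (auto simp: differentiable_def)
qed

lemma Ck_on_SucD: "Ck_on (Suc k) S f \<Longrightarrow> Ck_on k S f"
proof (induction k arbitrary: f)
  case 0
  then show ?case
    by (auto intro!: continuous_at_imp_continuous_on differentiable_imp_continuous_within)
next
  case (Suc k)
  then show ?case by auto
qed

lemma Ck_on_subset: "Ck_on k S f \<Longrightarrow> T \<subseteq> S \<Longrightarrow> Ck_on k T f"
  by (induction k arbitrary: f) (auto intro: continuous_on_subset)

lemma Ck_on_Un:
  assumes "open S" "open T" "Ck_on k S f" "Ck_on k T f"
  shows "Ck_on k (S \<union> T) f"
  using assms(3,4)
  by (induction k arbitrary: f) (auto intro: continuous_on_open_Un assms(1,2))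

lemma Ck_on_const: "Ck_on k S (\<lambda>_. c)"
  by (induction k arbitrary: c) (auto)

lemma Ck_on_add:
  assumes "open S"
  shows "Ck_on k S f \<Longrightarrow> Ck_on k S g \<Longrightarrow> Ck_on k S (\<lambda>x. f x + g x)"
proof (induction k arbitrary: f g)
  case 0
  then show ?case by (auto intro: continuous_intros)
next
  case (Suc k)
  show ?case
    by (rule Ck_on_SucI[OF assms, where f' = "\<lambda>x v. frechet_derivative f (at x) v + frechet_derivative g (at x) v"])
      (use Suc in \<open>auto intro!: derivative_intros simp flip: frechet_derivative_works\<close>)
qed

lemma Ck_on_sum:
  assumes "open S" "\<And>i. i \<in> I \<Longrightarrow> Ck_on k S (f i)"
  shows "Ck_on k S (\<lambda>x. \<Sum>i\<in>I. f i x)"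
proof (cases "finite I")
  case True
  then show ?thesis using assms(2)
    by (induction I) (auto intro: Ck_on_const Ck_on_add assms(1))
qed (simp add: Ck_on_const)


lemma Ck_on_bilinear:
  assumes "bounded_bilinear B" "open S"
  shows "Ck_on k S f \<Longrightarrow> Ck_on k S g \<Longrightarrow> Ck_on k S (\<lambda>x. B (f x) (g x))"
proof (induction k arbitrary: f g)
  case 0
  then show ?case using bounded_bilinear.continuous_on[OF assms(1)] by simp
next
  case (Suc k)
  show ?case
  proof (rule Ck_on_SucI[OF assms(2)])
    show "((\<lambda>x. B (f x) (g x)) has_derivative
        (\<lambda>v. B (f x) (frechet_derivative g (at x) v) + B (frechet_derivative f (at x) v) (g x))) (at x)"
      if "x \<in> S" for x
      using Suc.prems that
      by (intro bounded_bilinear.FDERIV[OF assms(1)]) (auto simp flip: frechet_derivative_works)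
    show "Ck_on k S (\<lambda>x. B (f x) (frechet_derivative g (at x) v) + B (frechet_derivative f (at x) v) (g x))" for v
      by (intro Ck_on_add[OF assms(2)] Suc.IH Ck_on_SucD[OF Suc.prems(1)] Ck_on_SucD[OF Suc.prems(2)])
        (use Suc.prems in auto)
  qed
qed

lemma Ck_on_linear:
  assumes "bounded_linear L" "open S" "Ck_on k S f"
  shows "Ck_on k S (\<lambda>x. L (f x))"
  using assms(3)
proof (induction k arbitrary: f)
  case 0
  then show ?case using bounded_linear.continuous_on[OF assms(1)] by simp
next
  case (Suc k)
  show ?case
  proof (rule Ck_on_SucI[OF assms(2)])
    show "((\<lambda>x. L (f x)) has_derivative (\<lambda>v. L (frechet_derivative f (at x) v))) (at x)"
      if "x \<in> S" for x
      using Suc.prems that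
      by (intro bounded_linear.has_derivative[OF assms(1)]) (auto simp flip: frechet_derivative_works)
    show "Ck_on k S (\<lambda>x. L (frechet_derivative f (at x) v))" for v
      by (intro Suc.IH) (use Suc.prems in auto)
  qed
qed

lemma Ck_on_ident:
  assumes "open S"
  shows "Ck_on k S (\<lambda>x. x)"
proof (cases k)
  case 0
  then show ?thesis by simp
next
  case (Suc n)
  show ?thesis unfolding Suc
    by (rule Ck_on_SucI[OF assms has_derivative_ident Ck_on_const])
qed

text \<open>Chain rule: the directional derivative of \<open>f\<close> along the moving direction
  \<open>Dg(x) v\<close> is expanded over the basis, so that the induction hypothesis applies to the
  directional derivatives of \<open>f\<close> along fixed basis vectors.\<close>

lemma Ck_on_compose:
  fixes f :: "'b::euclidean_space \<Rightarrow> 'c::euclidean_space" and g :: "'a::euclidean_space \<Rightarrow> 'b"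
  assumes "open S" "g ` S \<subseteq> T"
  shows "Ck_on k T f \<Longrightarrow> Ck_on k S g \<Longrightarrow> Ck_on k S (\<lambda>x. f (g x))"
proof (induction k arbitrary: f)
  case 0
  then show ?case using assms(2) by (auto intro: continuous_on_compose2)
next
  case (Suc k)
  have gT: "g x \<in> T" if "x \<in> S" for x using assms(2) that by auto
  show ?case
  proof (rule Ck_on_SucI[OF assms(1)])
    let ?Df = "\<lambda>y. frechet_derivative f (at y)" and ?Dg = "\<lambda>x. frechet_derivative g (at x)"
    show "((\<lambda>x. f (g x)) has_derivative (\<lambda>v. \<Sum>b\<in>Basis. (?Dg x v \<bullet> b) *\<^sub>R ?Df (g x) b)) (at x)"
      if x: "x \<in> S" for x
    proof -
      have Df: "(f has_derivative ?Df (g x)) (at (g x))"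
        using Suc.prems(1) gT[OF x] by (simp flip: frechet_derivative_works)
      interpret Df: bounded_linear "?Df (g x)" using Df by (rule has_derivative_bounded_linear)
      have "((\<lambda>x. f (g x)) has_derivative (\<lambda>v. ?Df (g x) (?Dg x v))) (at x)"
      proof (rule has_derivative_compose[of g "?Dg x" x UNIV f "?Df (g x)"])
        show "(g has_derivative ?Dg x) (at x)"
          using Suc.prems(2) x by (simp flip: frechet_derivative_works)
      qed (rule Df)
      also have "(\<lambda>v. ?Df (g x) (?Dg x v)) = (\<lambda>v. ?Df (g x) (\<Sum>b\<in>Basis. (?Dg x v \<bullet> b) *\<^sub>R b))"
        by (simp add: euclidean_representation)
      also have "\<dots> = (\<lambda>v. \<Sum>b\<in>Basis. (?Dg x v \<bullet> b) *\<^sub>R ?Df (g x) b)"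
        by (simp only: Df.sum Df.scaleR)
      finally show ?thesis .
    qed
    show "Ck_on k S (\<lambda>x. \<Sum>b\<in>Basis. (?Dg x v \<bullet> b) *\<^sub>R ?Df (g x) b)" for v
    proof (intro Ck_on_sum assms(1) Ck_on_bilinear[OF bounded_bilinear_scaleR] Ck_on_linear[OF bounded_linear_inner_left])
      show "Ck_on k S (\<lambda>x. ?Dg x v)" using Suc.prems by simp
      show "Ck_on k S (\<lambda>x. ?Df (g x) b)" for b
        by (rule Suc.IH) (use Suc.prems Ck_on_SucD[OF Suc.prems(2)] in auto)
    qed
  qed
qed

text \<open>The derivative of \<open>inverse\<close> is a quadratic polynomial in \<open>inverse\<close> itself, so the induction closes up.\<close>

lemma Ck_on_inverse: "Ck_on k (- {0}) (inverse :: 'a::{real_normed_field, euclidean_space} \<Rightarrow> 'a)"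
proof (induction k)
  case 0
  then show ?case by (auto intro: continuous_intros)
next
  case (Suc k)
  have op: "open (- {0::'a})" by auto
  show ?case
  proof (rule Ck_on_SucI[OF op])
    show "(inverse has_derivative (\<lambda>v. - (inverse x * v * inverse x))) (at x)" if "x \<in> - {0::'a}" for x
      using that by (intro has_derivative_inverse') auto
    show "Ck_on k (- {0}) (\<lambda>x. - (inverse x * v * inverse x))" for v :: 'a
      by (intro Ck_on_linear[OF bounded_linear_minus[OF bounded_linear_ident]]
          Ck_on_bilinear[OF bounded_bilinear_mult] Suc.IH Ck_on_const op)
  qed
qed

lemma smooth_on_const [intro]: "smooth_on S (\<lambda>_. c)"
  by (simp add: smooth_on_def Ck_on_const)

lemma smooth_on_ident [intro]: "open S \<Longrightarrow> smooth_on S (\<lambda>x. x)"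
  by (simp add: smooth_on_def Ck_on_ident)

lemma smooth_on_add [intro]: "open S \<Longrightarrow> smooth_on S f \<Longrightarrow> smooth_on S g \<Longrightarrow> smooth_on S (\<lambda>x. f x + g x)"
  by (simp add: smooth_on_def Ck_on_add)

lemma smooth_on_sum: "open S \<Longrightarrow> (\<And>i. i \<in> I \<Longrightarrow> smooth_on S (f i)) \<Longrightarrow> smooth_on S (\<lambda>x. \<Sum>i\<in>I. f i x)"
  by (simp add: smooth_on_def Ck_on_sum)

lemma smooth_on_bilinear:
  "bounded_bilinear B \<Longrightarrow> open S \<Longrightarrow> smooth_on S f \<Longrightarrow> smooth_on S g \<Longrightarrow> smooth_on S (\<lambda>x. B (f x) (g x))"
  by (simp add: smooth_on_def Ck_on_bilinear)

lemmas smooth_on_mult [intro] = smooth_on_bilinear[OF bounded_bilinear_mult]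

lemma smooth_on_linear: "bounded_linear L \<Longrightarrow> open S \<Longrightarrow> smooth_on S f \<Longrightarrow> smooth_on S (\<lambda>x. L (f x))"
  by (simp add: smooth_on_def Ck_on_linear)

lemma smooth_on_compose:
  "open S \<Longrightarrow> smooth_on T f \<Longrightarrow> smooth_on S g \<Longrightarrow> g ` S \<subseteq> T \<Longrightarrow> smooth_on S (\<lambda>x. f (g x))"
  by (auto simp add: smooth_on_def intro: Ck_on_compose)

lemma smooth_on_inverse:
  fixes f :: "'a::euclidean_space \<Rightarrow> 'b::{real_normed_field, euclidean_space}"
  assumes "open S" "smooth_on S f" "\<And>x. x \<in> S \<Longrightarrow> f x \<noteq> 0"
  shows "smooth_on S (\<lambda>x. inverse (f x))"
  by (rule smooth_on_compose[of S "- {0}" inverse f])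
    (use assms in \<open>auto simp: smooth_on_def Ck_on_inverse\<close>)

lemma smooth_on_cong: "open S \<Longrightarrow> (\<And>x. x \<in> S \<Longrightarrow> f x = g x) \<Longrightarrow> smooth_on S f \<Longrightarrow> smooth_on S g"
  by (auto simp add: smooth_on_def intro: Ck_on_cong)

lemma smooth_on_subset: "smooth_on S f \<Longrightarrow> T \<subseteq> S \<Longrightarrow> smooth_on T f"
  by (auto simp add: smooth_on_def intro: Ck_on_subset)

lemma smooth_on_Un: "open S \<Longrightarrow> open T \<Longrightarrow> smooth_on S f \<Longrightarrow> smooth_on T f \<Longrightarrow> smooth_on (S \<union> T) f"
  by (auto simp add: smooth_on_def intro: Ck_on_Un)

lemma smooth_onD:
  assumes "smooth_on S f" "x \<in> S"
  shows "(f has_derivative frechet_derivative f (at x)) (at x)"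
proof -
  have "Ck_on (Suc 0) S f" using assms(1) unfolding smooth_on_def by blast
  then show ?thesis using assms(2) unfolding Ck_on.simps frechet_derivative_works by blast
qed

lemma smooth_on_frechet_derivative:
  assumes "smooth_on S f"
  shows "smooth_on S (\<lambda>x. frechet_derivative f (at x) v)"
  unfolding smooth_on_def
proof
  fix k
  have "Ck_on (Suc k) S f" using assms unfolding smooth_on_def by blast
  then show "Ck_on k S (\<lambda>x. frechet_derivative f (at x) v)" by simp
qed

lemma smooth_on_continuous:
  assumes "smooth_on S f"
  shows "continuous_on S f"
proof -
  have "Ck_on 0 S f" using assms unfolding smooth_on_def by blast
  then show ?thesis by simp
qed

section \<open>A smooth step function\<close>

text \<open>The functions \<open>t\<^sup>-\<^sup>n exp(-1/t)\<close>, extended by \<open>0\<close>.  Differentiation sends the \<open>n\<close>-th one to a combination of the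
  next two, so smoothness is proved for all \<open>n\<close> simultaneously.\<close>

definition flat :: "nat \<Rightarrow> real \<Rightarrow> real" where
  "flat n t = (if t > 0 then inverse t ^ n * exp (- inverse t) else 0)"

lemma flat_tendsto_0: "(flat n \<longlongrightarrow> 0) (at 0)"
proof -
  have "((\<lambda>t. inverse t ^ n / exp (inverse t)) \<longlongrightarrow> (0::real)) (at_right 0)"
    by (rule filterlim_compose[OF tendsto_power_div_exp_0 filterlim_inverse_at_top_right])
  moreover have "eventually (\<lambda>t. inverse t ^ n / exp (inverse t) = flat n t) (at_right 0)"
    by (auto simp: eventually_at_filter flat_def exp_minus divide_simps)
  ultimately have "(flat n \<longlongrightarrow> 0) (at_right 0)"
    using Lim_transform_eventually by fast
  moreover have "(flat n \<longlongrightarrow> 0) (at_left 0)"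
    by (rule tendsto_eventually) (auto simp: eventually_at_filter flat_def)
  ultimately show ?thesis by (simp add: filterlim_split_at_real)
qed

lemma flat_has_field_derivative:
  "(flat n has_field_derivative flat (n + 2) t - of_nat n * flat (n + 1) t) (at t)"
proof -
  consider "t > 0" | "t < 0" | "t = 0" by linarith
  then show ?thesis
  proof cases
    case 1
    have "((\<lambda>t. inverse t ^ n * exp (- inverse t)) has_field_derivative
        flat (n + 2) t - of_nat n * flat (n + 1) t) (at t)"
      apply (rule derivative_eq_intros refl | use 1 in force)+
      using 1 by (cases n) (auto simp: flat_def field_simps power2_eq_square)
    then show ?thesis
      by (rule has_field_derivative_transform_within_open[where S = "{0<..}"]) (use 1 in \<open>auto simp: flat_def\<close>)
  next
    case 2
    have "((\<lambda>_. 0) has_field_derivative flat (n + 2) t - of_nat n * flat (n + 1) t) (at t)"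
      using 2 by (auto simp: flat_def)
    then show ?thesis
      by (rule has_field_derivative_transform_within_open[where S = "{..<0}"]) (use 2 in \<open>auto simp: flat_def\<close>)
  next
    case 3
    have "((\<lambda>h. (flat n (0 + h) - flat n 0) / h) \<longlongrightarrow> 0) (at 0)"
      by (rule Lim_transform_eventually[OF flat_tendsto_0[of "Suc n"]])
        (auto simp: eventually_at_filter flat_def field_simps)
    then show ?thesis by (simp add: 3 DERIV_def flat_def)
  qed
qed

lemma Ck_on_flat: "Ck_on k UNIV (flat n)"
proof (induction k arbitrary: n)
  case 0
  then show ?case
    using DERIV_continuous_on[OF flat_has_field_derivative[THEN has_field_derivative_at_within]] by simp
next
  case (Suc k)
  show ?case
  proof (rule Ck_on_SucI[OF open_UNIV])
    show "(flat n has_derivative (\<lambda>v. v * (flat (n + 2) t + (- of_nat n) * flat (n + 1) t))) (at t)" for t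
      using flat_has_field_derivative[of n t]
      by (intro has_derivative_eq_rhs[OF has_field_derivative_imp_has_derivative]) (auto simp: fun_eq_iff mult.commute)
    show "Ck_on k UNIV (\<lambda>t. v * (flat (n + 2) t + (- of_nat n) * flat (n + 1) t))" for v
      by (intro Ck_on_bilinear[OF bounded_bilinear_mult] Ck_on_add Ck_on_const Suc.IH open_UNIV)
  qed
qed

text \<open>The thresholds \<open>1\<close> and \<open>4\<close> are chosen for the cutoffs below: the rings \<open>1 < 4\<^sup>k |w|\<^sup>2 < 4\<close> with different \<open>k\<close> are
  disjoint.\<close>

definition smooth_step :: "real \<Rightarrow> real" where
  "smooth_step t = flat 0 (t - 1) * inverse (flat 0 (t - 1) + flat 0 (4 - t))"

lemma flat_0_pos_iff [simp]: "flat 0 t > 0 \<longleftrightarrow> t > 0"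
  by (simp add: flat_def)

lemma flat_0_nonneg [simp]: "flat 0 t \<ge> 0"
  by (simp add: flat_def)

lemma smooth_on_flat [intro]: "smooth_on UNIV (flat n)"
  by (simp add: smooth_on_def Ck_on_flat)

lemma smooth_on_smooth_step: "smooth_on UNIV smooth_step"
proof -
  have aff: "smooth_on UNIV (\<lambda>t::real. a + b * t)" for a b by (intro smooth_on_add smooth_on_mult) auto
  have 1: "smooth_on UNIV (\<lambda>t. flat 0 (t - 1))" "smooth_on UNIV (\<lambda>t. flat 0 (4 - t))"
    using smooth_on_compose[OF open_UNIV smooth_on_flat[of 0] aff[of "-1" 1]]
      smooth_on_compose[OF open_UNIV smooth_on_flat[of 0] aff[of 4 "-1"]] by auto
  have "flat 0 (t - 1) + flat 0 (4 - t) \<noteq> 0" for t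
  proof -
    have "flat 0 (t - 1) > 0 \<or> flat 0 (4 - t) > 0" by auto
    then show ?thesis using flat_0_nonneg[of "t - 1"] flat_0_nonneg[of "4 - t"] by linarith
  qed
  with 1 show ?thesis
    unfolding smooth_step_def by (intro smooth_on_mult smooth_on_inverse smooth_on_add) auto
qed

lemma smooth_step_eq_0: "t \<le> 1 \<Longrightarrow> smooth_step t = 0"
  by (simp add: smooth_step_def flat_def)

lemma smooth_step_eq_1: "t \<ge> 4 \<Longrightarrow> smooth_step t = 1"
  by (simp add: smooth_step_def flat_def)

lemma smooth_step_bounds: "0 \<le> smooth_step t" "smooth_step t \<le> 1"
proof -
  have pos: "flat 0 (t - 1) + flat 0 (4 - t) > 0"
  proof -
    have "flat 0 (t - 1) > 0 \<or> flat 0 (4 - t) > 0" by auto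
    then show ?thesis using flat_0_nonneg[of "t - 1"] flat_0_nonneg[of "4 - t"] by linarith
  qed
  show "0 \<le> smooth_step t" by (simp add: smooth_step_def)
  show "smooth_step t \<le> 1"
    using flat_0_nonneg[of "4 - t"] pos
    by (simp add: smooth_step_def flip: divide_inverse)
qed

section \<open>Mollifying kernels\<close>

lemma smooth_on_norm_power2:
  "smooth_on UNIV (\<lambda>x::'a::euclidean_space. (norm x)\<^sup>2)"
  unfolding power2_norm_eq_inner by (intro smooth_on_bilinear[OF bounded_bilinear_inner] smooth_on_ident open_UNIV)

lemma integrable_continuous_compact_support:
  fixes f :: "'a::euclidean_space \<Rightarrow> 'b::euclidean_space"
  assumes "continuous_on UNIV f" "compact K" "\<And>x. x \<notin> K \<Longrightarrow> f x = 0"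
  shows "integrable lborel f"
proof -
  have "integrable lborel (\<lambda>x. indicator K x *\<^sub>R f x)"
    using assms by (intro borel_integrable_compact) (auto intro: continuous_on_subset)
  also have "(\<lambda>x. indicator K x *\<^sub>R f x) = f"
    using assms(3) by (auto simp: fun_eq_iff indicator_def)
  finally show ?thesis .
qed

text \<open>The function \<open>exp(-1/(e\<^sup>2 - |y|\<^sup>2))\<close>, extended by \<open>0\<close> and normalised.\<close>

lemma mollifying_kernel_exists:
  assumes "e > 0"
  obtains \<kappa> :: "'a::euclidean_space \<Rightarrow> real"
  where "smooth_on UNIV \<kappa>" "\<And>y. \<kappa> y \<ge> 0" "\<And>y. norm y > e \<Longrightarrow> \<kappa> y = 0"
    "integrable lborel \<kappa>" "(LINT y|lborel. \<kappa> y) = 1"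
proof -
  define b where "b y = flat 0 (e\<^sup>2 - (norm y)\<^sup>2)" for y :: 'a
  have b0: "b y > 0 \<longleftrightarrow> norm y < e" for y
    using assms by (auto simp: b_def intro: power_less_imp_less_base[where n = 2] power_strict_mono)
  have sm: "smooth_on UNIV b"
  proof -
    have "smooth_on UNIV (\<lambda>y::'a. e\<^sup>2 + (-1) * (norm y)\<^sup>2)"
      by (intro smooth_on_add smooth_on_mult smooth_on_norm_power2 smooth_on_const open_UNIV)
    from smooth_on_compose[OF open_UNIV smooth_on_flat[of 0] this] show ?thesis
      by (simp add: b_def[abs_def])
  qed
  have nonneg: "b y \<ge> 0" for y by (simp add: b_def)
  have out: "b y = 0" if "y \<notin> cball 0 e" for y
    using that b0[of y] nonneg[of y] by (auto simp: order.order_iff_strict)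
  have int: "integrable lborel b"
    by (rule integrable_continuous_compact_support[OF smooth_on_continuous[OF sm] compact_cball out])
  define I where "I = (LINT y|lborel. b y)"
  have "I \<noteq> 0"
  proof
    assume "I = 0"
    then have "AE y in lborel. b y = 0"
      using int nonneg integral_nonneg_eq_0_iff_AE[OF int] by (auto simp: I_def)
    then have "AE y in lborel. y \<notin> (ball 0 e :: 'a set)"
      by eventually_elim (metis b0 dist_0_norm less_irrefl mem_ball)
    then have "negligible (ball 0 e :: 'a set)"
      by (auto simp: negligible_iff_null_sets intro!: null_sets_completionI AE_iff_null_sets[THEN iffD2])
    then show False using open_not_negligible[of "ball 0 e :: 'a set"] assms by simp
  qed
  moreover have "I \<ge> 0" unfolding I_def by (intro integral_nonneg_AE) (simp add: nonneg)
  ultimately have I: "I > 0" by simp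
  show ?thesis
  proof (rule that[of "\<lambda>y. inverse I * b y"])
    show "smooth_on UNIV (\<lambda>y. inverse I * b y)" by (intro smooth_on_mult sm smooth_on_const open_UNIV)
    show "inverse I * b y \<ge> 0" for y using I nonneg by simp
    show "inverse I * b y = 0" if "norm y > e" for y using out[of y] that by simp
    show "integrable lborel (\<lambda>y. inverse I * b y)" using int by simp
    show "(LINT y|lborel. inverse I * b y) = 1" using I by (simp add: I_def)
  qed
qed

section \<open>Cutoff functions of small Dirichlet energy\<close>

text \<open>The Cauchy-Riemann operator \<open>\<partial>/\<partial>w\<^sup>*\<close> in one variable.\<close>

definition dbar1 :: "(complex \<Rightarrow> complex) \<Rightarrow> complex \<Rightarrow> complex" where
  "dbar1 u w = (frechet_derivative u (at w) 1 + \<i> * frechet_derivative u (at w) \<i>) / 2"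

lemma norm_sum_square_at_most_one_nonzero:
  fixes a :: "'i \<Rightarrow> 'a::real_normed_vector"
  assumes "finite I" "\<And>i j. i \<in> I \<Longrightarrow> j \<in> I \<Longrightarrow> i \<noteq> j \<Longrightarrow> a i = 0 \<or> a j = 0"
  shows "(norm (\<Sum>i\<in>I. a i))\<^sup>2 = (\<Sum>i\<in>I. (norm (a i))\<^sup>2)"
proof (cases "\<exists>i\<in>I. a i \<noteq> 0")
  case True
  then obtain i where i: "i \<in> I" "a i \<noteq> 0" by blast
  then have "a j = 0" if "j \<in> I - {i}" for j using assms(2)[of i j] that by auto
  then show ?thesis using i assms(1) by (simp add: sum.remove[of I i])
qed simp

text \<open>Outside \<open>]1, 4[\<close> the step attains its minimum \<open>0\<close> or its maximum \<open>1\<close>, so its derivative vanishes there,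
  the end points included.\<close>

lemma smooth_step_derivative:
  obtains s' C where "\<And>t. (smooth_step has_field_derivative s' t) (at t)"
    "\<And>t. t \<le> 1 \<or> 4 \<le> t \<Longrightarrow> s' t = 0" "\<And>t. \<bar>s' t\<bar> \<le> C"
proof -
  define s' where "s' t = frechet_derivative smooth_step (at t) 1" for t
  have der: "(smooth_step has_field_derivative s' t) (at t)" for t
  proof -
    have h: "(smooth_step has_derivative frechet_derivative smooth_step (at t)) (at t)"
      by (rule smooth_onD[OF smooth_on_smooth_step UNIV_I])
    then interpret bounded_linear "frechet_derivative smooth_step (at t)" by (rule has_derivative_bounded_linear)
    have "frechet_derivative smooth_step (at t) = (*) (s' t)"
    proof
      fix v show "frechet_derivative smooth_step (at t) v = s' t * v"
        using scaleR[of v 1] by (simp add: s'_def mult.commute)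
    qed
    with h show ?thesis by (simp add: has_field_derivative_def)
  qed
  have zero: "s' t = 0" if "t \<le> 1 \<or> 4 \<le> t" for t
    using that
  proof
    assume "t \<le> 1"
    then show ?thesis
      using DERIV_local_min[OF der, of 1 t] smooth_step_bounds(1) by (simp add: smooth_step_eq_0)
  next
    assume "4 \<le> t"
    then show ?thesis
      using DERIV_local_max[OF der, of 1 t] smooth_step_bounds(2) by (simp add: smooth_step_eq_1)
  qed
  have "continuous_on {1..4} s'"
    unfolding s'_def
    by (rule continuous_on_subset[OF smooth_on_continuous[OF smooth_on_frechet_derivative[OF smooth_on_smooth_step]]]) simp
  then have "bounded (s' ` {1..4})"
    by (intro compact_imp_bounded compact_continuous_image) auto
  then obtain C where C: "\<And>t. t \<in> {1..4} \<Longrightarrow> \<bar>s' t\<bar> \<le> C" unfolding bounded_iff by fastforce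
  have "\<bar>s' t\<bar> \<le> max C 0" for t
    using C[of t] zero[of t] by (cases "t \<in> {1..4}") auto
  with der zero show ?thesis by (rule that)
qed

lemma emeasure_cball_complex_le: "a \<ge> 0 \<Longrightarrow> emeasure lborel (cball (0::complex) a) \<le> ennreal (4 * a\<^sup>2)"
proof -
  assume a: "a \<ge> 0"
  have "cball (0::complex) a \<subseteq> cbox (Complex (-a) (-a)) (Complex a a)"
  proof
    fix z :: complex assume "z \<in> cball 0 a"
    then show "z \<in> cbox (Complex (-a) (-a)) (Complex a a)"
      using abs_Re_le_cmod[of z] abs_Im_le_cmod[of z] by (auto simp: in_cbox_complex_iff)
  qed
  then have "emeasure lborel (cball (0::complex) a) \<le> emeasure lborel (cbox (Complex (-a) (-a)) (Complex a a))"
    by (intro emeasure_mono) auto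
  also have "\<dots> = ennreal (4 * a\<^sup>2)"
    using a by (subst emeasure_lborel_cbox) (auto simp: Basis_complex_def power2_eq_square)
  finally show ?thesis .
qed

lemma four_power_eq: "(4::real) ^ k = (2 ^ k)\<^sup>2"
  by (simp add: power2_eq_square flip: power_mult_distrib)

text \<open>A single cutoff \<open>s(4\<^sup>k |w|\<^sup>2)\<close> has a Dirichlet energy that does not depend on \<open>k\<close>, by scaling.  The gradients for
  different \<open>k\<close> have disjoint supports, hence are orthogonal, and the average over \<open>n\<close> scales has energy of order
  \<open>n / n\<^sup>2\<close>.  The average plays the role of the usual logarithmic cutoff.\<close>

lemma small_energy_cutoffs:
  obtains X :: "nat \<Rightarrow> complex \<Rightarrow> complex"
  where "\<And>N. smooth_on UNIV (X N)"
    "\<And>N. \<exists>e>0. \<forall>w. cmod w < e \<longrightarrow> X N w = 0"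
    "\<And>N w. cmod (X N w) \<le> 1"  "\<And>N w. cmod (1 - X N w) \<le> 1"
    "\<And>w. w \<noteq> 0 \<Longrightarrow> (\<lambda>N. X N w) \<longlonglongrightarrow> 1"
    "(\<lambda>N. \<integral>\<^sup>+ w. ennreal ((cmod (dbar1 (X N) w))\<^sup>2) \<partial>lborel) \<longlonglongrightarrow> 0"
proof -
  obtain s' C where s': "\<And>t. (smooth_step has_field_derivative s' t) (at t)"
    "\<And>t. t \<le> 1 \<or> 4 \<le> t \<Longrightarrow> s' t = 0" "\<And>t. \<bar>s' t\<bar> \<le> C"
    using smooth_step_derivative by blast
  define Y where "Y N w = (\<Sum>k=1..Suc N. smooth_step (4 ^ k * (cmod w)\<^sup>2)) / Suc N" for N w
  define X where "X N w = complex_of_real (Y N w)" for N w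
  have Y01: "0 \<le> Y N w" "Y N w \<le> 1" for N w
  proof -
    show "0 \<le> Y N w" unfolding Y_def by (intro divide_nonneg_pos sum_nonneg smooth_step_bounds) auto
    have "(\<Sum>k=1..Suc N. smooth_step (4 ^ k * (cmod w)\<^sup>2)) \<le> (\<Sum>k=1..Suc N. 1)"
      by (intro sum_mono smooth_step_bounds)
    then show "Y N w \<le> 1" unfolding Y_def by simp
  qed
  have smooth: "smooth_on UNIV (X N)" for N
  proof -
    have "smooth_on UNIV (\<lambda>w::complex. smooth_step (4 ^ k * (cmod w)\<^sup>2))" for k
      by (rule smooth_on_compose[OF open_UNIV smooth_on_smooth_step])
        (auto intro!: smooth_on_mult smooth_on_norm_power2)
    then have "smooth_on UNIV (\<lambda>w::complex. inverse (real (Suc N)) * (\<Sum>k=1..Suc N. smooth_step (4 ^ k * (cmod w)\<^sup>2)))"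
      by (intro smooth_on_mult smooth_on_sum smooth_on_const open_UNIV)
    then have "smooth_on UNIV (Y N)" by (simp add: Y_def[abs_def] divide_inverse mult.commute)
    from smooth_on_linear[OF bounded_linear_of_real open_UNIV this] show ?thesis
      by (simp add: X_def[abs_def])
  qed
  have vanish: "\<exists>e>0. \<forall>w. cmod w < e \<longrightarrow> X N w = 0" for N
  proof (intro exI[of _ "1 / 2 ^ Suc N"] conjI allI impI)
    fix w assume w: "cmod w < 1 / 2 ^ Suc N"
    have "4 ^ k * (cmod w)\<^sup>2 \<le> 1" if "k \<in> {1..Suc N}" for k
    proof -
      have "2 ^ k * cmod w \<le> 2 ^ Suc N * cmod w"
        using that by (intro mult_right_mono power_increasing) auto
      also have "\<dots> \<le> 1" using w by (simp add: field_simps)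
      finally have "(2 ^ k * cmod w)\<^sup>2 \<le> 1" by (intro power_le_one) auto
      then show ?thesis by (simp add: power_mult_distrib four_power_eq)
    qed
    then show "X N w = 0" by (simp add: X_def Y_def smooth_step_eq_0)
  qed simp
  have conv: "(\<lambda>N. X N w) \<longlonglongrightarrow> 1" if "w \<noteq> 0" for w
  proof -
    \<comment> \<open>All terms with \<open>k \<ge> K\<close> equal \<open>1\<close>, so the average differs from \<open>1\<close> by at most \<open>K / (N + 1)\<close>.\<close>
    obtain K where K: "4 / (cmod w)\<^sup>2 < 4 ^ K"
      using real_arch_pow[of 4 "4 / (cmod w)\<^sup>2"] by auto
    have one: "smooth_step (4 ^ k * (cmod w)\<^sup>2) = 1" if "k \<ge> K" for k
    proof (rule smooth_step_eq_1)
      have "4 / (cmod w)\<^sup>2 \<le> 4 ^ k" using K power_increasing[OF that, of "4::real"] by linarith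
      then show "4 \<le> 4 ^ k * (cmod w)\<^sup>2" using \<open>w \<noteq> 0\<close> by (simp add: field_simps)
    qed
    have "1 - Y N w \<le> K / Suc N" for N
    proof -
      have "Suc N - (\<Sum>k=1..Suc N. smooth_step (4 ^ k * (cmod w)\<^sup>2)) = (\<Sum>k=1..Suc N. 1 - smooth_step (4 ^ k * (cmod w)\<^sup>2))"
        by (simp add: sum_subtractf)
      also have "\<dots> \<le> (\<Sum>k=1..Suc N. if k \<in> {..<K} then 1 else 0)"
        by (intro sum_mono) (use one smooth_step_bounds in \<open>auto simp: not_less\<close>)
      also have "\<dots> = card ({1..Suc N} \<inter> {..<K})"
        by (subst sum.inter_restrict[symmetric]) auto
      also have "\<dots> \<le> K"
        using card_mono[of "{..<K}" "{1..Suc N} \<inter> {..<K}"] by simp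
      finally have "(Suc N - (\<Sum>k=1..Suc N. smooth_step (4 ^ k * (cmod w)\<^sup>2))) / Suc N \<le> K / Suc N"
        by (rule divide_right_mono) simp
      then show ?thesis by (simp add: Y_def diff_divide_distrib del: sum.cl_ivl_Suc of_nat_Suc)
    qed
    moreover have "(\<lambda>N. real K / Suc N) \<longlonglongrightarrow> 0"
      by (intro LIMSEQ_Suc[OF lim_const_over_n])
    ultimately have "(\<lambda>N. 1 - Y N w) \<longlonglongrightarrow> 0"
      using Y01 by (intro tendsto_sandwich[of "\<lambda>_. 0" "\<lambda>N. 1 - Y N w" sequentially "\<lambda>N. real K / Suc N" 0]) auto
    from tendsto_diff[OF tendsto_const[of 1] this] have "(\<lambda>N. Y N w) \<longlonglongrightarrow> 1" by simp
    from tendsto_of_real[OF this, where ?'a = complex] show ?thesis by (simp add: X_def)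
  qed
  \<comment> \<open>This is \<open>\<partial>/\<partial>w\<^sup>* |w|\<^sup>2 = w\<close> with the chain rule.\<close>
  have dbar1_X: "dbar1 (X N) w = (\<Sum>k=1..Suc N. of_real (s' (4 ^ k * (cmod w)\<^sup>2) * 4 ^ k) * w) / of_nat (Suc N)" for N w
  proof -
    define c where "c k = s' (4 ^ k * (cmod w)\<^sup>2) * 4 ^ k" for k :: nat
    define S n where "S = (\<Sum>k=1..Suc N. c k)" and "n = real (Suc N)"
    have "((\<lambda>w. smooth_step (4 ^ k * (cmod w)\<^sup>2)) has_derivative (\<lambda>v. c k * (2 * (w \<bullet> v)))) (at w)" for k
    proof -
      have "((\<lambda>w::complex. 4 ^ k * (w \<bullet> w)) has_derivative (\<lambda>v. 4 ^ k * (2 * (w \<bullet> v)))) (at w)"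
        by (auto intro!: derivative_eq_intros simp: inner_commute)
      from has_derivative_compose[OF this s'(1)[unfolded has_field_derivative_def]]
      show ?thesis
        by (simp add: c_def power2_norm_eq_inner mult.assoc)
    qed
    then have "((\<lambda>w. complex_of_real ((\<Sum>k=1..Suc N. smooth_step (4 ^ k * (cmod w)\<^sup>2)) / Suc N)) has_derivative
        (\<lambda>v. complex_of_real ((\<Sum>k=1..Suc N. c k * (2 * (w \<bullet> v))) / Suc N))) (at w)"
      by (intro bounded_linear.has_derivative[OF bounded_linear_of_real]
          bounded_linear.has_derivative[OF bounded_linear_divide] has_derivative_sum)
    then have "frechet_derivative (X N) (at w) = (\<lambda>v. complex_of_real ((\<Sum>k=1..Suc N. c k * (2 * (w \<bullet> v))) / Suc N))"
      unfolding X_def[abs_def] Y_def[abs_def] by (rule frechet_derivative_at[symmetric])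
    then have D: "frechet_derivative (X N) (at w) v = complex_of_real (S * (2 * (w \<bullet> v)) / n)" for v
      by (simp only: S_def n_def sum_distrib_right)
    have "dbar1 (X N) w = of_real S * w / of_real n"
      by (auto simp: dbar1_def D inner_complex_def complex_eq_iff)
    then show ?thesis by (simp add: c_def S_def n_def sum_distrib_right del: sum.cl_ivl_Suc)
  qed
  have energy: "sqint lborel (dbar1 (X N)) \<le> ennreal (64 * C\<^sup>2 / Suc N)" for N
  proof -
    have bound: "(cmod (dbar1 (X N) w))\<^sup>2
        \<le> (\<Sum>k=1..Suc N. (C\<^sup>2 * 4 * 4 ^ k) / (Suc N)\<^sup>2 * indicator (cball 0 (2 / 2 ^ k)) w)" for w
    proof -
      define a where "a k = of_real (s' (4 ^ k * (cmod w)\<^sup>2) * 4 ^ k) * w" for k :: nat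
      have nz: "1 < 4 ^ k * (cmod w)\<^sup>2 \<and> 4 ^ k * (cmod w)\<^sup>2 < 4" if "a k \<noteq> 0" for k
        using that s'(2)[of "4 ^ k * (cmod w)\<^sup>2"] by (force simp: a_def)
      \<comment> \<open>A point lies in at most one of the rings.\<close>
      have disj: "a j = 0 \<or> a k = 0" if "j < k" for j k
      proof (rule ccontr)
        assume "\<not> (a j = 0 \<or> a k = 0)"
        then have "1 < 4 ^ j * (cmod w)\<^sup>2" "4 ^ k * (cmod w)\<^sup>2 < 4" using nz by blast+
        moreover have "4 ^ Suc j * (cmod w)\<^sup>2 \<le> 4 ^ k * (cmod w)\<^sup>2"
          using that by (intro mult_right_mono power_increasing) auto
        ultimately show False by simp
      qed
      have "(cmod (dbar1 (X N) w))\<^sup>2 = (cmod (\<Sum>k=1..Suc N. a k))\<^sup>2 / (Suc N)\<^sup>2"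
        by (simp add: dbar1_X a_def norm_divide power_divide del: sum.cl_ivl_Suc of_nat_Suc)
      also have "(cmod (\<Sum>k=1..Suc N. a k))\<^sup>2 = (\<Sum>k=1..Suc N. (cmod (a k))\<^sup>2)"
      proof (rule norm_sum_square_at_most_one_nonzero)
        show "a i = 0 \<or> a j = 0" if "i \<noteq> j" for i j
          using disj[of i j] disj[of j i] that by linarith
      qed simp
      also have "\<dots> / (Suc N)\<^sup>2 = (\<Sum>k=1..Suc N. (cmod (a k))\<^sup>2 / (Suc N)\<^sup>2)"
        by (rule sum_divide_distrib)
      also have "\<dots> \<le> (\<Sum>k=1..Suc N. (C\<^sup>2 * 4 * 4 ^ k) / (Suc N)\<^sup>2 * indicator (cball 0 (2 / 2 ^ k)) w)"
      proof (rule sum_mono)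
        fix k
        show "(cmod (a k))\<^sup>2 / (Suc N)\<^sup>2 \<le> (C\<^sup>2 * 4 * 4 ^ k) / (Suc N)\<^sup>2 * indicator (cball 0 (2 / 2 ^ k)) w"
        proof (cases "a k = 0")
          case False
          from nz[OF this] have lt: "4 ^ k * (cmod w)\<^sup>2 < 4" by simp
          then have "(2 ^ k * cmod w)\<^sup>2 < 2\<^sup>2"
            by (simp add: power_mult_distrib four_power_eq)
          then have "2 ^ k * cmod w < 2" by (rule power_less_imp_less_base) simp
          then have "w \<in> cball 0 (2 / 2 ^ k)" by (simp add: field_simps)
          moreover have "(cmod (a k))\<^sup>2 \<le> C\<^sup>2 * 4 * 4 ^ k"
          proof -
            have "(cmod (a k))\<^sup>2 = (s' (4 ^ k * (cmod w)\<^sup>2))\<^sup>2 * (4 ^ k * (4 ^ k * (cmod w)\<^sup>2))"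
              by (simp only: a_def norm_mult[of _ w] norm_of_real power_mult_distrib power2_abs)
                (simp add: power2_eq_square)
            also have "\<dots> \<le> C\<^sup>2 * (4 ^ k * 4)"
            proof (intro mult_mono)
              have "\<bar>s' (4 ^ k * (cmod w)\<^sup>2)\<bar> \<le> \<bar>C\<bar>" using s'(3)[of "4 ^ k * (cmod w)\<^sup>2"] by linarith
              then show "(s' (4 ^ k * (cmod w)\<^sup>2))\<^sup>2 \<le> C\<^sup>2" by (simp only: abs_le_square_iff)
              show "4 ^ k * (cmod w)\<^sup>2 \<le> 4" using lt by linarith
            qed auto
            finally show ?thesis by (simp add: mult.commute mult.left_commute)
          qed
          ultimately show ?thesis by (simp add: divide_right_mono)
        qed simp
      qed
      finally show ?thesis .
    qed
    have "sqint lborel (dbar1 (X N))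
      \<le> (\<integral>\<^sup>+ w. (\<Sum>k=1..Suc N. ennreal ((C\<^sup>2 * 4 * 4 ^ k) / (Suc N)\<^sup>2) * indicator (cball (0::complex) (2 / 2 ^ k)) w) \<partial>lborel)"
    proof (intro nn_integral_mono)
      fix w
      have "ennreal ((cmod (dbar1 (X N) w))\<^sup>2)
          \<le> ennreal (\<Sum>k=1..Suc N. (C\<^sup>2 * 4 * 4 ^ k) / (Suc N)\<^sup>2 * indicator (cball 0 (2 / 2 ^ k)) w)"
        by (intro ennreal_leI bound)
      also have "\<dots> = (\<Sum>k=1..Suc N. ennreal ((C\<^sup>2 * 4 * 4 ^ k) / (Suc N)\<^sup>2 * indicator (cball 0 (2 / 2 ^ k)) w))"
        by (rule sum_ennreal[symmetric]) simp
      also have "\<dots> = (\<Sum>k=1..Suc N. ennreal ((C\<^sup>2 * 4 * 4 ^ k) / (Suc N)\<^sup>2) * indicator (cball 0 (2 / 2 ^ k)) w)"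
        by (intro sum.cong) (auto split: split_indicator)
      finally show "ennreal ((cmod (dbar1 (X N) w))\<^sup>2)
          \<le> (\<Sum>k=1..Suc N. ennreal ((C\<^sup>2 * 4 * 4 ^ k) / (Suc N)\<^sup>2) * indicator (cball 0 (2 / 2 ^ k)) w)" .
    qed
    also have "\<dots> = (\<Sum>k=1..Suc N. ennreal ((C\<^sup>2 * 4 * 4 ^ k) / (Suc N)\<^sup>2) * emeasure lborel (cball (0::complex) (2 / 2 ^ k)))"
      by (subst nn_integral_sum)
        (auto simp: nn_integral_cmult_indicator intro!: borel_measurable_times_ennreal borel_measurable_indicator)
    also have "\<dots> \<le> (\<Sum>k=1..Suc N. ennreal ((C\<^sup>2 * 4 * 4 ^ k) / (Suc N)\<^sup>2) * ennreal (4 * (2 / 2 ^ k)\<^sup>2))"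
      by (intro sum_mono mult_left_mono emeasure_cball_complex_le) auto
    also have "\<dots> = (\<Sum>k=1..Suc N. ennreal (64 * C\<^sup>2 / (Suc N)\<^sup>2))"
    proof (rule sum.cong)
      fix k
      have "(C\<^sup>2 * 4 * 4 ^ k) / (Suc N)\<^sup>2 * (4 * (2 / 2 ^ k)\<^sup>2) = 64 * C\<^sup>2 / (Suc N)\<^sup>2"
      proof -
        have "(2 ^ k)\<^sup>2 = (4::real) ^ k" by (rule four_power_eq[symmetric])
        then show ?thesis by (simp add: power_divide)
      qed
      then show "ennreal ((C\<^sup>2 * 4 * 4 ^ k) / (Suc N)\<^sup>2) * ennreal (4 * (2 / 2 ^ k)\<^sup>2) = ennreal (64 * C\<^sup>2 / (Suc N)\<^sup>2)"
        by (subst ennreal_mult[symmetric]) auto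
    qed simp
    also have "\<dots> = ennreal (real (Suc N) * (64 * C\<^sup>2 / (real (Suc N))\<^sup>2))"
      by (subst sum_ennreal) (simp, simp only: sum_constant card_atLeastAtMost, simp)
    also have "real (Suc N) * (64 * C\<^sup>2 / (real (Suc N))\<^sup>2) = 64 * C\<^sup>2 / Suc N"
      by (simp add: power2_eq_square)
    finally show ?thesis .
  qed
  have lim0: "(\<lambda>N. ennreal (64 * C\<^sup>2 / Suc N)) \<longlonglongrightarrow> ennreal 0"
    by (intro tendsto_ennrealI LIMSEQ_Suc[OF lim_const_over_n])
  have lim: "(\<lambda>N. \<integral>\<^sup>+ w. ennreal ((cmod (dbar1 (X N) w))\<^sup>2) \<partial>lborel) \<longlonglongrightarrow> 0"
  proof (rule tendsto_sandwich[OF _ _ tendsto_const, rotated 2])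
    show "(\<lambda>N. ennreal (64 * C\<^sup>2 / Suc N)) \<longlonglongrightarrow> 0" using lim0 by (simp only: ennreal_0)
  qed (simp_all only: energy eventually_True zero_le)
  show ?thesis
  proof (rule that[OF smooth vanish _ _ conv lim])
    show "cmod (X N w) \<le> 1" for N w using Y01 by (simp add: X_def)
    have "1 - X N w = of_real (1 - Y N w)" for N w by (simp add: X_def)
    then show "cmod (1 - X N w) \<le> 1" for N w using Y01[of N w] by (simp only: norm_of_real)
  qed auto
qed

section \<open>Complex scaling and the Hartogs triangle\<close>

text \<open>Real and imaginary part become accessible to Fubini.\<close>

lemma lborel_complex_eq_distr:
  "(lborel :: complex measure) = distr (lborel \<Otimes>\<^sub>M lborel) borel (\<lambda>(x, y). Complex x y)"
proof -
  have cont: "continuous_on UNIV (\<lambda>(x, y). Complex x y)"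
    unfolding split_beta Complex_eq by (intro continuous_intros)
  then have meas: "(\<lambda>(x, y). Complex x y) \<in> borel_measurable borel"
    by (rule borel_measurable_continuous_onI)
  show ?thesis unfolding lborel_prod
  proof (rule lborel_eqI)
    fix l u :: complex assume lu: "\<And>b. b \<in> Basis \<Longrightarrow> l \<bullet> b \<le> u \<bullet> b"
    then have le: "Re l \<le> Re u" "Im l \<le> Im u"
      using lu[of 1] lu[of \<i>] by (auto simp: Basis_complex_def)
    have "(\<lambda>(x, y). Complex x y) -` box l u = box (Re l, Im l) (Re u, Im u)"
      by (auto simp: box_def Basis_complex_def Basis_prod_def ball_Un)
    then have "emeasure (distr lborel borel (\<lambda>(x, y). Complex x y)) (box l u)
        = emeasure lborel (box (Re l, Im l) (Re u, Im u))"
      using meas by (subst emeasure_distr) auto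
    also have "\<dots> = (\<Prod>b\<in>Basis. (u - l) \<bullet> b)"
      using le
      by (subst emeasure_lborel_box) (auto simp: Basis_complex_def Basis_prod_def ball_Un prod.union_disjoint prod.reindex inj_on_def)
    finally show "emeasure (distr lborel borel (\<lambda>(x, y). Complex x y)) (box l u) = (\<Prod>b\<in>Basis. (u - l) \<bullet> b)" .
  qed simp
qed

lemma measurable_Complex [measurable]:
  assumes [measurable]: "f \<in> borel_measurable M" "g \<in> borel_measurable M"
  shows "(\<lambda>x. Complex (f x) (g x)) \<in> borel_measurable M"
  unfolding Complex_eq by measurable

lemma nn_integral_complex:
  assumes [measurable]: "f \<in> borel_measurable borel"
  shows "(\<integral>\<^sup>+z. f z \<partial>lborel) = (\<integral>\<^sup>+x. \<integral>\<^sup>+y. f (Complex x y) \<partial>lborel \<partial>lborel)"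
proof -
  have "(\<integral>\<^sup>+z. f z \<partial>lborel) = (\<integral>\<^sup>+p. f (case p of (x, y) \<Rightarrow> Complex x y) \<partial>(lborel \<Otimes>\<^sub>M lborel))"
    by (subst lborel_complex_eq_distr, subst nn_integral_distr) auto
  also have "\<dots> = (\<integral>\<^sup>+x. \<integral>\<^sup>+y. f (Complex x y) \<partial>lborel \<partial>lborel)"
    by (subst lborel.nn_integral_fst[symmetric]) auto
  finally show ?thesis .
qed

text \<open>Multiplication by \<open>c\<close> is a real linear map with determinant \<open>|c|\<^sup>2\<close>; for \<open>Re c \<noteq> 0\<close> it is
  the composition of two maps, each of which changes one real variable affinely.\<close>

lemma nn_integral_complex_mult:
  fixes c :: complex
  assumes c: "c \<noteq> 0" and [measurable]: "f \<in> borel_measurable borel"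
  shows "(\<integral>\<^sup>+z. f z \<partial>lborel) = ennreal ((cmod c)\<^sup>2) * (\<integral>\<^sup>+z. f (c * z) \<partial>lborel)"
proof -
  define a b where "a = Re c" and "b = Im c"
  define F where "F x y = f (Complex x y)" for x y
  have [measurable]: "case_prod F \<in> borel_measurable (borel \<Otimes>\<^sub>M borel)"
    unfolding F_def by measurable
  have F2 [measurable]: "(\<lambda>p. F (u p) (v p)) \<in> borel_measurable M"
    if [measurable]: "u \<in> borel_measurable M" "v \<in> borel_measurable M" for u v and M :: "'m measure"
    unfolding F_def by measurable
  have swap: "(\<integral>\<^sup>+x. \<integral>\<^sup>+y. G x y \<partial>lborel \<partial>lborel) = (\<integral>\<^sup>+y. \<integral>\<^sup>+x. G x y \<partial>lborel \<partial>lborel)"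
    if "case_prod G \<in> borel_measurable (borel \<Otimes>\<^sub>M borel)" for G :: "real \<Rightarrow> real \<Rightarrow> ennreal"
    using that by (intro lborel_pair.Fubini') simp
  have lhs: "(\<integral>\<^sup>+z. f z \<partial>lborel) = (\<integral>\<^sup>+x. \<integral>\<^sup>+y. F x y \<partial>lborel \<partial>lborel)"
    unfolding F_def by (rule nn_integral_complex) simp
  have rhs: "(\<integral>\<^sup>+z. f (c * z) \<partial>lborel) = (\<integral>\<^sup>+x. \<integral>\<^sup>+y. F (a * x - b * y) (b * x + a * y) \<partial>lborel \<partial>lborel)"
  proof -
    have "c * Complex x y = Complex (a * x - b * y) (b * x + a * y)" for x y
      by (simp add: complex_eq_iff a_def b_def)
    then show ?thesis unfolding F_def by (subst nn_integral_complex) simp_all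
  qed
  have nc: "(cmod c)\<^sup>2 = a\<^sup>2 + b\<^sup>2" by (simp add: cmod_power2 a_def b_def)
  show ?thesis
  proof (cases "a = 0")
    case False
    define m where "m = (a\<^sup>2 + b\<^sup>2) / a"
    have m: "m \<noteq> 0" using False by (simp add: m_def sum_power2_eq_zero_iff)
    have "(\<integral>\<^sup>+x. \<integral>\<^sup>+y. F x y \<partial>lborel \<partial>lborel) = (\<integral>\<^sup>+x. \<bar>m\<bar> * (\<integral>\<^sup>+y. F x (b / a * x + m * y) \<partial>lborel) \<partial>lborel)"
      by (intro nn_integral_cong nn_integral_real_affine m) measurable
    also have "\<dots> = \<bar>m\<bar> * (\<integral>\<^sup>+x. \<integral>\<^sup>+y. F x (b / a * x + m * y) \<partial>lborel \<partial>lborel)"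
      by (rule nn_integral_cmult) measurable
    also have "(\<integral>\<^sup>+x. \<integral>\<^sup>+y. F x (b / a * x + m * y) \<partial>lborel \<partial>lborel)
        = (\<integral>\<^sup>+y. \<integral>\<^sup>+x. F x (b / a * x + m * y) \<partial>lborel \<partial>lborel)"
      by (rule swap) measurable
    also have "\<dots> = (\<integral>\<^sup>+y. \<bar>a\<bar> * (\<integral>\<^sup>+x. F (- b * y + a * x) (b / a * (- b * y + a * x) + m * y) \<partial>lborel) \<partial>lborel)"
      by (intro nn_integral_cong nn_integral_real_affine False) measurable
    also have "\<dots> = \<bar>a\<bar> * (\<integral>\<^sup>+y. \<integral>\<^sup>+x. F (- b * y + a * x) (b / a * (- b * y + a * x) + m * y) \<partial>lborel \<partial>lborel)"
      by (rule nn_integral_cmult) measurable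
    also have "(\<lambda>y x. F (- b * y + a * x) (b / a * (- b * y + a * x) + m * y)) = (\<lambda>y x. F (a * x - b * y) (b * x + a * y))"
    proof -
      have 1: "- b * y + a * x = a * x - b * y" for x y by simp
      have 2: "b / a * (- b * y + a * x) + m * y = b * x + a * y" for x y
        using False by (simp add: m_def field_simps power2_eq_square)
      show ?thesis unfolding 2 unfolding 1 ..
    qed
    also have "(\<integral>\<^sup>+y. \<integral>\<^sup>+x. F (a * x - b * y) (b * x + a * y) \<partial>lborel \<partial>lborel)
       = (\<integral>\<^sup>+x. \<integral>\<^sup>+y. F (a * x - b * y) (b * x + a * y) \<partial>lborel \<partial>lborel)"
      by (rule swap[symmetric]) measurable
    finally have "(\<integral>\<^sup>+z. f z \<partial>lborel) = (ennreal \<bar>m\<bar> * ennreal \<bar>a\<bar>) * (\<integral>\<^sup>+z. f (c * z) \<partial>lborel)"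
      by (simp add: lhs rhs mult.assoc)
    also have "ennreal \<bar>m\<bar> * ennreal \<bar>a\<bar> = ennreal ((cmod c)\<^sup>2)"
      using False by (simp add: nc m_def abs_divide flip: ennreal_mult)
    finally show ?thesis .
  next
    case True
    with c have b: "b \<noteq> 0" by (auto simp: a_def b_def complex_eq_iff)
    then have mb: "- b \<noteq> 0" by simp
    have "(\<integral>\<^sup>+x. \<integral>\<^sup>+y. F x y \<partial>lborel \<partial>lborel) = (\<integral>\<^sup>+y. \<integral>\<^sup>+x. F x y \<partial>lborel \<partial>lborel)"
      by (rule swap) measurable
    also have "\<dots> = \<bar>b\<bar> * (\<integral>\<^sup>+y. \<integral>\<^sup>+x. F x (0 + b * y) \<partial>lborel \<partial>lborel)"
      by (rule nn_integral_real_affine[OF _ b]) measurable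
    also have "(\<integral>\<^sup>+y. \<integral>\<^sup>+x. F x (0 + b * y) \<partial>lborel \<partial>lborel) = (\<integral>\<^sup>+y. \<bar>-b\<bar> * (\<integral>\<^sup>+x. F (0 + (-b) * x) (0 + b * y) \<partial>lborel) \<partial>lborel)"
      by (intro nn_integral_cong nn_integral_real_affine mb) measurable
    also have "\<dots> = \<bar>-b\<bar> * (\<integral>\<^sup>+y. \<integral>\<^sup>+x. F (0 + (-b) * x) (0 + b * y) \<partial>lborel \<partial>lborel)"
      by (rule nn_integral_cmult) measurable
    finally have "(\<integral>\<^sup>+z. f z \<partial>lborel) = (ennreal \<bar>b\<bar> * ennreal \<bar>b\<bar>) * (\<integral>\<^sup>+z. f (c * z) \<partial>lborel)"
      by (simp add: lhs rhs mult.assoc True)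
    also have "ennreal \<bar>b\<bar> * ennreal \<bar>b\<bar> = ennreal ((cmod c)\<^sup>2)"
      using nc True by (simp add: power2_eq_square flip: ennreal_mult)
    finally show ?thesis .
  qed
qed

definition punctured_bidisc :: "(complex \<times> complex) set" where
  "punctured_bidisc = ball 0 1 \<times> (ball 0 1 - {0})"

text \<open>The inverse of \<open>(z, w) \<mapsto> (z/w, w)\<close>.\<close>

definition triangle_chart :: "complex \<times> complex \<Rightarrow> complex \<times> complex" where
  "triangle_chart p = (fst p * snd p, snd p)"

lemma open_hartogs_triangle: "open hartogs_triangle"
proof -
  have "hartogs_triangle = {p. cmod (fst p) < cmod (snd p)} \<inter> {p. cmod (snd p) < 1}"
    by (auto simp: hartogs_triangle_def)
  moreover have "open {p :: complex \<times> complex. cmod (fst p) < cmod (snd p)}" "open {p :: complex \<times> complex. cmod (snd p) < 1}"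
    by (intro open_Collect_less continuous_intros)+
  ultimately show ?thesis by (metis open_Int)
qed

lemma open_punctured_bidisc: "open punctured_bidisc"
  unfolding punctured_bidisc_def by (intro open_Times open_ball open_Diff closed_singleton)

lemma borel_hartogs_triangle [measurable]: "hartogs_triangle \<in> sets borel"
  by (simp add: open_hartogs_triangle)

lemma borel_punctured_bidisc [measurable]: "punctured_bidisc \<in> sets borel"
  by (simp add: open_punctured_bidisc)

lemma measurable_chart_weight [measurable]:
  "(\<lambda>q. indicator punctured_bidisc q * (cmod (snd q))\<^sup>2) \<in> borel_measurable borel"
  by (intro borel_measurable_times borel_measurable_indicator borel_measurable_continuous_onI
      continuous_intros borel_punctured_bidisc)

lemma measurable_triangle_chart [measurable]: "triangle_chart \<in> borel_measurable borel"
  unfolding triangle_chart_def borel_prod[symmetric] by measurable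

text \<open>For \<open>0 < |w| < 1\<close> the slice of the triangle is \<open>w\<close> times the unit disc, so the change of variables is a complex scaling
  in each slice.\<close>

lemma nn_integral_hartogs_triangle:
  assumes [measurable]: "g \<in> borel_measurable borel"
  shows "(\<integral>\<^sup>+p. g p * indicator hartogs_triangle p \<partial>lborel)
    = (\<integral>\<^sup>+q. ennreal (indicator punctured_bidisc q * (cmod (snd q))\<^sup>2) * g (triangle_chart q) \<partial>lborel)"
proof -
  have g2 [measurable]: "g \<in> borel_measurable (borel \<Otimes>\<^sub>M borel)" by (simp add: borel_prod)
  have T2 [measurable]: "hartogs_triangle \<in> sets (borel \<Otimes>\<^sub>M borel)"
    by (subst borel_prod) (rule borel_hartogs_triangle)
  have P2 [measurable]: "punctured_bidisc \<in> sets (borel \<Otimes>\<^sub>M borel)"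
    by (subst borel_prod) (rule borel_punctured_bidisc)
  have "(\<integral>\<^sup>+p. g p * indicator hartogs_triangle p \<partial>lborel)
      = (\<integral>\<^sup>+w. \<integral>\<^sup>+z. g (z, w) * indicator hartogs_triangle (z, w) \<partial>lborel \<partial>lborel)"
    unfolding lborel_prod[symmetric] by (subst lborel_pair.nn_integral_snd[symmetric]) auto
  also have "\<dots> = (\<integral>\<^sup>+w. \<integral>\<^sup>+\<zeta>. ennreal (indicator punctured_bidisc (\<zeta>, w) * (cmod w)\<^sup>2) * g (triangle_chart (\<zeta>, w)) \<partial>lborel \<partial>lborel)"
  proof (rule nn_integral_cong)
    fix w :: complex
    show "(\<integral>\<^sup>+z. g (z, w) * indicator hartogs_triangle (z, w) \<partial>lborel)
      = (\<integral>\<^sup>+\<zeta>. ennreal (indicator punctured_bidisc (\<zeta>, w) * (cmod w)\<^sup>2) * g (triangle_chart (\<zeta>, w)) \<partial>lborel)"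
    proof (cases "w = 0")
      case True
      then show ?thesis by (simp add: hartogs_triangle_def punctured_bidisc_def)
    next
      case False
      have "(\<integral>\<^sup>+z. g (z, w) * indicator hartogs_triangle (z, w) \<partial>lborel)
        = ennreal ((cmod w)\<^sup>2) * (\<integral>\<^sup>+\<zeta>. g (w * \<zeta>, w) * indicator hartogs_triangle (w * \<zeta>, w) \<partial>lborel)"
        by (rule nn_integral_complex_mult[OF False]) measurable
      also have "\<dots> = (\<integral>\<^sup>+\<zeta>. ennreal ((cmod w)\<^sup>2) * (g (w * \<zeta>, w) * indicator hartogs_triangle (w * \<zeta>, w)) \<partial>lborel)"
        by (rule nn_integral_cmult[symmetric]) measurable
      also have "\<dots> = (\<integral>\<^sup>+\<zeta>. ennreal (indicator punctured_bidisc (\<zeta>, w) * (cmod w)\<^sup>2) * g (triangle_chart (\<zeta>, w)) \<partial>lborel)"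
        using False
        by (intro nn_integral_cong)
          (auto simp: hartogs_triangle_def punctured_bidisc_def triangle_chart_def norm_mult mult.commute split: split_indicator)
      finally show ?thesis .
    qed
  qed
  also have "\<dots> = (\<integral>\<^sup>+q. ennreal (indicator punctured_bidisc q * (cmod (snd q))\<^sup>2) * g (triangle_chart q) \<partial>lborel)"
  proof -
    have "(\<lambda>q. ennreal (indicator punctured_bidisc q * (cmod (snd q))\<^sup>2) * g (triangle_chart q))
        \<in> borel_measurable (lborel \<Otimes>\<^sub>M lborel)"
      unfolding lborel_prod by measurable
    from lborel_pair.nn_integral_snd[OF this] show ?thesis by (simp add: lborel_prod)
  qed
  finally show ?thesis .
qed

text \<open>Stated for measures, the change of variables applies to Bochner integrals of arbitrary measurable functions.\<close>

lemma hartogs_triangle_measure_eq: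
  "density lborel (indicator hartogs_triangle)
    = distr (density lborel (\<lambda>q. ennreal (indicator punctured_bidisc q * (cmod (snd q))\<^sup>2))) borel triangle_chart"
  (is "_ = distr ?D borel _")
proof (rule measure_eqI)
  fix A :: "(complex \<times> complex) set" assume "A \<in> sets (density lborel (indicator hartogs_triangle))"
  then have [measurable]: "A \<in> sets borel" by simp
  have "emeasure (density lborel (indicator hartogs_triangle)) A
      = (\<integral>\<^sup>+p. indicator A p * indicator hartogs_triangle p \<partial>lborel)"
    by (subst emeasure_density) (auto simp: mult.commute)
  also have "\<dots> = (\<integral>\<^sup>+q. ennreal (indicator punctured_bidisc q * (cmod (snd q))\<^sup>2) * indicator A (triangle_chart q) \<partial>lborel)"
    by (rule nn_integral_hartogs_triangle) simp
  also have "\<dots> = (\<integral>\<^sup>+q. indicator A (triangle_chart q) \<partial>?D)"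
    by (subst nn_integral_density) auto
  also have "\<dots> = (\<integral>\<^sup>+p. indicator A p \<partial>distr ?D borel triangle_chart)"
    by (subst nn_integral_distr) auto
  also have "\<dots> = emeasure (distr ?D borel triangle_chart) A" by simp
  finally show "emeasure (density lborel (indicator hartogs_triangle)) A = emeasure (distr ?D borel triangle_chart) A" .
qed simp

lemma integral_hartogs_triangle:
  fixes f :: "complex \<times> complex \<Rightarrow> complex"
  assumes [measurable]: "f \<in> borel_measurable borel"
  shows "(LINT p|lborel. indicator hartogs_triangle p *\<^sub>R f p)
    = (LINT q|lborel. (indicator punctured_bidisc q * (cmod (snd q))\<^sup>2) *\<^sub>R f (triangle_chart q))"
proof -
  have "(LINT p|lborel. indicator hartogs_triangle p *\<^sub>R f p)
      = (LINT p|density lborel (\<lambda>p. ennreal (indicator hartogs_triangle p)). f p)"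
    by (rule integral_density[symmetric]) auto
  also have "(\<lambda>p. ennreal (indicator hartogs_triangle p)) = (indicator hartogs_triangle :: _ \<Rightarrow> ennreal)"
    by (auto simp: fun_eq_iff split: split_indicator)
  also have "(LINT p|density lborel (indicator hartogs_triangle). f p)
      = (LINT q|density lborel (\<lambda>q. ennreal (indicator punctured_bidisc q * (cmod (snd q))\<^sup>2)). f (triangle_chart q))"
    unfolding hartogs_triangle_measure_eq by (rule integral_distr) auto
  also have "\<dots> = (LINT q|lborel. (indicator punctured_bidisc q * (cmod (snd q))\<^sup>2) *\<^sub>R f (triangle_chart q))"
    by (rule integral_density) auto
  finally show ?thesis .
qed

section \<open>Lebesgue integrals of Borel functions\<close>

lemma integral_lebesgue_on_borel:
  fixes f :: "'a::euclidean_space \<Rightarrow> 'b::euclidean_space"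
  assumes [measurable]: "f \<in> borel_measurable borel" "S \<in> sets borel"
  shows "(LINT x|lebesgue_on S. f x) = (LINT x|lborel. indicator S x *\<^sub>R f x)"
  by (subst integral_restrict_space, simp, rule integral_completion) measurable

lemma integrable_lebesgue_on_borel:
  fixes f :: "'a::euclidean_space \<Rightarrow> 'b::euclidean_space"
  assumes [measurable]: "f \<in> borel_measurable borel" "S \<in> sets borel"
  shows "integrable (lebesgue_on S) f \<longleftrightarrow> integrable lborel (\<lambda>x. indicator S x *\<^sub>R f x)"
  by (subst integrable_restrict_space, simp, rule integrable_completion) measurable

section \<open>Density of continuous functions\<close>

lemma norm_diff_square_le:
  fixes a b c :: "'a::real_normed_vector"
  shows "(norm (a - c))\<^sup>2 \<le> 2 * (norm (a - b))\<^sup>2 + 2 * (norm (b - c))\<^sup>2"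
proof -
  have "norm (a - c) \<le> norm (a - b) + norm (b - c)" using norm_triangle_ineq[of "a - b" "b - c"] by simp
  then have "(norm (a - c))\<^sup>2 \<le> (norm (a - b) + norm (b - c))\<^sup>2" by (intro power_mono) auto
  also have "\<dots> \<le> 2 * (norm (a - b))\<^sup>2 + 2 * (norm (b - c))\<^sup>2"
    using sum_squares_bound[of "norm (a - b)" "norm (b - c)"] by (simp add: power2_sum)
  finally show ?thesis .
qed

text \<open>Truncate \<open>f\<close> in size and in space.  The truncation is an almost everywhere limit of continuous functions, and these may
  be forced to obey the same bounds by projecting the values to a ball and cutting off at infinity; dominated
  convergence does the rest.\<close>

lemma L2_continuous_dense:
  fixes f :: "'a::euclidean_space \<Rightarrow> 'b::euclidean_space"
  assumes [measurable]: "f \<in> borel_measurable borel"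
    and fin: "sqint lborel f < \<infinity>" and e: "e > 0"
  obtains g R where "continuous_on UNIV g" "\<And>x. x \<notin> cball 0 R \<Longrightarrow> g x = 0"
    "sqint lborel (\<lambda>x. f x - g x) < ennreal e"
proof -
  define h where "h M x = (if norm x \<le> M \<and> norm (f x) \<le> M then f x else 0)" for M x
  have [measurable]: "h M \<in> borel_measurable borel" for M unfolding h_def by measurable
  have "(\<lambda>M. \<integral>\<^sup>+x. ennreal ((norm (f x - h (real M) x))\<^sup>2) \<partial>lborel) \<longlonglongrightarrow> (\<integral>\<^sup>+x. 0 \<partial>(lborel :: 'a measure))"
  proof (rule nn_integral_dominated_convergence[where w = "\<lambda>x. ennreal ((norm (f x))\<^sup>2)"])
    show "AE x in lborel. ennreal ((norm (f x - h (real M) x))\<^sup>2) \<le> ennreal ((norm (f x))\<^sup>2)" for M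
      by (auto simp: h_def)
    show "AE x in lborel. (\<lambda>M. ennreal ((norm (f x - h (real M) x))\<^sup>2)) \<longlonglongrightarrow> 0"
    proof (intro AE_I2 tendsto_eventually)
      fix x
      obtain M0 :: nat where "max (norm x) (norm (f x)) \<le> M0" using real_arch_simple by blast
      then show "eventually (\<lambda>M. ennreal ((norm (f x - h (real M) x))\<^sup>2) = 0) sequentially"
        by (intro eventually_sequentiallyI[of M0]) (auto simp: h_def)
    qed
  qed (use fin in auto)
  then have "eventually (\<lambda>M. sqint lborel (\<lambda>x. f x - h (real M) x) < ennreal (e / 4)) sequentially"
    using e by (intro order_tendstoD(2)) auto
  then obtain M :: nat where M: "sqint lborel (\<lambda>x. f x - h (real M) x) < ennreal (e / 4)"
    by (auto simp: eventually_sequentially)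
  have "h (real M) measurable_on UNIV"
    by (rule lebesgue_measurable_imp_measurable_on) (auto intro: measurable_completion)
  then obtain N g where N: "negligible N" and g: "\<And>n. continuous_on UNIV (g n)"
    and lim: "\<And>x. x \<notin> N \<Longrightarrow> (\<lambda>n. g n x) \<longlonglongrightarrow> h (real M) x"
    unfolding measurable_on_def by auto
  define k where "k n x = max 0 (min 1 (real M + 1 - norm x)) *\<^sub>R closest_point (cball 0 (real M)) (g n x)" for n and x :: 'a
  have k_cont: "continuous_on UNIV (k n)" for n
    unfolding k_def
    by (intro continuous_intros continuous_on_compose2[OF continuous_on_closest_point g]) auto
  then have [measurable]: "k n \<in> borel_measurable borel" for n
    by (intro borel_measurable_continuous_onI)
  have cp: "norm (closest_point (cball 0 (real M)) y) \<le> M" for y :: 'b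
    using closest_point_in_set[of "cball (0::'b) (real M)" y] by auto
  have k_out: "k n x = 0" if "x \<notin> cball 0 (real M + 1)" for n x
    using that by (auto simp: k_def)
  have k_le: "norm (k n x) \<le> M" for n x
    using cp[of "g n x"] mult_mono[of "\<bar>max 0 (min 1 (real M + 1 - norm x))\<bar>" 1 "norm (closest_point (cball 0 (real M)) (g n x))" M]
    by (simp add: k_def)
  have h_le: "norm (h (real M) x) \<le> M" for x by (simp add: h_def)
  have k_lim: "(\<lambda>n. k n x) \<longlonglongrightarrow> h (real M) x" if "x \<notin> N" for x
  proof -
    have "(\<lambda>n. closest_point (cball 0 (real M)) (g n x)) \<longlonglongrightarrow> closest_point (cball 0 (real M)) (h (real M) x)"
      by (intro isCont_tendsto_compose[OF _ lim[OF that]])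
        (auto intro: continuous_on_interior[OF continuous_on_closest_point[of "cball (0::'b) (real M)" UNIV]])
    also have "closest_point (cball 0 (real M)) (h (real M) x) = h (real M) x"
      using h_le by (intro closest_point_self) auto
    finally have "(\<lambda>n. k n x) \<longlonglongrightarrow> max 0 (min 1 (real M + 1 - norm x)) *\<^sub>R h (real M) x"
      unfolding k_def by (intro tendsto_intros)
    also have "max 0 (min 1 (real M + 1 - norm x)) *\<^sub>R h (real M) x = h (real M) x"
      by (auto simp: h_def)
    finally show ?thesis .
  qed
  have "(\<lambda>n. \<integral>\<^sup>+x. ennreal ((norm (h (real M) x - k n x))\<^sup>2) \<partial>lborel) \<longlonglongrightarrow> (\<integral>\<^sup>+x. 0 \<partial>(lborel :: 'a measure))"
  proof (rule nn_integral_dominated_convergence[where w = "\<lambda>x. ennreal ((2 * real M)\<^sup>2) * indicator (cball 0 (real M + 1)) x"])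
    show "AE x in lborel. ennreal ((norm (h (real M) x - k n x))\<^sup>2) \<le> ennreal ((2 * real M)\<^sup>2) * indicator (cball 0 (real M + 1)) x" for n
    proof (intro AE_I2)
      fix x
      have "norm (h (real M) x - k n x) \<le> 2 * real M"
        using norm_triangle_ineq4[of "h (real M) x" "k n x"] h_le[of x] k_le[of n x] by linarith
      then have "(norm (h (real M) x - k n x))\<^sup>2 \<le> (2 * real M)\<^sup>2" by (intro power_mono) auto
      moreover have "h (real M) x - k n x = 0" if "x \<notin> cball 0 (real M + 1)"
        using k_out[OF that] that by (auto simp: h_def)
      ultimately show "ennreal ((norm (h (real M) x - k n x))\<^sup>2) \<le> ennreal ((2 * real M)\<^sup>2) * indicator (cball 0 (real M + 1)) x"
        by (auto split: split_indicator intro: ennreal_leI)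
    qed
    have "AE x in lebesgue. x \<notin> N"
      using N by (simp add: negligible_iff_null_sets AE_not_in)
    then have "AE x in lborel. x \<notin> N" by (simp add: AE_completion_iff)
    then show "AE x in lborel. (\<lambda>n. ennreal ((norm (h (real M) x - k n x))\<^sup>2)) \<longlonglongrightarrow> 0"
    proof eventually_elim
      case (elim x)
      from tendsto_diff[OF tendsto_const[of "h (real M) x"] k_lim[OF elim]]
      have "(\<lambda>n. (norm (h (real M) x - k n x))\<^sup>2) \<longlonglongrightarrow> (norm (0::'b))\<^sup>2"
        by (intro tendsto_power tendsto_norm) simp
      then show ?case using tendsto_ennrealI by fastforce
    qed
    show "(\<integral>\<^sup>+x. ennreal ((2 * real M)\<^sup>2) * indicator (cball 0 (real M + 1)) x \<partial>(lborel::'a measure)) < \<infinity>"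
      using emeasure_bounded_finite[OF bounded_cball[of "0::'a" "real M + 1"]]
      by (subst nn_integral_cmult_indicator) (auto simp: ennreal_mult_less_top)
  qed (auto intro!: borel_measurable_times_ennreal borel_measurable_indicator)
  then have "eventually (\<lambda>n. sqint lborel (\<lambda>x. h (real M) x - k n x) < ennreal (e / 4)) sequentially"
    using e by (intro order_tendstoD(2)) auto
  then obtain n where n: "sqint lborel (\<lambda>x. h (real M) x - k n x) < ennreal (e / 4)"
    by (auto simp: eventually_sequentially)
  have "sqint lborel (\<lambda>x. f x - k n x)
      \<le> (\<integral>\<^sup>+x. 2 * ennreal ((norm (f x - h (real M) x))\<^sup>2) + 2 * ennreal ((norm (h (real M) x - k n x))\<^sup>2) \<partial>lborel)"
  proof (intro nn_integral_mono)
    fix x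
    have "ennreal ((norm (f x - k n x))\<^sup>2) \<le> ennreal (2 * (norm (f x - h (real M) x))\<^sup>2 + 2 * (norm (h (real M) x - k n x))\<^sup>2)"
      by (intro ennreal_leI norm_diff_square_le)
    then show "ennreal ((norm (f x - k n x))\<^sup>2) \<le> 2 * ennreal ((norm (f x - h (real M) x))\<^sup>2) + 2 * ennreal ((norm (h (real M) x - k n x))\<^sup>2)"
      by (simp add: ennreal_plus ennreal_mult)
  qed
  also have "\<dots> = 2 * sqint lborel (\<lambda>x. f x - h (real M) x) + 2 * sqint lborel (\<lambda>x. h (real M) x - k n x)"
    by (simp add: nn_integral_add nn_integral_cmult)
  also have "\<dots> < 2 * ennreal (e / 4) + 2 * ennreal (e / 4)"
    using M n by (intro add_strict_mono ennreal_mult_strict_left_mono) auto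
  also have "\<dots> = ennreal e"
    using e by (simp add: ennreal_plus[symmetric] ennreal_mult[symmetric] ennreal_numeral[symmetric] del: ennreal_plus ennreal_numeral)
  finally show ?thesis
    using k_cont k_out by (intro that[of "k n" "real M + 1"]) auto
qed

section \<open>Convolution with test functions\<close>

lemma test_functionsI:
  assumes "smooth_on UNIV \<phi>" "compact K" "K \<subseteq> \<Omega>" "\<And>x. x \<notin> K \<Longrightarrow> \<phi> x = 0"
  shows "\<phi> \<in> test_functions \<Omega>"
  using assms unfolding test_functions_def smooth_on_UNIV_iff[symmetric] by blast

lemma test_functionsE:
  assumes "\<phi> \<in> test_functions \<Omega>"
  obtains K where "smooth_on UNIV \<phi>" "compact K" "K \<subseteq> \<Omega>" "\<And>x. x \<notin> K \<Longrightarrow> \<phi> x = 0"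
  using assms unfolding test_functions_def smooth_on_UNIV_iff[symmetric] by blast

lemma test_functions_mono: "\<phi> \<in> test_functions \<Omega> \<Longrightarrow> \<Omega> \<subseteq> \<Omega>' \<Longrightarrow> \<phi> \<in> test_functions \<Omega>'"
  unfolding test_functions_def by blast

lemma frechet_derivative_eq_0_off_support:
  assumes "closed K" "\<And>x. x \<notin> K \<Longrightarrow> \<phi> x = 0" "x \<notin> K"
  shows "frechet_derivative \<phi> (at x) v = 0"
proof -
  have "frechet_derivative \<phi> (at x) = frechet_derivative (\<lambda>_. 0) (at x)"
    by (rule frechet_derivative_cong_open[of "- K"]) (use assms in auto)
  then show ?thesis by simp
qed

lemma test_functions_frechet_derivative:
  assumes "\<phi> \<in> test_functions \<Omega>"
  shows "(\<lambda>x. frechet_derivative \<phi> (at x) v) \<in> test_functions \<Omega>"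
proof -
  obtain K where K: "smooth_on UNIV \<phi>" "compact K" "K \<subseteq> \<Omega>" "\<And>x. x \<notin> K \<Longrightarrow> \<phi> x = 0"
    using assms by (rule test_functionsE) blast
  show ?thesis
    by (rule test_functionsI[OF smooth_on_frechet_derivative[OF K(1)] K(2,3)])
      (rule frechet_derivative_eq_0_off_support[OF compact_imp_closed[OF K(2)] K(4)])
qed

lemma test_functions_integrable: "\<phi> \<in> test_functions \<Omega> \<Longrightarrow> integrable lborel \<phi>"
  by (elim test_functionsE) (rule integrable_continuous_compact_support[OF smooth_on_continuous])

lemma continuous_compact_support_bounded:
  fixes f :: "'a::euclidean_space \<Rightarrow> 'b::euclidean_space"
  assumes "continuous_on UNIV f" "compact K" "\<And>x. x \<notin> K \<Longrightarrow> f x = 0"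
  obtains C where "C \<ge> 0" "\<And>x. norm (f x) \<le> C"
proof -
  have "bounded (f ` K)"
    by (intro compact_imp_bounded compact_continuous_image continuous_on_subset[OF assms(1)] assms(2)) auto
  then obtain C where C: "\<And>x. x \<in> K \<Longrightarrow> norm (f x) \<le> C" unfolding bounded_iff by blast
  have "norm (f x) \<le> max C 0" for x
    using C[of x] assms(3)[of x] by (cases "x \<in> K") auto
  then show ?thesis by (intro that[of "max C 0"]) auto
qed

lemma uniformly_continuous_compact_support:
  fixes f :: "'a::euclidean_space \<Rightarrow> 'b::euclidean_space"
  assumes "continuous_on UNIV f" "compact K" "\<And>x. x \<notin> K \<Longrightarrow> f x = 0" "e > 0"
  obtains d where "d > 0" "\<And>x y. norm (x - y) < d \<Longrightarrow> norm (f x - f y) < e"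
proof -
  obtain R where R: "K \<subseteq> cball 0 R"
    using bounded_subset_ballD[OF compact_imp_bounded[OF assms(2)], of 0] ball_subset_cball by blast
  have "uniformly_continuous_on (cball 0 (R + 1)) f"
    by (intro compact_uniformly_continuous continuous_on_subset[OF assms(1)]) auto
  then have "\<exists>d>0. \<forall>x\<in>cball 0 (R + 1). \<forall>y\<in>cball 0 (R + 1). dist y x < d \<longrightarrow> dist (f y) (f x) < e"
    using assms(4) by (simp add: uniformly_continuous_on_def)
  then obtain d where d: "d > 0"
    "\<And>x y. x \<in> cball 0 (R + 1) \<Longrightarrow> y \<in> cball 0 (R + 1) \<Longrightarrow> dist y x < d \<Longrightarrow> dist (f y) (f x) < e"
    by blast
  show ?thesis
  proof (rule that[of "min d 1"])
    show "min d 1 > 0" using d by simp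
    fix x y :: 'a assume xy: "norm (x - y) < min d 1"
    show "norm (f x - f y) < e"
    proof (cases "x \<in> cball 0 (R + 1) \<and> y \<in> cball 0 (R + 1)")
      case True
      then show ?thesis using d(2)[of y x] xy by (simp add: dist_norm)
    next
      case False
      then have "norm x > R + 1 \<or> norm y > R + 1" by (simp add: not_le)
      moreover have "norm x \<le> norm y + norm (x - y)" by (rule norm_triangle_sub)
      moreover have "norm y \<le> norm x + norm (x - y)" using norm_triangle_sub[of y x] by (simp only: norm_minus_commute)
      ultimately have "norm x > R" "norm y > R" using xy by linarith+
      then have "x \<notin> cball 0 R" "y \<notin> cball 0 R" by simp_all
      then have "f x = 0" "f y = 0" using R assms(3) by blast+
      then show ?thesis using assms(4) by simp
    qed
  qed
qed

text \<open>The remainder estimate is uniform in \<open>x\<close>, because the first derivatives of a test function are uniformly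
  continuous.  It allows differentiation under an integral sign against a merely integrable factor.\<close>

lemma test_function_uniform_linearization:
  fixes \<phi> :: "'a::euclidean_space \<Rightarrow> 'b::euclidean_space"
  assumes "\<phi> \<in> test_functions UNIV" and e: "e > 0"
  obtains d where "d > 0"
    "\<And>x k. norm k < d \<Longrightarrow> norm (\<phi> (x + k) - \<phi> x - frechet_derivative \<phi> (at x) k) \<le> e * norm k"
proof -
  let ?D = "\<lambda>x. frechet_derivative \<phi> (at x)"
  obtain K where K: "smooth_on UNIV \<phi>" "compact K" "K \<subseteq> UNIV" "\<And>x. x \<notin> K \<Longrightarrow> \<phi> x = 0"
    using assms(1) by (rule test_functionsE) blast
  define \<eta> where "\<eta> = e / DIM('a)"
  have \<eta>: "\<eta> > 0" using e by (simp add: \<eta>_def)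
  have "\<forall>b\<in>Basis. \<exists>d>0. \<forall>x y. norm (x - y) < d \<longrightarrow> norm (?D x b - ?D y b) < \<eta>"
  proof
    fix b :: 'a
    obtain d where "d > 0" "\<And>x y. norm (x - y) < d \<Longrightarrow> norm (?D x b - ?D y b) < \<eta>"
      by (rule uniformly_continuous_compact_support[OF
            smooth_on_continuous[OF smooth_on_frechet_derivative[OF K(1), of b]] K(2) _ \<eta>])
        (auto simp: frechet_derivative_eq_0_off_support[OF compact_imp_closed[OF K(2)] K(4)])
    then show "\<exists>d>0. \<forall>x y. norm (x - y) < d \<longrightarrow> norm (?D x b - ?D y b) < \<eta>" by blast
  qed
  from bchoice[OF this] obtain d where d: "\<And>b. b \<in> Basis \<Longrightarrow> d b > 0"
    "\<And>b x y. b \<in> Basis \<Longrightarrow> norm (x - y) < d b \<Longrightarrow> norm (?D x b - ?D y b) < \<eta>"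
    by blast
  define d0 where "d0 = Min (d ` Basis)"
  have d0: "d0 > 0" unfolding d0_def using d(1) by (subst Min_gr_iff) auto
  have d0_le: "d0 \<le> d b" if "b \<in> Basis" for b unfolding d0_def using that by (intro Min_le) auto
  show ?thesis
  proof (rule that[OF d0])
    fix x k :: 'a assume k: "norm k < d0"
    have der: "(\<phi> has_derivative ?D y) (at y)" for y by (rule smooth_onD[OF K(1)]) simp
    have lin: "bounded_linear (?D y)" for y by (rule has_derivative_bounded_linear[OF der])
    have on: "onorm (?D y - ?D x) \<le> e" if y: "norm (y - x) < d0" for y
    proof (rule onorm_le)
      fix v
      interpret y: bounded_linear "?D y" by (rule lin)
      interpret x: bounded_linear "?D x" by (rule lin)
      have "(?D y - ?D x) v = ?D y (\<Sum>b\<in>Basis. (v \<bullet> b) *\<^sub>R b) - ?D x (\<Sum>b\<in>Basis. (v \<bullet> b) *\<^sub>R b)"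
        by (simp add: euclidean_representation)
      also have "\<dots> = (\<Sum>b\<in>Basis. (v \<bullet> b) *\<^sub>R (?D y b - ?D x b))"
        by (simp only: x.sum y.sum x.scaleR y.scaleR sum_subtractf scaleR_diff_right)
      also have "norm \<dots> \<le> (\<Sum>b\<in>(Basis::'a set). norm v * \<eta>)"
      proof (rule sum_norm_le)
        fix b :: 'a assume b: "b \<in> Basis"
        have "norm (?D y b - ?D x b) \<le> \<eta>" using d(2)[OF b, of y x] d0_le[OF b] y by simp
        then show "norm ((v \<bullet> b) *\<^sub>R (?D y b - ?D x b)) \<le> norm v * \<eta>"
          using Basis_le_norm[OF b, of v] \<eta> by (simp add: mult_mono)
      qed
      also have "\<dots> = e * norm v" by (simp add: \<eta>_def)
      finally show "norm ((?D y - ?D x) v) \<le> e * norm v" .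
    qed
    have "norm (\<phi> (x + k) - \<phi> x - ?D x ((x + k) - x)) \<le> norm ((x + k) - x) * e"
    proof (rule differentiable_bound_linearization[where S = "ball x d0"])
      show "x + t *\<^sub>R (x + k - x) \<in> ball x d0" if "t \<in> {0..1}" for t
      proof -
        have "\<bar>t\<bar> * norm k \<le> 1 * norm k" using that by (intro mult_right_mono) auto
        then show ?thesis using k by (simp add: dist_norm)
      qed
      show "(\<phi> has_derivative ?D y) (at y within ball x d0)" for y
        by (rule has_derivative_at_withinI[OF der])
      show "onorm (?D y - ?D x) \<le> e" if "y \<in> ball x d0" for y
        using that by (intro on) (simp add: dist_norm norm_minus_commute)
    qed (simp add: d0)
    then show "norm (\<phi> (x + k) - \<phi> x - ?D x k) \<le> e * norm k" by (simp add: mult.commute)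
  qed
qed

text \<open>The kernel is centred at \<open>r x\<close> instead of \<open>x\<close>: for \<open>r < 1\<close> and a kernel of small support, the values
  on a ball around \<open>0\<close> depend on \<open>h\<close> in that ball only.\<close>

definition dilated_conv :: "('a::euclidean_space \<Rightarrow> complex) \<Rightarrow> ('a \<Rightarrow> complex) \<Rightarrow> real \<Rightarrow> 'a \<Rightarrow> complex" where
  "dilated_conv h \<phi> r x = (LINT u|lborel. h u * \<phi> (u - r *\<^sub>R x))"

lemma integrable_mult_test_function:
  assumes h: "integrable lborel h" and \<phi>: "\<phi> \<in> test_functions UNIV"
  shows "integrable lborel (\<lambda>u. h u * \<phi> (u - a) :: complex)"
proof -
  obtain K where K: "smooth_on UNIV \<phi>" "compact K" "K \<subseteq> UNIV" "\<And>x. x \<notin> K \<Longrightarrow> \<phi> x = 0"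
    using \<phi> by (rule test_functionsE) blast
  obtain C where C: "C \<ge> 0" "\<And>x. norm (\<phi> x) \<le> C"
    using continuous_compact_support_bounded[OF smooth_on_continuous[OF K(1)] K(2,4)] by blast
  have "continuous_on UNIV (\<lambda>u. \<phi> (u - a))"
    by (rule continuous_on_compose2[OF smooth_on_continuous[OF K(1)]]) (auto intro!: continuous_intros)
  then have [measurable]: "(\<lambda>u. \<phi> (u - a)) \<in> borel_measurable borel" by (rule borel_measurable_continuous_onI)
  have [measurable]: "h \<in> borel_measurable borel" using h by auto
  show ?thesis
  proof (rule Bochner_Integration.integrable_bound)
    show "integrable lborel (\<lambda>u. C * norm (h u))" using h by auto
    show "AE u in lborel. norm (h u * \<phi> (u - a)) \<le> norm (C * norm (h u))"
    proof (intro AE_I2)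
      fix u
      have "norm (h u) * norm (\<phi> (u - a)) \<le> norm (h u) * C" by (intro mult_left_mono C(2)) simp
      then show "norm (h u * \<phi> (u - a)) \<le> norm (C * norm (h u))"
        using C(1) by (simp add: norm_mult abs_mult mult.commute[of C])
    qed
  qed measurable
qed

lemma dilated_conv_has_derivative:
  fixes h \<phi> :: "'a::euclidean_space \<Rightarrow> complex"
  assumes h: "integrable lborel h" and \<phi>: "\<phi> \<in> test_functions UNIV"
  shows "(dilated_conv h \<phi> r has_derivative
           (\<lambda>v. dilated_conv h (\<lambda>y. frechet_derivative \<phi> (at y) (- (r *\<^sub>R v))) r x)) (at x)"
proof -
  let ?D = "\<lambda>x. frechet_derivative \<phi> (at x)"
  obtain K where K: "smooth_on UNIV \<phi>" using \<phi> by (rule test_functionsE) blast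
  have der: "(\<phi> has_derivative ?D y) (at y)" for y by (rule smooth_onD[OF K]) simp
  have lin: "bounded_linear (?D y)" for y by (rule has_derivative_bounded_linear[OF der])
  have int: "integrable lborel (\<lambda>u. h u * ?D (u - a) v)" for a v
    by (rule integrable_mult_test_function[OF h test_functions_frechet_derivative[OF \<phi>]])
  have int0: "integrable lborel (\<lambda>u. h u * \<phi> (u - a))" for a
    by (rule integrable_mult_test_function[OF h \<phi>])
  let ?L = "\<lambda>v. dilated_conv h (\<lambda>y. ?D y (- (r *\<^sub>R v))) r x"
  have "linear ?L"
  proof (rule linearI)
    fix v w :: 'a and c :: real
    have "?D y (- (r *\<^sub>R (v + w))) = ?D y (- (r *\<^sub>R v)) + ?D y (- (r *\<^sub>R w))" for y
    proof -
      interpret bounded_linear "?D y" by (rule lin)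
      show ?thesis by (simp add: scaleR_add_right add diff neg)
    qed
    then have "?L (v + w) = (LINT u|lborel. h u * ?D (u - r *\<^sub>R x) (- (r *\<^sub>R v)) + h u * ?D (u - r *\<^sub>R x) (- (r *\<^sub>R w)))"
      unfolding dilated_conv_def by (simp only: distrib_left)
    also have "\<dots> = ?L v + ?L w"
      unfolding dilated_conv_def by (rule Bochner_Integration.integral_add[OF int int])
    finally show "?L (v + w) = ?L v + ?L w" .
    have "?D y (- (r *\<^sub>R c *\<^sub>R v)) = of_real c * ?D y (- (r *\<^sub>R v))" for y
    proof -
      interpret bounded_linear "?D y" by (rule lin)
      have "- (r *\<^sub>R c *\<^sub>R v) = c *\<^sub>R (- (r *\<^sub>R v))" by simp
      then show ?thesis by (simp only: scaleR) (simp add: scaleR_conv_of_real)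
    qed
    then have "?L (c *\<^sub>R v) = (LINT u|lborel. of_real c * (h u * ?D (u - r *\<^sub>R x) (- (r *\<^sub>R v))))"
      unfolding dilated_conv_def by (simp only: mult.left_commute)
    also have "\<dots> = of_real c * ?L v" unfolding dilated_conv_def by (rule integral_mult_right_zero)
    finally show "?L (c *\<^sub>R v) = c *\<^sub>R ?L v" by (simp add: scaleR_conv_of_real)
  qed
  then have bl: "bounded_linear ?L" by (simp add: linear_conv_bounded_linear)
  show ?thesis
    unfolding has_derivative_at_alt
  proof (intro conjI bl allI impI)
    fix e :: real assume e: "e > 0"
    define J where "J = (LINT u|lborel. norm (h u))"
    have J: "J \<ge> 0" by (simp add: J_def)
    \<comment> \<open>The increment of the argument of \<open>\<phi>\<close> is at most \<open>|r|\<close> times that of \<open>x\<close>; adding \<open>1\<close> avoids division by zero.\<close>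
    define e' where "e' = e / ((\<bar>r\<bar> + 1) * (J + 1))"
    have e': "e' > 0" using e J by (simp add: e'_def)
    obtain d where d: "d > 0" "\<And>x k. norm k < d \<Longrightarrow> norm (\<phi> (x + k) - \<phi> x - ?D x k) \<le> e' * norm k"
      using test_function_uniform_linearization[OF \<phi> e'] by blast
    show "\<exists>d>0. \<forall>y. norm (y - x) < d \<longrightarrow>
        norm (dilated_conv h \<phi> r y - dilated_conv h \<phi> r x - ?L (y - x)) \<le> e * norm (y - x)"
    proof (intro exI[of _ "d / (\<bar>r\<bar> + 1)"] conjI allI impI)
      show "d / (\<bar>r\<bar> + 1) > 0" using d by simp
      fix y assume y: "norm (y - x) < d / (\<bar>r\<bar> + 1)"
      define k where "k = - (r *\<^sub>R (y - x))"
      have k_le: "norm k \<le> (\<bar>r\<bar> + 1) * norm (y - x)" by (simp add: k_def distrib_right)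
      also have "\<dots> < d" using y by (simp add: pos_less_divide_eq mult.commute)
      finally have k: "norm k < d" .
      have eq: "u - r *\<^sub>R y = (u - r *\<^sub>R x) + k" for u by (simp add: k_def algebra_simps)
      have "dilated_conv h \<phi> r y - dilated_conv h \<phi> r x - ?L (y - x)
          = (LINT u|lborel. h u * \<phi> (u - r *\<^sub>R y) - h u * \<phi> (u - r *\<^sub>R x) - h u * ?D (u - r *\<^sub>R x) k)"
        unfolding dilated_conv_def k_def
        by (simp only: Bochner_Integration.integral_diff int int0 Bochner_Integration.integrable_diff)
      also have "\<dots> = (LINT u|lborel. h u * (\<phi> ((u - r *\<^sub>R x) + k) - \<phi> (u - r *\<^sub>R x) - ?D (u - r *\<^sub>R x) k))"
        by (simp only: eq right_diff_distrib)
      finally have "norm (dilated_conv h \<phi> r y - dilated_conv h \<phi> r x - ?L (y - x))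
          = norm (LINT u|lborel. h u * (\<phi> ((u - r *\<^sub>R x) + k) - \<phi> (u - r *\<^sub>R x) - ?D (u - r *\<^sub>R x) k))"
        by (rule arg_cong)
      also have "\<dots> \<le> (LINT u|lborel. norm (h u * (\<phi> ((u - r *\<^sub>R x) + k) - \<phi> (u - r *\<^sub>R x) - ?D (u - r *\<^sub>R x) k)))"
        by (rule integral_norm_bound)
      also have "\<dots> \<le> (LINT u|lborel. norm (h u) * (e' * norm k))"
      proof (rule integral_mono)
        have "integrable lborel (\<lambda>u. h u * \<phi> (u - r *\<^sub>R y) - h u * \<phi> (u - r *\<^sub>R x) - h u * ?D (u - r *\<^sub>R x) k)"
          by (intro Bochner_Integration.integrable_diff int int0)
        then show "integrable lborel (\<lambda>u. norm (h u * (\<phi> ((u - r *\<^sub>R x) + k) - \<phi> (u - r *\<^sub>R x) - ?D (u - r *\<^sub>R x) k)))"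
          by (intro integrable_norm) (simp only: eq right_diff_distrib)
        show "integrable lborel (\<lambda>u. norm (h u) * (e' * norm k))" using h by auto
        show "norm (h u * (\<phi> ((u - r *\<^sub>R x) + k) - \<phi> (u - r *\<^sub>R x) - ?D (u - r *\<^sub>R x) k)) \<le> norm (h u) * (e' * norm k)" for u
          unfolding norm_mult by (intro mult_left_mono d(2) k) simp
      qed
      also have "\<dots> = J * (e' * norm k)" by (simp add: J_def)
      also have "\<dots> \<le> (J + 1) * (e' * ((\<bar>r\<bar> + 1) * norm (y - x)))"
        using J e' k_le by (intro mult_mono) auto
      also have "\<dots> = e * norm (y - x)" 
      proof -
        have "(J + 1) * (e / (q * (J + 1)) * (q * t)) = e * t" if "q > 0" for q t
          using J that by simp
        from this[of "\<bar>r\<bar> + 1" "norm (y - x)"] show ?thesis unfolding e'_def by simp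
      qed
      finally show "norm (dilated_conv h \<phi> r y - dilated_conv h \<phi> r x - ?L (y - x)) \<le> e * norm (y - x)" .
    qed
  qed
qed

text \<open>Each directional derivative is again a dilated convolution of \<open>h\<close> with a test function.\<close>

lemma smooth_dilated_conv:
  fixes h \<phi> :: "'a::euclidean_space \<Rightarrow> complex"
  assumes h: "integrable lborel h" and \<phi>: "\<phi> \<in> test_functions UNIV"
  shows "smooth_on UNIV (dilated_conv h \<phi> r)"
  unfolding smooth_on_def
proof
  fix k show "Ck_on k UNIV (dilated_conv h \<phi> r)"
    using \<phi>
  proof (induction k arbitrary: \<phi>)
    case 0
    then show ?case
      using dilated_conv_has_derivative[OF h, of \<phi> r]
      by (auto intro!: continuous_at_imp_continuous_on has_derivative_continuous)
  next
    case (Suc k)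
    show ?case
      by (rule Ck_on_SucI[OF open_UNIV dilated_conv_has_derivative[OF h Suc.prems]])
        (rule Suc.IH[OF test_functions_frechet_derivative[OF Suc.prems]])
  qed
qed

lemma integral_lborel_shift:
  fixes f :: "'a::euclidean_space \<Rightarrow> 'b::euclidean_space"
  assumes [measurable]: "f \<in> borel_measurable borel"
  shows "(LINT u|lborel. f (u - x)) = (LINT u|lborel. f u)"
proof -
  have "(LINT u|lborel. f u) = (LINT u|distr lborel borel ((+) (- x)). f u)" by (simp only: lborel_distr_plus)
  also have "\<dots> = (LINT u|lborel. f (- x + u))" by (rule integral_distr) auto
  finally show ?thesis by simp
qed

lemma nn_integral_lborel_shift:
  fixes f :: "'a::euclidean_space \<Rightarrow> ennreal"
  assumes [measurable]: "f \<in> borel_measurable borel"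
  shows "(\<integral>\<^sup>+u. f (u - x) \<partial>lborel) = (\<integral>\<^sup>+u. f u \<partial>lborel)"
proof -
  have "(\<integral>\<^sup>+u. f u \<partial>lborel) = (\<integral>\<^sup>+u. f u \<partial>distr lborel borel ((+) (- x)))" by (simp only: lborel_distr_plus)
  also have "\<dots> = (\<integral>\<^sup>+u. f (- x + u) \<partial>lborel)" by (rule nn_integral_distr) auto
  finally show ?thesis by simp
qed

text \<open>Translation invariance of Lebesgue measure makes \<open>\<integral> \<phi>(u - x) du\<close> independent of \<open>x\<close>;
  near \<open>x = 0\<close> it is a convolution with the indicator of a large ball, whose derivative is known.\<close>

lemma integral_frechet_derivative_test_function:
  fixes \<phi> :: "'a::euclidean_space \<Rightarrow> complex"
  assumes \<phi>: "\<phi> \<in> test_functions UNIV"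
  shows "(LINT x|lborel. frechet_derivative \<phi> (at x) v) = 0"
proof -
  obtain K where K: "smooth_on UNIV \<phi>" "compact K" "K \<subseteq> UNIV" "\<And>x. x \<notin> K \<Longrightarrow> \<phi> x = 0"
    using \<phi> by (rule test_functionsE) blast
  obtain R where R: "K \<subseteq> cball 0 R"
    using bounded_subset_ballD[OF compact_imp_bounded[OF K(2)], of 0] ball_subset_cball by blast
  define h where "h u = complex_of_real (indicator (cball 0 (R + 1)) u)" for u :: 'a
  have h: "integrable lborel h"
    unfolding h_def using emeasure_bounded_finite[OF bounded_cball[of "0::'a" "R + 1"]]
    by (intro integrable_of_real) (auto simp: integrable_indicator_iff)
  have [measurable]: "\<phi> \<in> borel_measurable borel"
    by (intro borel_measurable_continuous_onI smooth_on_continuous K)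
  have const: "dilated_conv h \<phi> 1 x = (LINT u|lborel. \<phi> u)" if "x \<in> ball 0 1" for x
  proof -
    have "h u * \<phi> (u - x) = \<phi> (u - x)" for u
    proof (cases "u \<in> cball 0 (R + 1)")
      case False
      have "norm u \<le> norm (u - x) + norm x" using norm_triangle_sub[of u x] by simp
      with False that have "u - x \<notin> cball 0 R" by auto
      then have "u - x \<notin> K" using R by blast
      then show ?thesis by (simp add: K(4))
    qed (simp add: h_def)
    then have "(\<lambda>u. h u * \<phi> (u - 1 *\<^sub>R x)) = (\<lambda>u. \<phi> (u - x))" by (intro ext) (simp only: scaleR_one)
    then show ?thesis unfolding dilated_conv_def by (simp only:) (rule integral_lborel_shift, simp)
  qed
  have "(dilated_conv h \<phi> 1 has_derivative (\<lambda>v. 0)) (at 0)"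
    by (rule has_derivative_transform_within_open[of "\<lambda>_. LINT u|lborel. \<phi> u" _ _ _ "ball 0 1"])
      (auto simp: const)
  then have "dilated_conv h (\<lambda>y. frechet_derivative \<phi> (at y) (- (1 *\<^sub>R (- v)))) 1 0 = 0"
    by (rule fun_cong[OF has_derivative_unique[OF dilated_conv_has_derivative[OF h \<phi>, of 1 0]]])
  also have "dilated_conv h (\<lambda>y. frechet_derivative \<phi> (at y) (- (1 *\<^sub>R (- v)))) 1 0
      = (LINT u|lborel. h u * frechet_derivative \<phi> (at u) v)"
    by (simp add: dilated_conv_def)
  also have "(\<lambda>u. h u * frechet_derivative \<phi> (at u) v) = (\<lambda>u. frechet_derivative \<phi> (at u) v)"
  proof
    fix u
    have "R \<le> R + 1" by simp
    then have "K \<subseteq> cball 0 (R + 1)" using R subset_cball by blast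
    then show "h u * frechet_derivative \<phi> (at u) v = frechet_derivative \<phi> (at u) v"
      using frechet_derivative_eq_0_off_support[OF compact_imp_closed[OF K(2)] K(4), where x = u and v = v]
      by (cases "u \<in> K") (auto simp: h_def)
  qed
  finally show ?thesis .
qed

section \<open>Mollification in the mean\<close>

lemma nn_integral_lborel_dilate:
  fixes f :: "'a::euclidean_space \<Rightarrow> ennreal"
  assumes [measurable]: "f \<in> borel_measurable borel" and r: "r > 0"
  shows "(\<integral>\<^sup>+y. f y \<partial>lborel) = ennreal (r ^ DIM('a)) * (\<integral>\<^sup>+x. f (u - r *\<^sub>R x) \<partial>lborel)"
proof -
  have "(\<integral>\<^sup>+y. f y \<partial>lborel)
      = (\<integral>\<^sup>+y. f y \<partial>density (distr lborel borel (\<lambda>x. u + (- r) *\<^sub>R x)) (\<lambda>_. \<bar>- r\<bar> ^ DIM('a)))"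
    using r by (subst lborel_affine[of "- r" u, symmetric]) auto
  also have "\<dots> = (\<integral>\<^sup>+y. ennreal (r ^ DIM('a)) * f y \<partial>distr lborel borel (\<lambda>x. u + (- r) *\<^sub>R x))"
    using r by (subst nn_integral_density) auto
  also have "\<dots> = (\<integral>\<^sup>+x. ennreal (r ^ DIM('a)) * f (u - r *\<^sub>R x) \<partial>lborel)"
    by (subst nn_integral_distr) auto
  also have "\<dots> = ennreal (r ^ DIM('a)) * (\<integral>\<^sup>+x. f (u - r *\<^sub>R x) \<partial>lborel)"
    by (rule nn_integral_cmult) measurable
  finally show ?thesis .
qed

locale mollifying_kernel =
  fixes \<kappa> :: "'a::euclidean_space \<Rightarrow> real" and \<delta> :: real
  assumes smooth: "smooth_on UNIV \<kappa>" and nonneg: "\<And>y. \<kappa> y \<ge> 0"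
    and support: "\<And>y. norm y > \<delta> \<Longrightarrow> \<kappa> y = 0"
    and integrable: "integrable lborel \<kappa>" and integral: "(LINT y|lborel. \<kappa> y) = 1"
begin

lemma measurable_kernel [measurable]: "\<kappa> \<in> borel_measurable borel"
  by (intro borel_measurable_continuous_onI smooth_on_continuous smooth)

lemma test_function: "(\<lambda>y. complex_of_real (\<kappa> y)) \<in> test_functions UNIV"
  by (rule test_functionsI[of _ "cball 0 \<delta>"])
    (auto intro!: smooth_on_linear[OF bounded_linear_of_real] smooth support)

lemma nn_integral_kernel: "(\<integral>\<^sup>+y. ennreal (\<kappa> y) \<partial>lborel) = 1"
  by (subst nn_integral_eq_integral) (auto simp: integrable integral nonneg)

abbreviation smoothing :: "('a \<Rightarrow> complex) \<Rightarrow> real \<Rightarrow> 'a \<Rightarrow> complex" where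
  "smoothing h r \<equiv> dilated_conv h (\<lambda>y. complex_of_real (\<kappa> y)) r"

text \<open>Cauchy-Schwarz for the probability density \<open>\<kappa>\<close>, split as \<open>\<surd>\<kappa> \<surd>\<kappa>\<close>.\<close>

lemma norm_smoothing_square_le:
  assumes h: "integrable lborel h"
  shows "ennreal ((norm (smoothing h r x))\<^sup>2)
      \<le> (\<integral>\<^sup>+u. ennreal ((norm (h u))\<^sup>2) * ennreal (\<kappa> (u - r *\<^sub>R x)) \<partial>lborel)"
proof -
  have [measurable]: "h \<in> borel_measurable borel" using h by auto
  let ?k = "\<lambda>u. \<kappa> (u - r *\<^sub>R x)"
  have "ennreal (norm (smoothing h r x)) \<le> (\<integral>\<^sup>+u. ennreal (norm (h u * complex_of_real (?k u))) \<partial>lborel)"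
    unfolding dilated_conv_def
    by (rule integral_norm_bound_ennreal[OF integrable_mult_test_function[OF h test_function]])
  also have "\<dots> = (\<integral>\<^sup>+u. ennreal (norm (h u) * sqrt (?k u)) * ennreal (sqrt (?k u)) \<partial>lborel)"
    by (intro nn_integral_cong) (simp add: norm_mult nonneg mult.assoc flip: ennreal_mult)
  finally have "(ennreal (norm (smoothing h r x)))\<^sup>2
      \<le> (\<integral>\<^sup>+u. ennreal (norm (h u) * sqrt (?k u)) * ennreal (sqrt (?k u)) \<partial>lborel)\<^sup>2"
    by (rule power_mono) simp
  also have "\<dots> \<le> (\<integral>\<^sup>+u. (ennreal (norm (h u) * sqrt (?k u)))\<^sup>2 \<partial>lborel) * (\<integral>\<^sup>+u. (ennreal (sqrt (?k u)))\<^sup>2 \<partial>lborel)"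
    by (rule Cauchy_Schwarz_nn_integral) measurable
  also have "(\<integral>\<^sup>+u. (ennreal (sqrt (?k u)))\<^sup>2 \<partial>lborel) = (\<integral>\<^sup>+u. ennreal (?k u) \<partial>lborel)"
    by (intro nn_integral_cong) (simp add: nonneg ennreal_power)
  also have "\<dots> = 1"
    using nn_integral_lborel_shift[of "\<lambda>y. ennreal (\<kappa> y)" "r *\<^sub>R x"] nn_integral_kernel by simp
  also have "(\<integral>\<^sup>+u. (ennreal (norm (h u) * sqrt (?k u)))\<^sup>2 \<partial>lborel)
      = (\<integral>\<^sup>+u. ennreal ((norm (h u))\<^sup>2) * ennreal (?k u) \<partial>lborel)"
    by (intro nn_integral_cong) (simp add: nonneg ennreal_power power_mult_distrib flip: ennreal_mult)
  finally show ?thesis by (simp add: ennreal_power)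
qed

text \<open>By Tonelli the pointwise bound integrates to the squared \<open>L\<^sup>2\<close> norm of \<open>h\<close> times the integral of \<open>\<kappa>(u - r x)\<close> over \<open>x\<close>,
  which is \<open>r\<close> to the power minus the dimension.\<close>

lemma L2_norm_smoothing_le:
  assumes h: "integrable lborel h" and r: "r > 0"
  shows "ennreal (r ^ DIM('a)) * sqint lborel (\<lambda>x. smoothing h r x)
      \<le> sqint lborel h"
proof -
  have [measurable]: "h \<in> borel_measurable borel" using h by auto
  have "sqint lborel (\<lambda>x. smoothing h r x)
      \<le> (\<integral>\<^sup>+x. \<integral>\<^sup>+u. ennreal ((norm (h u))\<^sup>2) * ennreal (\<kappa> (u - r *\<^sub>R x)) \<partial>lborel \<partial>lborel)"
    by (intro nn_integral_mono norm_smoothing_square_le h)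
  also have "\<dots> = (\<integral>\<^sup>+u. \<integral>\<^sup>+x. ennreal ((norm (h u))\<^sup>2) * ennreal (\<kappa> (u - r *\<^sub>R x)) \<partial>lborel \<partial>lborel)"
    by (rule lborel_pair.Fubini') measurable
  also have "\<dots> = (\<integral>\<^sup>+u. ennreal ((norm (h u))\<^sup>2) * (\<integral>\<^sup>+x. ennreal (\<kappa> (u - r *\<^sub>R x)) \<partial>lborel) \<partial>lborel)"
    by (intro nn_integral_cong nn_integral_cmult) measurable
  finally have "ennreal (r ^ DIM('a)) * sqint lborel (\<lambda>x. smoothing h r x)
      \<le> ennreal (r ^ DIM('a)) * (\<integral>\<^sup>+u. ennreal ((norm (h u))\<^sup>2) * (\<integral>\<^sup>+x. ennreal (\<kappa> (u - r *\<^sub>R x)) \<partial>lborel) \<partial>lborel)"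
    by (rule mult_left_mono) simp
  also have "\<dots> = (\<integral>\<^sup>+u. ennreal (r ^ DIM('a)) * (ennreal ((norm (h u))\<^sup>2) * (\<integral>\<^sup>+x. ennreal (\<kappa> (u - r *\<^sub>R x)) \<partial>lborel)) \<partial>lborel)"
    by (rule nn_integral_cmult[symmetric]) measurable
  also have "\<dots> = sqint lborel h"
  proof (rule nn_integral_cong)
    fix u
    have "ennreal (r ^ DIM('a)) * (\<integral>\<^sup>+x. ennreal (\<kappa> (u - r *\<^sub>R x)) \<partial>lborel) = 1"
      using nn_integral_lborel_dilate[of "\<lambda>y. ennreal (\<kappa> y)" r u] r nn_integral_kernel by simp
    then show "ennreal (r ^ DIM('a)) * (ennreal ((norm (h u))\<^sup>2) * (\<integral>\<^sup>+x. ennreal (\<kappa> (u - r *\<^sub>R x)) \<partial>lborel)) = ennreal ((norm (h u))\<^sup>2)"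
      by (simp only: mult.left_commute[of "ennreal (r ^ DIM('a))"] mult_1_right)
  qed
  finally show ?thesis .
qed

lemma norm_smoothing_diff_le:
  assumes g: "integrable lborel g"
    and osc: "\<And>u. norm (u - r *\<^sub>R x) \<le> \<delta> \<Longrightarrow> norm (g u - g x) \<le> \<eta>"
  shows "norm (smoothing g r x - g x) \<le> \<eta>"
proof -
  let ?k = "\<lambda>u. \<kappa> (u - r *\<^sub>R x)"
  have ik: "integrable lborel ?k"
  proof -
    have "integrable lborel \<kappa>" by (rule integrable)
    then have "integrable (distr lborel borel ((+) (- (r *\<^sub>R x)))) \<kappa>" by (simp only: lborel_distr_plus)
    then show ?thesis by (subst (asm) integrable_distr_eq) auto
  qed
  have k1: "(LINT u|lborel. ?k u) = 1" using integral_lborel_shift[of \<kappa> "r *\<^sub>R x"] integral by simp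
  have igk: "integrable lborel (\<lambda>u. g u * complex_of_real (?k u))"
    by (rule integrable_mult_test_function[OF g test_function])
  have ick: "integrable lborel (\<lambda>u. g x * complex_of_real (?k u))"
    using ik by (intro integrable_mult_right integrable_of_real) auto
  have "smoothing g r x - g x = (LINT u|lborel. g u * complex_of_real (?k u)) - (LINT u|lborel. g x * complex_of_real (?k u))"
    by (simp add: dilated_conv_def k1)
  also have "\<dots> = (LINT u|lborel. g u * complex_of_real (?k u) - g x * complex_of_real (?k u))"
    by (rule Bochner_Integration.integral_diff[OF igk ick, symmetric])
  finally have "norm (smoothing g r x - g x) = norm (LINT u|lborel. g u * complex_of_real (?k u) - g x * complex_of_real (?k u))"
    by (rule arg_cong)
  also have "\<dots> \<le> (LINT u|lborel. norm (g u * complex_of_real (?k u) - g x * complex_of_real (?k u)))"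
    by (rule integral_norm_bound)
  also have "\<dots> \<le> (LINT u|lborel. \<eta> * ?k u)"
  proof (rule integral_mono)
    show "integrable lborel (\<lambda>u. norm (g u * complex_of_real (?k u) - g x * complex_of_real (?k u)))"
      using igk ick by (intro integrable_norm Bochner_Integration.integrable_diff)
    show "integrable lborel (\<lambda>u. \<eta> * ?k u)" using ik by simp
    fix u
    have "norm (g u * complex_of_real (?k u) - g x * complex_of_real (?k u)) = norm (g u - g x) * ?k u"
      by (simp add: nonneg norm_mult flip: left_diff_distrib)
    also have "\<dots> \<le> \<eta> * ?k u"
    proof (cases "norm (u - r *\<^sub>R x) \<le> \<delta>")
      case True
      then show ?thesis by (intro mult_right_mono osc nonneg)
    next
      case False
      then show ?thesis using support[of "u - r *\<^sub>R x"] by simp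
    qed
    finally show "norm (g u * complex_of_real (?k u) - g x * complex_of_real (?k u)) \<le> \<eta> * ?k u" .
  qed
  also have "\<dots> = \<eta>" by (simp add: k1)
  finally show ?thesis .
qed

end

lemma nn_integral_linear_combination:
  assumes [measurable]: "f \<in> borel_measurable M" "g \<in> borel_measurable M" "k \<in> borel_measurable M"
  shows "(\<integral>\<^sup>+x. c * f x + g x + d * k x \<partial>M) = c * (\<integral>\<^sup>+x. f x \<partial>M) + (\<integral>\<^sup>+x. g x \<partial>M) + d * (\<integral>\<^sup>+x. k x \<partial>M)"
  by (simp add: nn_integral_add nn_integral_cmult)

text \<open>Smoothing is bounded in \<open>L\<^sup>2\<close> uniformly for \<open>\<delta> \<le> 1/2\<close>, and it converges uniformly on \<open>U\<close> for continuous functions of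
  compact support, which are dense.\<close>

lemma smoothing_tendsto_L2:
  fixes h :: "'a::euclidean_space \<Rightarrow> complex"
  assumes h: "integrable lborel h" and h2: "sqint lborel h < \<infinity>"
    and U: "bounded U" "U \<in> sets borel" and e: "e > 0"
  obtains d where "d > 0"
    "\<And>\<kappa> \<delta>. mollifying_kernel \<kappa> \<delta> \<Longrightarrow> 0 < \<delta> \<Longrightarrow> \<delta> < d \<Longrightarrow>
       (\<integral>\<^sup>+x. ennreal (indicator U x * (norm (dilated_conv h (\<lambda>y. complex_of_real (\<kappa> y)) (1 - \<delta>) x - h x))\<^sup>2) \<partial>lborel) < ennreal e"
proof -
  have [measurable]: "h \<in> borel_measurable borel" using h by auto
  note U(2)[measurable]
  \<comment> \<open>With \<open>|Sh - h|\<^sup>2 \<le> 2|S(h - g)|\<^sup>2 + 4|Sg - g|\<^sup>2 + 4|g - h|\<^sup>2\<close> and \<open>r \<ge> 1/2\<close>, the two terms with \<open>h - g\<close>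
    contribute \<open>A e1 = e/2\<close>, and \<open>\<eta>\<close> is chosen so that the remaining one contributes less than \<open>e/2\<close>.\<close>
  define A where "A = 2 * 2 ^ DIM('a) + (4::real)"
  have A: "A > 0" by (simp add: A_def add_pos_pos)
  define e1 where "e1 = e / (2 * A)"
  have e1: "e1 > 0" using e A by (simp add: e1_def)
  obtain g R where g: "continuous_on UNIV g" "\<And>x. x \<notin> cball 0 R \<Longrightarrow> g x = 0"
    "sqint lborel (\<lambda>x. h x - g x) < ennreal e1"
    using L2_continuous_dense[OF _ h2 e1] by auto
  have [measurable]: "g \<in> borel_measurable borel" by (rule borel_measurable_continuous_onI[OF g(1)])
  have ig: "integrable lborel g" by (rule integrable_continuous_compact_support[OF g(1) compact_cball g(2)])
  obtain B where B: "B > 0" "U \<subseteq> ball 0 B" using bounded_subset_ballD[OF U(1)] by blast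
  define V where "V = measure lborel U"
  have V: "emeasure lborel U = ennreal V" "V \<ge> 0"
    unfolding V_def using emeasure_bounded_finite[OF U(1)] by (auto intro!: emeasure_eq_ennreal_measure)
  define \<eta> where "\<eta> = sqrt (e / (8 * (V + 1)))"
  have \<eta>: "\<eta> > 0" "\<eta>\<^sup>2 = e / (8 * (V + 1))" using e V(2) by (auto simp: \<eta>_def)
  obtain d where d: "d > 0" "\<And>x y. norm (x - y) < d \<Longrightarrow> norm (g x - g y) < \<eta>"
    using uniformly_continuous_compact_support[OF g(1) compact_cball g(2) \<eta>(1)] by blast
  show ?thesis
  proof (rule that[of "min (1 / 2) (d / (1 + B))"])
    show "min (1 / 2) (d / (1 + B)) > 0" using d(1) B(1) by simp
    fix \<kappa> :: "'a \<Rightarrow> real" and \<delta> :: real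
    assume ker: "mollifying_kernel \<kappa> \<delta>" and \<delta>: "0 < \<delta>" "\<delta> < min (1 / 2) (d / (1 + B))"
    interpret mollifying_kernel \<kappa> \<delta> by (rule ker)
    define r where "r = 1 - \<delta>"
    have r: "1 / 2 < r" "r > 0" using \<delta> by (auto simp: r_def)
    have \<delta>d: "\<delta> * (1 + B) < d" using \<delta>(2) B(1) by (simp add: pos_less_divide_eq)
    have ihg: "integrable lborel (\<lambda>x. h x - g x)" using h ig by simp
    have cont: "continuous_on UNIV (smoothing k r)" if "integrable lborel k" for k
      by (rule smooth_on_continuous[OF smooth_dilated_conv[OF that test_function]])
    have [measurable]: "smoothing k r \<in> borel_measurable borel" if "integrable lborel k" for k
      by (rule borel_measurable_continuous_onI[OF cont[OF that]])
    note [measurable] = this[OF h] this[OF ig] this[OF ihg]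
    have diff: "smoothing (\<lambda>x. h x - g x) r x = smoothing h r x - smoothing g r x" for x
      unfolding dilated_conv_def left_diff_distrib
      by (rule Bochner_Integration.integral_diff[OF integrable_mult_test_function[OF h test_function]
            integrable_mult_test_function[OF ig test_function]])
    have near: "norm (smoothing g r x - g x) \<le> \<eta>" if "x \<in> U" for x
    proof (rule norm_smoothing_diff_le[OF ig])
      fix u assume u: "norm (u - r *\<^sub>R x) \<le> \<delta>"
      have "norm (u - x) \<le> norm (u - r *\<^sub>R x) + norm (\<delta> *\<^sub>R x)"
        using norm_triangle_ineq4[of "u - r *\<^sub>R x" "\<delta> *\<^sub>R x"] by (simp add: r_def algebra_simps)
      also have "\<dots> \<le> \<delta> + \<delta> * B"
        using u that B(2) \<delta>(1) by (intro add_mono) (auto simp: subset_iff intro!: mult_left_mono less_imp_le)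
      also have "\<dots> < d" using \<delta>d by (simp add: distrib_left)
      finally show "norm (g u - g x) \<le> \<eta>" using d(2) by (simp add: less_imp_le)
    qed
    have pt: "indicator U x * (norm (smoothing h r x - h x))\<^sup>2
        \<le> 2 * (norm (smoothing (\<lambda>x. h x - g x) r x))\<^sup>2 + 4 * \<eta>\<^sup>2 * indicator U x + 4 * (norm (h x - g x))\<^sup>2" for x
    proof (cases "x \<in> U")
      case True
      have "(norm (smoothing h r x - h x))\<^sup>2
          \<le> 2 * (norm (smoothing h r x - smoothing g r x))\<^sup>2 + 2 * (norm (smoothing g r x - h x))\<^sup>2"
        by (rule norm_diff_square_le)
      moreover have "(norm (smoothing g r x - h x))\<^sup>2 \<le> 2 * (norm (smoothing g r x - g x))\<^sup>2 + 2 * (norm (g x - h x))\<^sup>2"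
        by (rule norm_diff_square_le)
      moreover have "(norm (smoothing g r x - g x))\<^sup>2 \<le> \<eta>\<^sup>2"
        using near[OF True] by (intro power_mono) auto
      ultimately show ?thesis using True by (simp add: diff norm_minus_commute[of "g x"])
    next
      case False
      then show ?thesis by simp
    qed
    have "(\<integral>\<^sup>+x. ennreal (indicator U x * (norm (smoothing h r x - h x))\<^sup>2) \<partial>lborel)
        \<le> (\<integral>\<^sup>+x. ennreal 2 * ennreal ((norm (smoothing (\<lambda>x. h x - g x) r x))\<^sup>2)
              + ennreal (4 * \<eta>\<^sup>2) * indicator U x + ennreal 4 * ennreal ((norm (h x - g x))\<^sup>2) \<partial>lborel)"
    proof (rule nn_integral_mono)
      fix x
      have "ennreal (indicator U x * (norm (smoothing h r x - h x))\<^sup>2)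
        \<le> ennreal (2 * (norm (smoothing (\<lambda>x. h x - g x) r x))\<^sup>2 + 4 * \<eta>\<^sup>2 * indicator U x + 4 * (norm (h x - g x))\<^sup>2)"
        by (intro ennreal_leI pt)
      also have "\<dots> = ennreal 2 * ennreal ((norm (smoothing (\<lambda>x. h x - g x) r x))\<^sup>2)
              + ennreal (4 * \<eta>\<^sup>2) * indicator U x + ennreal 4 * ennreal ((norm (h x - g x))\<^sup>2)"
        by (cases "x \<in> U") (simp_all add: ennreal_plus ennreal_mult)
      finally show "ennreal (indicator U x * (norm (smoothing h r x - h x))\<^sup>2)
        \<le> ennreal 2 * ennreal ((norm (smoothing (\<lambda>x. h x - g x) r x))\<^sup>2)
              + ennreal (4 * \<eta>\<^sup>2) * indicator U x + ennreal 4 * ennreal ((norm (h x - g x))\<^sup>2)" .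
    qed
    also have "\<dots> = ennreal 2 * sqint lborel (\<lambda>x. smoothing (\<lambda>x. h x - g x) r x)
              + ennreal (4 * \<eta>\<^sup>2) * emeasure lborel U + ennreal 4 * sqint lborel (\<lambda>x. h x - g x)"
    proof -
      have m: "(\<lambda>x. ennreal (4 * \<eta>\<^sup>2) * indicator U x) \<in> borel_measurable lborel"
        by (intro borel_measurable_times_ennreal borel_measurable_indicator borel_measurable_const) (simp add: U)
      then have "(\<integral>\<^sup>+x. ennreal (4 * \<eta>\<^sup>2) * indicator U x \<partial>lborel) = ennreal (4 * \<eta>\<^sup>2) * emeasure lborel U"
        by (intro nn_integral_cmult_indicator) (simp add: U)
      moreover have "(\<integral>\<^sup>+x. ennreal 2 * ennreal ((norm (smoothing (\<lambda>x. h x - g x) r x))\<^sup>2)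
              + ennreal (4 * \<eta>\<^sup>2) * indicator U x + ennreal 4 * ennreal ((norm (h x - g x))\<^sup>2) \<partial>lborel)
          = ennreal 2 * sqint lborel (\<lambda>x. smoothing (\<lambda>x. h x - g x) r x)
              + (\<integral>\<^sup>+x. ennreal (4 * \<eta>\<^sup>2) * indicator U x \<partial>lborel)
              + ennreal 4 * sqint lborel (\<lambda>x. h x - g x)"
        by (rule nn_integral_linear_combination[OF _ m]) measurable
      ultimately show ?thesis by (simp only:)
    qed
    also have "\<dots> \<le> ennreal 2 * ennreal (2 ^ DIM('a) * e1) + ennreal (4 * \<eta>\<^sup>2) * ennreal V + ennreal 4 * ennreal e1"
    proof (intro add_mono mult_left_mono)
      let ?I = "\<integral>\<^sup>+x. ennreal ((norm (smoothing (\<lambda>x. h x - g x) r x))\<^sup>2) \<partial>lborel"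
      have "ennreal ((1 / 2) ^ DIM('a)) * ?I \<le> ennreal (r ^ DIM('a)) * ?I"
        using r by (intro mult_right_mono ennreal_leI power_mono) auto
      also have "\<dots> \<le> sqint lborel (\<lambda>x. h x - g x)"
        by (rule L2_norm_smoothing_le[OF ihg r(2)])
      also have "\<dots> \<le> ennreal e1" using g(3) by simp
      finally have "ennreal (2 ^ DIM('a)) * (ennreal ((1 / 2) ^ DIM('a)) * ?I) \<le> ennreal (2 ^ DIM('a)) * ennreal e1"
        by (rule mult_left_mono) simp
      also have "ennreal (2 ^ DIM('a)) * (ennreal ((1 / 2) ^ DIM('a)) * ?I) = ?I"
      proof -
        have "ennreal (2 ^ DIM('a)) * ennreal ((1 / 2) ^ DIM('a)) = 1"
          by (subst ennreal_mult[symmetric]) (simp_all flip: power_mult_distrib)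
        then show ?thesis by (simp only: mult.assoc[symmetric] mult_1_left)
      qed
      finally show "?I \<le> ennreal (2 ^ DIM('a) * e1)" using e1 by (simp add: ennreal_mult)
      show "emeasure lborel U \<le> ennreal V" by (simp add: V(1))
      show "sqint lborel (\<lambda>x. h x - g x) \<le> ennreal e1" using g(3) by simp
    qed simp_all
    also have "\<dots> = ennreal (A * e1 + 4 * \<eta>\<^sup>2 * V)"
    proof -
      have "ennreal 2 * ennreal p + ennreal q * ennreal V + ennreal 4 * ennreal e1 = ennreal (2 * p + q * V + 4 * e1)"
        if "p \<ge> 0" "q \<ge> 0" for p q
        using that e1 V(2) by (simp add: ennreal_plus ennreal_mult)
      from this[of "2 ^ DIM('a) * e1" "4 * \<eta>\<^sup>2"] e1
      have "ennreal 2 * ennreal (2 ^ DIM('a) * e1) + ennreal (4 * \<eta>\<^sup>2) * ennreal V + ennreal 4 * ennreal e1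
          = ennreal (2 * (2 ^ DIM('a) * e1) + 4 * \<eta>\<^sup>2 * V + 4 * e1)" by simp
      also have "2 * (2 ^ DIM('a) * e1) + 4 * \<eta>\<^sup>2 * V + 4 * e1 = A * e1 + 4 * \<eta>\<^sup>2 * V"
        by (simp add: A_def distrib_right)
      finally show ?thesis .
    qed
    also have "\<dots> < ennreal e"
    proof (rule ennreal_lessI[OF e])
      have "4 * \<eta>\<^sup>2 * V = (e / 2) * (V / (V + 1))" 
      proof -
        have "4 * (e / (8 * q)) * V = (e / 2) * (V / q)" for q by simp
        then show ?thesis unfolding \<eta>(2) .
      qed
      also have "\<dots> < (e / 2) * 1" using e V(2) by (intro mult_strict_left_mono) auto
      finally show "A * e1 + 4 * \<eta>\<^sup>2 * V < e" using A by (simp add: e1_def)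
    qed
    finally show "(\<integral>\<^sup>+x. ennreal (indicator U x * (norm (smoothing h (1 - \<delta>) x - h x))\<^sup>2) \<partial>lborel) < ennreal e"
      by (simp only: r_def)
  qed
qed

section \<open>Wirtinger derivatives\<close>

text \<open>The operators \<open>\<partial>/\<partial>z\<^sup>*\<close> and \<open>\<partial>/\<partial>w\<^sup>*\<close> are instances of one
  first order operator with two real directions \<open>a\<close> and \<open>b\<close>.\<close>

definition wirtinger :: "'a::euclidean_space \<Rightarrow> 'a \<Rightarrow> ('a \<Rightarrow> complex) \<Rightarrow> 'a \<Rightarrow> complex" where
  "wirtinger a b f p = (frechet_derivative f (at p) a + \<i> * frechet_derivative f (at p) b) / 2"

lemma dzbar_eq_wirtinger: "dzbar = wirtinger (1, 0) (\<i>, 0)"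
  by (simp add: fun_eq_iff dzbar_def wirtinger_def)

lemma dwbar_eq_wirtinger: "dwbar = wirtinger (0, 1) (0, \<i>)"
  by (simp add: fun_eq_iff dwbar_def wirtinger_def)

lemma dbar1_eq_wirtinger: "dbar1 = wirtinger 1 \<i>"
  by (simp add: fun_eq_iff dbar1_def wirtinger_def)

lemma wirtinger_has_derivative: "(f has_derivative D) (at p) \<Longrightarrow> wirtinger a b f p = (D a + \<i> * D b) / 2"
  by (simp add: wirtinger_def frechet_derivative_at[symmetric])

lemma wirtinger_mult:
  assumes "smooth_on S f" "smooth_on S g" "p \<in> S"
  shows "wirtinger a b (\<lambda>p. f p * g p) p = f p * wirtinger a b g p + wirtinger a b f p * g p"
proof -
  have "((\<lambda>p. f p * g p) has_derivative
      (\<lambda>v. f p * frechet_derivative g (at p) v + frechet_derivative f (at p) v * g p)) (at p)"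
    by (intro has_derivative_mult smooth_onD[OF assms(1,3)] smooth_onD[OF assms(2,3)])
  from wirtinger_has_derivative[OF this] show ?thesis
    by (simp add: wirtinger_def algebra_simps add_divide_distrib)
qed

lemma smooth_on_wirtinger: "open S \<Longrightarrow> smooth_on S f \<Longrightarrow> smooth_on S (wirtinger a b f)"
  unfolding wirtinger_def[abs_def] divide_inverse
  by (intro smooth_on_mult smooth_on_add smooth_on_const smooth_on_frechet_derivative)

lemma wirtinger_cong_open:
  "open S \<Longrightarrow> p \<in> S \<Longrightarrow> (\<And>q. q \<in> S \<Longrightarrow> f q = g q) \<Longrightarrow> wirtinger a b f p = wirtinger a b g p"
  unfolding wirtinger_def using frechet_derivative_cong_open[of S p f g] by simp

lemma wirtinger_eq_0_off_support:
  "closed K \<Longrightarrow> (\<And>x. x \<notin> K \<Longrightarrow> f x = 0) \<Longrightarrow> x \<notin> K \<Longrightarrow> wirtinger a b f x = 0"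
  unfolding wirtinger_def by (simp add: frechet_derivative_eq_0_off_support)

lemma test_functions_wirtinger:
  assumes "\<phi> \<in> test_functions \<Omega>"
  shows "wirtinger a b \<phi> \<in> test_functions \<Omega>"
proof -
  obtain K where K: "smooth_on UNIV \<phi>" "compact K" "K \<subseteq> \<Omega>" "\<And>x. x \<notin> K \<Longrightarrow> \<phi> x = 0"
    using assms by (rule test_functionsE) blast
  show ?thesis
    by (rule test_functionsI[OF smooth_on_wirtinger[OF open_UNIV K(1)] K(2,3)])
      (rule wirtinger_eq_0_off_support[OF compact_imp_closed[OF K(2)] K(4)])
qed

lemma test_functions_mult:
  fixes f g :: "'a::euclidean_space \<Rightarrow> complex"
  assumes "smooth_on UNIV f" "\<phi> \<in> test_functions \<Omega>"
  shows "(\<lambda>x. f x * \<phi> x) \<in> test_functions \<Omega>"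
proof -
  obtain K where K: "smooth_on UNIV \<phi>" "compact K" "K \<subseteq> \<Omega>" "\<And>x. x \<notin> K \<Longrightarrow> \<phi> x = 0"
    using assms(2) by (rule test_functionsE) blast
  show ?thesis
    by (rule test_functionsI[OF smooth_on_mult[OF open_UNIV assms(1) K(1)] K(2,3)]) (simp add: K(4))
qed

text \<open>The product \<open>f \<phi>\<close> is a test function, so the integrals of its derivatives vanish.\<close>

lemma integral_wirtinger_by_parts:
  fixes f \<phi> :: "'a::euclidean_space \<Rightarrow> complex"
  assumes f: "smooth_on UNIV f" and \<phi>: "\<phi> \<in> test_functions UNIV"
  shows "(LINT x|lborel. wirtinger a b f x * \<phi> x) = - (LINT x|lborel. f x * wirtinger a b \<phi> x)"
proof -
  obtain K where K: "smooth_on UNIV \<phi>" using \<phi> by (rule test_functionsE) blast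
  have f\<phi>: "(\<lambda>x. f x * \<phi> x) \<in> test_functions UNIV" by (rule test_functions_mult[OF f \<phi>])
  have i: "integrable lborel (\<lambda>x. frechet_derivative (\<lambda>x. f x * \<phi> x) (at x) v)" for v
    by (rule test_functions_integrable[OF test_functions_frechet_derivative[OF f\<phi>]])
  have i1: "integrable lborel (\<lambda>x. wirtinger a b f x * \<phi> x)"
    by (rule test_functions_integrable[OF test_functions_mult[OF smooth_on_wirtinger[OF open_UNIV f] \<phi>]])
  have i2: "integrable lborel (\<lambda>x. f x * wirtinger a b \<phi> x)"
    by (rule test_functions_integrable[OF test_functions_mult[OF f test_functions_wirtinger[OF \<phi>]]])
  have "(LINT x|lborel. f x * wirtinger a b \<phi> x) + (LINT x|lborel. wirtinger a b f x * \<phi> x)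
      = (LINT x|lborel. f x * wirtinger a b \<phi> x + wirtinger a b f x * \<phi> x)"
    by (rule Bochner_Integration.integral_add[OF i2 i1, symmetric])
  also have "\<dots> = (LINT x|lborel. wirtinger a b (\<lambda>x. f x * \<phi> x) x)"
    by (simp only: wirtinger_mult[OF f K UNIV_I])
  also have "\<dots> = ((LINT x|lborel. frechet_derivative (\<lambda>x. f x * \<phi> x) (at x) a)
      + \<i> * (LINT x|lborel. frechet_derivative (\<lambda>x. f x * \<phi> x) (at x) b)) / 2"
    unfolding wirtinger_def using i by simp
  also have "\<dots> = 0" by (simp add: integral_frechet_derivative_test_function[OF f\<phi>])
  finally show ?thesis by (metis add.commute eq_neg_iff_add_eq_0)
qed

section \<open>The chart of the Hartogs triangle\<close>

lemma smooth_on_fst: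
  assumes "open S"
  shows "smooth_on S fst"
  using smooth_on_linear[OF bounded_linear_fst assms smooth_on_ident[OF assms]] by simp

lemma smooth_on_snd:
  assumes "open S"
  shows "smooth_on S snd"
  using smooth_on_linear[OF bounded_linear_snd assms smooth_on_ident[OF assms]] by simp

lemma smooth_on_Pair:
  fixes f :: "'z::euclidean_space \<Rightarrow> 'a::euclidean_space" and g :: "'z \<Rightarrow> 'b::euclidean_space"
  assumes "open S" "smooth_on S f" "smooth_on S g"
  shows "smooth_on S (\<lambda>x. (f x, g x))"
proof -
  have 1: "bounded_linear (\<lambda>a::'a. (a, 0::'b))"
    by (rule bounded_linear_Pair[OF bounded_linear_ident bounded_linear_zero])
  have 2: "bounded_linear (\<lambda>b::'b. (0::'a, b))"
    by (rule bounded_linear_Pair[OF bounded_linear_zero bounded_linear_ident])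
  have "smooth_on S (\<lambda>x. (f x, 0::'b) + (0::'a, g x))"
    by (rule smooth_on_add[OF assms(1) smooth_on_linear[OF 1 assms(1,2)] smooth_on_linear[OF 2 assms(1,3)]])
  then show ?thesis by simp
qed

text \<open>Smoothness on \<open>S\<close> and triviality off a closed subset of \<open>S\<close> cover the whole space.\<close>

lemma smooth_on_glue_zero:
  assumes "open S" "smooth_on S f" "closed C" "C \<subseteq> S" "\<And>x. x \<notin> C \<Longrightarrow> f x = 0"
  shows "smooth_on UNIV f"
proof -
  have "smooth_on (- C) f"
    by (rule smooth_on_cong[OF _ _ smooth_on_const[of _ 0]]) (use assms in auto)
  then have "smooth_on (S \<union> - C) f" using assms by (intro smooth_on_Un) auto
  also have "S \<union> - C = UNIV" using assms(4) by blast
  finally show ?thesis .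
qed

lemma open_snd_nonzero: "open {p :: complex \<times> complex. snd p \<noteq> 0}"
  by (intro open_Collect_neq continuous_intros)

lemma smooth_on_ratio:
  fixes f :: "complex \<times> complex \<Rightarrow> complex"
  assumes "smooth_on UNIV f"
  shows "smooth_on {p. snd p \<noteq> 0} (\<lambda>p. f (fst p / snd p, snd p))"
proof (rule smooth_on_compose[OF open_snd_nonzero assms])
  show "smooth_on {p. snd p \<noteq> 0} (\<lambda>p :: complex \<times> complex. (fst p / snd p, snd p))"
    unfolding divide_inverse
    by (intro smooth_on_Pair smooth_on_mult smooth_on_inverse smooth_on_fst smooth_on_snd open_snd_nonzero) auto
qed auto

text \<open>The combination \<open>L + \<i> L(\<i> \<sqdot>)\<close> extracts the conjugate linear part of a real linear map.\<close>

lemma real_linear_conjugate_part: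
  fixes L :: "complex \<Rightarrow> complex"
  assumes "bounded_linear L"
  shows "L c + \<i> * L (\<i> * c) = cnj c * (L 1 + \<i> * L \<i>)"
proof -
  interpret bounded_linear L by fact
  have *: "L (of_real a + \<i> * of_real b) = of_real a * L 1 + of_real b * L \<i>" for a b
  proof -
    have "of_real a + \<i> * of_real b = a *\<^sub>R 1 + b *\<^sub>R \<i>" by (simp add: scaleR_conv_of_real)
    then show ?thesis by (simp only: add scaleR) (simp add: scaleR_conv_of_real)
  qed
  have c: "c = of_real (Re c) + \<i> * of_real (Im c)" by (rule complex_eq)
  have ic: "\<i> * c = of_real (- Im c) + \<i> * of_real (Re c)" by (simp add: complex_eq_iff)
  have "L c = of_real (Re c) * L 1 + of_real (Im c) * L \<i>" by (subst c) (rule *)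
  moreover have "L (\<i> * c) = of_real (- Im c) * L 1 + of_real (Re c) * L \<i>" by (subst ic) (rule *)
  moreover have "cnj c = of_real (Re c) - \<i> * of_real (Im c)" by (simp add: complex_eq_iff)
  moreover have "a * P + b * Q + \<i> * ((- b) * P + a * Q) = (a - \<i> * b) * (P + \<i> * Q)" for a b P Q :: complex
    by (simp add: algebra_simps)
  ultimately show ?thesis by (simp only: of_real_minus)
qed

text \<open>Chain rule for the holomorphic map \<open>(z, w) \<mapsto> (z/w, w)\<close>: its derivatives \<open>1/w\<close> and \<open>-z/w\<^sup>2\<close> enter conjugated.\<close>

lemma wirtinger_ratio:
  fixes f :: "complex \<times> complex \<Rightarrow> complex"
  assumes f: "smooth_on UNIV f" and w: "snd p \<noteq> 0"
  defines "q \<equiv> (fst p / snd p, snd p)"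
  shows "dzbar (\<lambda>p. f (fst p / snd p, snd p)) p = dzbar f q / cnj (snd p)"
    and "dwbar (\<lambda>p. f (fst p / snd p, snd p)) p = dwbar f q - cnj (fst q) / cnj (snd p) * dzbar f q"
proof -
  let ?L = "frechet_derivative f (at q)" and ?z = "fst p" and ?w = "snd p"
  have der: "(f has_derivative ?L) (at q)" by (rule smooth_onD[OF f]) simp
  interpret L: bounded_linear ?L by (rule has_derivative_bounded_linear[OF der])
  have Q: "((\<lambda>p. (fst p / snd p, snd p)) has_derivative
      (\<lambda>v. ((fst v * ?w - ?z * snd v) / (?w * ?w), snd v))) (at p)"
    using w by (intro has_derivative_Pair has_derivative_divide' has_derivative_fst has_derivative_snd has_derivative_ident)
  have D: "((\<lambda>p. f (fst p / snd p, snd p)) has_derivative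
      (\<lambda>v. ?L ((fst v * ?w - ?z * snd v) / (?w * ?w), snd v))) (at p)"
    by (rule has_derivative_compose[OF Q der[unfolded q_def], folded q_def])
  have bl: "bounded_linear (\<lambda>c. ?L (c, 0))"
    by (rule bounded_linear_compose[OF L.bounded_linear_axioms bounded_linear_Pair[OF bounded_linear_ident bounded_linear_zero]])
  have conj: "?L (c, 0) + \<i> * ?L (\<i> * c, 0) = cnj c * (2 * dzbar f q)" for c
    using real_linear_conjugate_part[OF bl, of c] by (simp add: dzbar_def)
  have split: "?L (a, b) = ?L (a, 0) + ?L (0, b)" for a b
    using L.add[of "(a, 0)" "(0, b)"] by simp
  have w2: "(1 * ?w - ?z * 0) / (?w * ?w) = inverse ?w" "(\<i> * ?w - ?z * 0) / (?w * ?w) = \<i> * inverse ?w"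
    using w by (simp_all add: divide_inverse)
  have "dzbar (\<lambda>p. f (fst p / snd p, snd p)) p = (?L (inverse ?w, 0) + \<i> * ?L (\<i> * inverse ?w, 0)) / 2"
    using wirtinger_has_derivative[OF D, of "(1, 0)" "(\<i>, 0)"]
    by (simp only: dzbar_eq_wirtinger fst_conv snd_conv w2)
  also have "\<dots> = cnj (inverse ?w) * (2 * dzbar f q) / 2" by (simp only: conj)
  also have "\<dots> = dzbar f q / cnj (snd p)" by (simp add: inverse_eq_divide)
  finally show "dzbar (\<lambda>p. f (fst p / snd p, snd p)) p = dzbar f q / cnj (snd p)" .
  define c where "c = - ?z / (?w * ?w)"
  have c: "(0 * ?w - ?z * 1) / (?w * ?w) = c" "(0 * ?w - ?z * \<i>) / (?w * ?w) = \<i> * c" by (simp_all add: c_def mult.commute[of \<i>])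
  have cc: "cnj c = - (cnj (fst q) / cnj ?w)" by (simp add: c_def q_def)
  have "dwbar (\<lambda>p. f (fst p / snd p, snd p)) p = (?L (c, 1) + \<i> * ?L (\<i> * c, \<i>)) / 2"
    using wirtinger_has_derivative[OF D, of "(0, 1)" "(0, \<i>)"] by (simp only: dwbar_eq_wirtinger fst_conv snd_conv c)
  also have "\<dots> = (?L (c, 0) + \<i> * ?L (\<i> * c, 0)) / 2 + dwbar f q"
    unfolding split[of c 1] split[of "\<i> * c" \<i>] dwbar_def by (simp add: distrib_left add_divide_distrib)
  also have "\<dots> = dwbar f q - cnj (fst q) / cnj (snd p) * dzbar f q"
    by (simp add: conj cc)
  finally show "dwbar (\<lambda>p. f (fst p / snd p, snd p)) p = dwbar f q - cnj (fst q) / cnj (snd p) * dzbar f q" .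
qed

lemma triangle_chart_mem: "q \<in> punctured_bidisc \<Longrightarrow> triangle_chart q \<in> hartogs_triangle"
  by (auto simp: punctured_bidisc_def triangle_chart_def hartogs_triangle_def norm_mult)

text \<open>The value \<open>0\<close> on \<open>w = 0\<close> makes the composition with \<open>(z, w) \<mapsto> (z/w, w)\<close> smooth everywhere, provided that \<open>\<phi>\<close> vanishes near
  \<open>w = 0\<close>.\<close>

definition pullback :: "(complex \<times> complex \<Rightarrow> complex) \<Rightarrow> complex \<times> complex \<Rightarrow> complex" where
  "pullback \<phi> p = (if snd p = 0 then 0 else \<phi> (fst p / snd p, snd p))"

lemma pullback_wirtinger:
  assumes \<phi>: "smooth_on UNIV \<phi>" and w: "snd q \<noteq> 0"
  shows "dzbar (pullback \<phi>) (triangle_chart q) = dzbar \<phi> q / cnj (snd q)"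
    and "dwbar (pullback \<phi>) (triangle_chart q) = dwbar \<phi> q - cnj (fst q) / cnj (snd q) * dzbar \<phi> q"
proof -
  have s: "snd (triangle_chart q) = snd q" "fst (triangle_chart q) / snd q = fst q"
    using w by (simp_all add: triangle_chart_def)
  have "wirtinger a b (pullback \<phi>) (triangle_chart q)
      = wirtinger a b (\<lambda>p. \<phi> (fst p / snd p, snd p)) (triangle_chart q)" for a b
    by (rule wirtinger_cong_open[OF open_snd_nonzero]) (use w in \<open>auto simp: s pullback_def\<close>)
  then show "dzbar (pullback \<phi>) (triangle_chart q) = dzbar \<phi> q / cnj (snd q)"
    "dwbar (pullback \<phi>) (triangle_chart q) = dwbar \<phi> q - cnj (fst q) / cnj (snd q) * dzbar \<phi> q"
    using wirtinger_ratio[OF \<phi>, of "triangle_chart q"] w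
    by (simp_all add: s dzbar_eq_wirtinger dwbar_eq_wirtinger)
qed

lemma pullback_test_function:
  assumes "\<phi> \<in> test_functions punctured_bidisc"
  shows "pullback \<phi> \<in> test_functions hartogs_triangle"
proof -
  obtain K where K: "smooth_on UNIV \<phi>" "compact K" "K \<subseteq> punctured_bidisc" "\<And>x. x \<notin> K \<Longrightarrow> \<phi> x = 0"
    using assms by (rule test_functionsE) blast
  have comp: "compact (triangle_chart ` K)"
    unfolding triangle_chart_def by (intro compact_continuous_image K continuous_intros)
  have sub: "triangle_chart ` K \<subseteq> hartogs_triangle" using K(3) triangle_chart_mem by blast
  have zero: "pullback \<phi> p = 0" if "p \<notin> triangle_chart ` K" for p
  proof (rule ccontr)
    assume "pullback \<phi> p \<noteq> 0"
    then have w: "snd p \<noteq> 0" and "\<phi> (fst p / snd p, snd p) \<noteq> 0" by (auto simp: pullback_def split: if_splits)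
    then have "(fst p / snd p, snd p) \<in> K" using K(4) by blast
    moreover have "triangle_chart (fst p / snd p, snd p) = p" using w by (simp add: triangle_chart_def)
    ultimately show False using that by (metis imageI)
  qed
  have "smooth_on UNIV (pullback \<phi>)"
  proof (rule smooth_on_glue_zero[OF open_snd_nonzero _ compact_imp_closed[OF comp] _ zero])
    show "smooth_on {p. snd p \<noteq> 0} (pullback \<phi>)"
      by (rule smooth_on_cong[OF open_snd_nonzero _ smooth_on_ratio[OF K(1)]]) (simp add: pullback_def)
    show "triangle_chart ` K \<subseteq> {p. snd p \<noteq> 0}" using sub by (auto simp: hartogs_triangle_def)
  qed
  then show ?thesis by (rule test_functionsI[OF _ comp sub zero])
qed

section \<open>Transport to the bidisc\<close>

text \<open>The function \<open>w f(\<zeta>w, w)\<close>.  The factor \<open>w\<close> absorbs the Jacobian \<open>|w|\<^sup>2\<close> and makes \<open>f \<mapsto> chart_coefficient f\<close> an isometry;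
  it is holomorphic, so it does not disturb the Cauchy-Riemann equations.\<close>

definition chart_coefficient :: "(complex \<times> complex \<Rightarrow> complex) \<Rightarrow> complex \<times> complex \<Rightarrow> complex" where
  "chart_coefficient f q = indicator punctured_bidisc q *\<^sub>R (snd q * f (triangle_chart q))"

lemma measurable_chart_coefficient [measurable]:
  assumes [measurable]: "f \<in> borel_measurable borel"
  shows "chart_coefficient f \<in> borel_measurable borel"
proof -
  have [measurable]: "snd \<in> borel_measurable (borel :: (complex \<times> complex) measure)"
    by (intro borel_measurable_continuous_onI continuous_intros)
  show ?thesis unfolding chart_coefficient_def[abs_def] by measurable
qed

lemma chart_coefficient_eq_0: "q \<notin> punctured_bidisc \<Longrightarrow> chart_coefficient f q = 0"
  by (simp add: chart_coefficient_def)

text \<open>One factor \<open>w\<close> of \<open>|w|\<^sup>2 = w w\<^sup>*\<close> goes to \<open>f\<close>, the other one stays with the test function.\<close>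

lemma integral_mult_chart:
  assumes [measurable]: "f \<in> borel_measurable borel" "k \<in> borel_measurable borel"
    and f0: "\<And>p. p \<notin> hartogs_triangle \<Longrightarrow> f p = 0"
  shows "(LINT p|lborel. f p * k p)
    = (LINT q|lborel. chart_coefficient f q * (cnj (snd q) * k (triangle_chart q)))"
proof -
  have "(LINT p|lborel. f p * k p) = (LINT p|lborel. indicator hartogs_triangle p *\<^sub>R (f p * k p))"
    using f0 by (intro Bochner_Integration.integral_cong) (auto split: split_indicator)
  also have "\<dots> = (LINT q|lborel. (indicator punctured_bidisc q * (cmod (snd q))\<^sup>2) *\<^sub>R (f (triangle_chart q) * k (triangle_chart q)))"
    by (rule integral_hartogs_triangle) measurable
  also have "\<dots> = (LINT q|lborel. chart_coefficient f q * (cnj (snd q) * k (triangle_chart q)))"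
  proof (rule Bochner_Integration.integral_cong)
    fix q :: "complex \<times> complex"
    have "(cmod (snd q))\<^sup>2 *\<^sub>R x = snd q * cnj (snd q) * x" for x
      by (simp only: scaleR_conv_of_real complex_norm_square)
    then show "(indicator punctured_bidisc q * (cmod (snd q))\<^sup>2) *\<^sub>R (f (triangle_chart q) * k (triangle_chart q))
        = chart_coefficient f q * (cnj (snd q) * k (triangle_chart q))"
      by (cases "q \<in> punctured_bidisc") (simp_all add: chart_coefficient_def)
  qed simp
  finally show ?thesis .
qed

lemma nn_integral_norm_chart_coefficient:
  assumes [measurable]: "f \<in> borel_measurable borel"
  shows "sqint lborel (chart_coefficient f)
    = (\<integral>\<^sup>+p. ennreal ((cmod (f p))\<^sup>2) * indicator hartogs_triangle p \<partial>lborel)"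
  by (subst nn_integral_hartogs_triangle)
    (auto simp: chart_coefficient_def norm_mult power_mult_distrib ennreal_mult intro!: nn_integral_cong split: split_indicator)

lemma norm_integral_mult_square_le:
  fixes f g :: "'a \<Rightarrow> complex"
  assumes [measurable]: "f \<in> borel_measurable M" "g \<in> borel_measurable M"
  shows "ennreal ((norm (LINT x|M. f x * g x))\<^sup>2)
    \<le> sqint M f * sqint M g"
proof (cases "integrable M (\<lambda>x. f x * g x)")
  case True
  have "ennreal (norm (LINT x|M. f x * g x)) \<le> (\<integral>\<^sup>+x. ennreal (norm (f x * g x)) \<partial>M)"
    by (rule integral_norm_bound_ennreal[OF True])
  also have "\<dots> = (\<integral>\<^sup>+x. ennreal (norm (f x)) * ennreal (norm (g x)) \<partial>M)"
    by (simp add: norm_mult ennreal_mult)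
  finally have "(ennreal (norm (LINT x|M. f x * g x)))\<^sup>2 \<le> (\<integral>\<^sup>+x. ennreal (norm (f x)) * ennreal (norm (g x)) \<partial>M)\<^sup>2"
    by (rule power_mono) simp
  also have "\<dots> \<le> (\<integral>\<^sup>+x. (ennreal (norm (f x)))\<^sup>2 \<partial>M) * (\<integral>\<^sup>+x. (ennreal (norm (g x)))\<^sup>2 \<partial>M)"
    by (rule Cauchy_Schwarz_nn_integral) measurable
  finally show ?thesis by (simp add: ennreal_power)
qed (simp add: not_integrable_integral_eq)

definition bidisc :: "(complex \<times> complex) set" where
  "bidisc = ball 0 1 \<times> ball 0 1"

lemma open_bidisc: "open bidisc"
  unfolding bidisc_def by (intro open_Times open_ball)

lemma bounded_bidisc: "bounded bidisc"
  unfolding bidisc_def by (intro bounded_Times bounded_ball)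

lemma borel_bidisc [measurable]: "bidisc \<in> sets borel"
  by (simp add: open_bidisc)

lemma punctured_bidisc_subset: "punctured_bidisc \<subseteq> bidisc"
  by (auto simp: punctured_bidisc_def bidisc_def)

text \<open>The constant \<open>4\<close> is the area of a square containing the unit disc.\<close>

lemma nn_integral_bidisc_snd_le:
  assumes [measurable]: "g \<in> borel_measurable borel"
  shows "(\<integral>\<^sup>+q. indicator bidisc q * g (snd q) \<partial>lborel) \<le> 4 * (\<integral>\<^sup>+w. g w \<partial>lborel)"
proof -
  have [measurable]: "snd \<in> borel_measurable (borel :: (complex \<times> complex) measure)"
    by (intro borel_measurable_continuous_onI continuous_intros)
  have m: "(\<lambda>q. indicator bidisc q * g (snd q)) \<in> borel_measurable (lborel \<Otimes>\<^sub>M lborel)"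
    unfolding lborel_prod by measurable
  have "(\<integral>\<^sup>+q. indicator bidisc q * g (snd q) \<partial>lborel) = (\<integral>\<^sup>+w. \<integral>\<^sup>+z. indicator bidisc (z, w) * g w \<partial>lborel \<partial>lborel)"
    using lborel_pair.nn_integral_snd[OF m] by (simp add: lborel_prod)
  also have "\<dots> \<le> (\<integral>\<^sup>+w. \<integral>\<^sup>+z. g w * indicator (cball (0::complex) 1) z \<partial>lborel \<partial>lborel)"
    by (intro nn_integral_mono) (auto simp: bidisc_def split: split_indicator)
  also have "\<dots> = (\<integral>\<^sup>+w. g w * emeasure lborel (cball (0::complex) 1) \<partial>lborel)"
    by (intro nn_integral_cong nn_integral_cmult_indicator) simp
  also have "\<dots> \<le> (\<integral>\<^sup>+w. g w * 4 \<partial>lborel)"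
    using emeasure_cball_complex_le[of 1] by (intro nn_integral_mono mult_left_mono) auto
  also have "\<dots> = 4 * (\<integral>\<^sup>+w. g w \<partial>lborel)"
    by (subst nn_integral_multc) (simp_all add: mult.commute[of _ 4])
  finally show ?thesis .
qed

lemma smooth_on_comp_snd:
  assumes "smooth_on UNIV u"
  shows "smooth_on UNIV (\<lambda>q :: complex \<times> complex. u (snd q))"
  by (rule smooth_on_compose[OF open_UNIV assms smooth_on_snd[OF open_UNIV] subset_UNIV])

lemma wirtinger_comp_snd:
  fixes u :: "complex \<Rightarrow> complex"
  assumes "smooth_on S u" "snd q \<in> S"
  shows "dzbar (\<lambda>q. u (snd q)) q = 0" "dwbar (\<lambda>q. u (snd q)) q = dbar1 u (snd q)"
proof -
  have der: "(u has_derivative frechet_derivative u (at (snd q))) (at (snd q))"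
    by (rule smooth_onD[OF assms])
  interpret L: bounded_linear "frechet_derivative u (at (snd q))" by (rule has_derivative_bounded_linear[OF der])
  have D: "((\<lambda>q. u (snd q)) has_derivative (\<lambda>v. frechet_derivative u (at (snd q)) (snd v))) (at q)"
    by (rule has_derivative_compose[OF has_derivative_snd[OF has_derivative_ident] der])
  show "dzbar (\<lambda>q. u (snd q)) q = 0" "dwbar (\<lambda>q. u (snd q)) q = dbar1 u (snd q)"
    using wirtinger_has_derivative[OF D, of "(1, 0)" "(\<i>, 0)"] wirtinger_has_derivative[OF D, of "(0, 1)" "(0, \<i>)"]
    by (simp_all add: dzbar_eq_wirtinger dwbar_eq_wirtinger L.zero dbar1_def)
qed

lemma wirtinger_cnj_fst: "dzbar (\<lambda>q. cnj (fst q)) q = 1"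
proof -
  have D: "((\<lambda>q :: complex \<times> complex. cnj (fst q)) has_derivative (\<lambda>v. cnj (fst v))) (at q)"
    by (intro bounded_linear.has_derivative[OF bounded_linear_cnj] has_derivative_fst has_derivative_ident)
  show ?thesis using wirtinger_has_derivative[OF D, of "(1, 0)" "(\<i>, 0)"] by (simp add: dzbar_eq_wirtinger)
qed

lemma wirtinger_cnj_snd: "dwbar (\<lambda>q. cnj (snd q)) q = 1"
proof -
  have D: "((\<lambda>q :: complex \<times> complex. cnj (snd q)) has_derivative (\<lambda>v. cnj (snd v))) (at q)"
    by (intro bounded_linear.has_derivative[OF bounded_linear_cnj] has_derivative_snd has_derivative_ident)
  show ?thesis using wirtinger_has_derivative[OF D, of "(0, 1)" "(0, \<i>)"] by (simp add: dwbar_eq_wirtinger)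
qed

section \<open>The transported function is weakly holomorphic on the bidisc\<close>

definition weakly_dbar_closed :: "(complex \<times> complex) set \<Rightarrow> (complex \<times> complex \<Rightarrow> complex) \<Rightarrow> bool" where
  "weakly_dbar_closed \<Omega> f \<longleftrightarrow> (\<forall>\<phi>\<in>test_functions \<Omega>.
     (LINT p|lborel. f p * dzbar \<phi> p) = 0 \<and> (LINT p|lborel. f p * dwbar \<phi> p) = 0)"

lemma measurable_test_wirtinger:
  assumes "\<phi> \<in> test_functions \<Omega>"
  shows "dzbar \<phi> \<in> borel_measurable borel" "dwbar \<phi> \<in> borel_measurable borel"
proof -
  have "wirtinger a b \<phi> \<in> borel_measurable borel" for a b
    using test_functions_wirtinger[OF assms, of a b]
    by (rule test_functionsE) (intro borel_measurable_continuous_onI smooth_on_continuous)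
  then show "dzbar \<phi> \<in> borel_measurable borel" "dwbar \<phi> \<in> borel_measurable borel"
    by (simp_all add: dzbar_eq_wirtinger dwbar_eq_wirtinger)
qed

text \<open>The equations on the triangle, tested with \<open>\<phi>(z/w, w)\<close>.\<close>

lemma integral_chart_coefficient_test:
  assumes [measurable]: "f \<in> borel_measurable borel" and f0: "\<forall>p. p \<notin> hartogs_triangle \<longrightarrow> f p = 0"
    and closed: "weakly_dbar_closed hartogs_triangle f" and \<phi>: "\<phi> \<in> test_functions punctured_bidisc"
  shows "(LINT q|lborel. chart_coefficient f q * dzbar \<phi> q) = 0"
    and "(LINT q|lborel. chart_coefficient f q * (cnj (snd q) * dwbar \<phi> q - cnj (fst q) * dzbar \<phi> q)) = 0"
proof -
  have \<psi>: "pullback \<phi> \<in> test_functions hartogs_triangle" by (rule pullback_test_function[OF \<phi>])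
  note [measurable] = measurable_test_wirtinger[OF \<psi>]
  have s: "smooth_on UNIV \<phi>" using \<phi> by (rule test_functionsE) blast
  have 1: "chart_coefficient f q * (cnj (snd q) * dzbar (pullback \<phi>) (triangle_chart q))
      = chart_coefficient f q * dzbar \<phi> q" for q
  proof (cases "snd q = 0")
    case True
    then show ?thesis by (simp add: chart_coefficient_def)
  next
    case False
    then show ?thesis by (simp add: pullback_wirtinger(1)[OF s False])
  qed
  have 2: "chart_coefficient f q * (cnj (snd q) * dwbar (pullback \<phi>) (triangle_chart q))
      = chart_coefficient f q * (cnj (snd q) * dwbar \<phi> q - cnj (fst q) * dzbar \<phi> q)" for q
  proof (cases "snd q = 0")
    case True
    then show ?thesis by (simp add: chart_coefficient_def)
  next
    case False
    then show ?thesis by (simp add: pullback_wirtinger(2)[OF s False] right_diff_distrib)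
  qed
  have "(LINT p|lborel. f p * dzbar (pullback \<phi>) p) = 0" "(LINT p|lborel. f p * dwbar (pullback \<phi>) p) = 0"
    using closed \<psi> by (auto simp: weakly_dbar_closed_def)
  moreover have "(LINT p|lborel. f p * dzbar (pullback \<phi>) p) = (LINT q|lborel. chart_coefficient f q * dzbar \<phi> q)"
    using integral_mult_chart[OF assms(1) measurable_test_wirtinger(1)[OF \<psi>]] f0 by (simp add: 1)
  moreover have "(LINT p|lborel. f p * dwbar (pullback \<phi>) p)
      = (LINT q|lborel. chart_coefficient f q * (cnj (snd q) * dwbar \<phi> q - cnj (fst q) * dzbar \<phi> q))"
    using integral_mult_chart[OF assms(1) measurable_test_wirtinger(2)[OF \<psi>]] f0 by (simp add: 2)
  ultimately show "(LINT q|lborel. chart_coefficient f q * dzbar \<phi> q) = 0"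
    "(LINT q|lborel. chart_coefficient f q * (cnj (snd q) * dwbar \<phi> q - cnj (fst q) * dzbar \<phi> q)) = 0"
    by simp_all
qed

lemma smooth_on_divide_vanishing:
  fixes u v :: "complex \<Rightarrow> complex"
  assumes u: "smooth_on UNIV u" and v: "smooth_on UNIV v" and v0: "\<And>w. w \<noteq> 0 \<Longrightarrow> v w \<noteq> 0"
    and van: "e > 0" "\<And>w. cmod w < e \<Longrightarrow> u w = 0"
  shows "smooth_on UNIV (\<lambda>w. u w * inverse (v w))"
proof (rule smooth_on_glue_zero[of "- {0}" _ "- ball 0 e"])
  show "smooth_on (- {0}) (\<lambda>w. u w * inverse (v w))"
    by (intro smooth_on_mult smooth_on_inverse smooth_on_subset[OF u] smooth_on_subset[OF v]) (use v0 in auto)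
qed (use van in auto)

lemma smooth_on_cnj: "smooth_on UNIV cnj"
  using smooth_on_linear[OF bounded_linear_cnj open_UNIV smooth_on_ident[OF open_UNIV]] by simp

text \<open>Testing against \<open>\<phi>\<close> cut off near \<open>w = 0\<close> needs two test functions on the punctured bidisc:
  the weak equation on the triangle expresses \<open>w\<^sup>*\<partial>/\<partial>w\<^sup>* - \<zeta>\<^sup>*\<partial>/\<partial>\<zeta>\<^sup>*\<close> in the chart, and adding the first weak
  equation for \<open>\<zeta>\<^sup>*\<phi>/w\<^sup>*\<close> to it for \<open>\<phi>/w\<^sup>*\<close> leaves \<open>\<partial>\<phi>/\<partial>w\<^sup>*\<close>.\<close>

lemma integral_chart_coefficient_cutoff:
  assumes f: "f \<in> borel_measurable borel" "\<forall>p. p \<notin> hartogs_triangle \<longrightarrow> f p = 0"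
    "weakly_dbar_closed hartogs_triangle f"
    and H: "integrable lborel (chart_coefficient f)"
    and \<phi>: "\<phi> \<in> test_functions bidisc"
    and X: "smooth_on UNIV X" "e > 0" "\<And>w. cmod w < e \<Longrightarrow> X w = 0"
  shows "(LINT q|lborel. chart_coefficient f q * (X (snd q) * dzbar \<phi> q)) = 0"
    and "(LINT q|lborel. chart_coefficient f q * (X (snd q) * dwbar \<phi> q + dbar1 X (snd q) * \<phi> q)) = 0"
proof -
  obtain K where K: "smooth_on UNIV \<phi>" "compact K" "K \<subseteq> bidisc" "\<And>x. x \<notin> K \<Longrightarrow> \<phi> x = 0"
    using \<phi> by (rule test_functionsE) blast
  \<comment> \<open>Both test functions contain \<open>X(w)/w\<^sup>*\<close>, which is smooth because \<open>X\<close> vanishes near \<open>0\<close>.\<close>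
  define m where "m w = X w * inverse (cnj w)" for w
  have m: "smooth_on UNIV m"
    unfolding m_def[abs_def] by (rule smooth_on_divide_vanishing[OF X(1) smooth_on_cnj _ X(2,3)]) auto
  have cut: "(\<lambda>q. u (snd q) * \<phi> q) \<in> test_functions punctured_bidisc"
    if u: "smooth_on UNIV u" "\<And>w. cmod w < e \<Longrightarrow> u w = 0" for u
  proof (rule test_functionsI[of _ "K \<inter> {q. e \<le> cmod (snd q)}"])
    show "smooth_on UNIV (\<lambda>q. u (snd q) * \<phi> q)" by (intro smooth_on_mult smooth_on_comp_snd u K open_UNIV)
    show "compact (K \<inter> {q. e \<le> cmod (snd q)})"
      by (intro compact_Int_closed K closed_Collect_le continuous_intros)
    show "K \<inter> {q. e \<le> cmod (snd q)} \<subseteq> punctured_bidisc"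
      using K(3) X(2) by (auto simp: bidisc_def punctured_bidisc_def)
    show "u (snd q) * \<phi> q = 0" if "q \<notin> K \<inter> {q. e \<le> cmod (snd q)}" for q
      using that u(2)[of "snd q"] K(4)[of q] by (auto simp: not_le)
  qed
  define \<theta> where "\<theta> q = m (snd q) * \<phi> q" for q
  have \<theta>: "\<theta> \<in> test_functions punctured_bidisc"
    unfolding \<theta>_def[abs_def] by (rule cut[OF m]) (simp add: m_def X(3))
  have \<theta>s: "smooth_on UNIV \<theta>" using \<theta> by (rule test_functionsE) blast
  have cf: "smooth_on UNIV (\<lambda>q :: complex \<times> complex. cnj (fst q))"
    by (rule smooth_on_linear[OF bounded_linear_cnj open_UNIV smooth_on_fst[OF open_UNIV]])
  have cs: "smooth_on UNIV (\<lambda>q :: complex \<times> complex. cnj (snd q))"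
    by (rule smooth_on_linear[OF bounded_linear_cnj open_UNIV smooth_on_snd[OF open_UNIV]])
  have Xs: "smooth_on UNIV (\<lambda>q :: complex \<times> complex. X (snd q))" by (rule smooth_on_comp_snd[OF X(1)])
  have X\<phi>: "(\<lambda>q. X (snd q) * \<phi> q) \<in> test_functions punctured_bidisc" by (rule cut[OF X(1,3)])
  have "dzbar (\<lambda>q. X (snd q) * \<phi> q) q = X (snd q) * dzbar \<phi> q" for q
    using wirtinger_mult[OF Xs K(1) UNIV_I, of "(1, 0)" "(\<i>, 0)" q] wirtinger_comp_snd(1)[OF X(1) UNIV_I, of q]
    by (simp only: dzbar_eq_wirtinger mult_zero_left add_0_right)
  with integral_chart_coefficient_test(1)[OF f X\<phi>]
  show "(LINT q|lborel. chart_coefficient f q * (X (snd q) * dzbar \<phi> q)) = 0" by simp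
  have \<theta>2: "(\<lambda>q. cnj (fst q) * \<theta> q) \<in> test_functions punctured_bidisc" by (rule test_functions_mult[OF cf \<theta>])
  have d\<theta>2: "dzbar (\<lambda>q. cnj (fst q) * \<theta> q) q = cnj (fst q) * dzbar \<theta> q + \<theta> q" for q
    using wirtinger_mult[OF cf \<theta>s UNIV_I, of "(1, 0)" "(\<i>, 0)" q] wirtinger_cnj_fst[of q]
    by (simp only: dzbar_eq_wirtinger mult_1_left)
  have A: "integrable lborel (\<lambda>q. chart_coefficient f q * (cnj (fst q) * dzbar \<theta> q + \<theta> q))"
  proof -
    have "integrable lborel (\<lambda>q. chart_coefficient f q * dzbar (\<lambda>q. cnj (fst q) * \<theta> q) q)"
      using integrable_mult_test_function[where a = 0, OF H test_functions_mono[OF test_functions_wirtinger[OF \<theta>2] subset_UNIV]]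
      by (simp add: dzbar_eq_wirtinger)
    then show ?thesis by (simp only: d\<theta>2)
  qed
  have B: "integrable lborel (\<lambda>q. chart_coefficient f q * (cnj (snd q) * dwbar \<theta> q - cnj (fst q) * dzbar \<theta> q))"
  proof -
    have "integrable lborel (\<lambda>q. chart_coefficient f q * (cnj (snd q) * dwbar \<theta> q))"
      "integrable lborel (\<lambda>q. chart_coefficient f q * (cnj (fst q) * dzbar \<theta> q))"
      using integrable_mult_test_function[where a = 0, OF H test_functions_mono[OF test_functions_mult[OF cs test_functions_wirtinger[OF \<theta>]] subset_UNIV]]
       integrable_mult_test_function[where a = 0, OF H test_functions_mono[OF test_functions_mult[OF cf test_functions_wirtinger[OF \<theta>]] subset_UNIV]]
      by (simp_all add: dwbar_eq_wirtinger dzbar_eq_wirtinger)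
    from Bochner_Integration.integrable_diff[OF this] show ?thesis by (simp only: right_diff_distrib)
  qed
  \<comment> \<open>The left-hand side is \<open>\<partial>/\<partial>w\<^sup>*\<close> of \<open>w\<^sup>* \<theta> = X \<phi>\<close>.\<close>
  have pt: "cnj (snd q) * dwbar \<theta> q + \<theta> q = X (snd q) * dwbar \<phi> q + dbar1 X (snd q) * \<phi> q" for q
  proof -
    have eq: "(\<lambda>q. cnj (snd q) * \<theta> q) = (\<lambda>q. X (snd q) * \<phi> q)"
    proof
      fix q :: "complex \<times> complex"
      show "cnj (snd q) * \<theta> q = X (snd q) * \<phi> q"
        using X(2) X(3)[of "snd q"] by (cases "snd q = 0") (simp_all add: \<theta>_def m_def)
    qed
    have "dwbar (\<lambda>q. cnj (snd q) * \<theta> q) q = cnj (snd q) * dwbar \<theta> q + \<theta> q"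
      using wirtinger_mult[OF cs \<theta>s UNIV_I, of "(0, 1)" "(0, \<i>)" q] wirtinger_cnj_snd[of q]
      by (simp only: dwbar_eq_wirtinger mult_1_left)
    moreover have "dwbar (\<lambda>q. X (snd q) * \<phi> q) q = X (snd q) * dwbar \<phi> q + dbar1 X (snd q) * \<phi> q"
      using wirtinger_mult[OF Xs K(1) UNIV_I, of "(0, 1)" "(0, \<i>)" q] wirtinger_comp_snd(2)[OF X(1) UNIV_I, of q]
      by (simp only: dwbar_eq_wirtinger)
    ultimately show ?thesis by (simp only: eq)
  qed
  have "(LINT q|lborel. chart_coefficient f q * (X (snd q) * dwbar \<phi> q + dbar1 X (snd q) * \<phi> q))
      = (LINT q|lborel. chart_coefficient f q * (cnj (fst q) * dzbar \<theta> q + \<theta> q)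
          + chart_coefficient f q * (cnj (snd q) * dwbar \<theta> q - cnj (fst q) * dzbar \<theta> q))"
    by (intro Bochner_Integration.integral_cong refl) (simp add: pt[symmetric] distrib_left right_diff_distrib)
  also have "\<dots> = (LINT q|lborel. chart_coefficient f q * dzbar (\<lambda>q. cnj (fst q) * \<theta> q) q) + 0"
    unfolding d\<theta>2 integral_chart_coefficient_test(2)[OF f \<theta>, symmetric]
    by (rule Bochner_Integration.integral_add[OF A B])
  also have "\<dots> = 0" using integral_chart_coefficient_test(1)[OF f \<theta>2] by simp
  finally show "(LINT q|lborel. chart_coefficient f q * (X (snd q) * dwbar \<phi> q + dbar1 X (snd q) * \<phi> q)) = 0" .
qed

lemma integrable_of_square_integrable:
  fixes h :: "'a::euclidean_space \<Rightarrow> complex"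
  assumes [measurable]: "h \<in> borel_measurable borel" "U \<in> sets borel" and "bounded U"
    and "\<And>x. x \<notin> U \<Longrightarrow> h x = 0" and fin: "sqint lborel h < \<infinity>"
  shows "integrable lborel h"
proof (rule integrableI_bounded)
  have "(\<integral>\<^sup>+x. ennreal (norm (h x)) \<partial>lborel) \<le> (\<integral>\<^sup>+x. indicator U x + ennreal ((norm (h x))\<^sup>2) \<partial>lborel)"
  proof (rule nn_integral_mono)
    fix x
    have "t \<le> 1 + t\<^sup>2" for t :: real
    proof -
      have "2 * t \<le> 1 + t\<^sup>2" using sum_squares_bound[of 1 t] by simp
      then show ?thesis using zero_le_power2[of t] by linarith
    qed
    then have "ennreal (norm (h x)) \<le> ennreal (1 + (norm (h x))\<^sup>2)" by (rule ennreal_leI)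
    also have "\<dots> = 1 + ennreal ((norm (h x))\<^sup>2)" by (simp add: ennreal_plus)
    finally show "ennreal (norm (h x)) \<le> indicator U x + ennreal ((norm (h x))\<^sup>2)"
      using assms(4)[of x] by (cases "x \<in> U") simp_all
  qed
  also have "\<dots> = emeasure lborel U + sqint lborel h"
    by (subst nn_integral_add) simp_all
  also have "\<dots> < \<infinity>" using fin emeasure_bounded_finite[OF assms(3)] by simp
  finally show "(\<integral>\<^sup>+x. ennreal (norm (h x)) \<partial>lborel) < \<infinity>" .
qed simp

text \<open>The hyperplane \<open>w = 0\<close> is removable for square integrable functions: with cutoffs of
  vanishing Dirichlet energy, the boundary term is controlled by Cauchy-Schwarz.\<close>

lemma weakly_dbar_closed_chart_coefficient:
  assumes f: "f \<in> borel_measurable borel" "\<forall>p. p \<notin> hartogs_triangle \<longrightarrow> f p = 0"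
    "weakly_dbar_closed hartogs_triangle f"
    and H2: "sqint lborel (chart_coefficient f) < \<infinity>"
  shows "weakly_dbar_closed bidisc (chart_coefficient f)"
  unfolding weakly_dbar_closed_def
proof
  let ?H = "chart_coefficient f"
  have Hm [measurable]: "?H \<in> borel_measurable borel" by (rule measurable_chart_coefficient[OF f(1)])
  have H: "integrable lborel ?H"
    by (rule integrable_of_square_integrable[OF Hm borel_bidisc bounded_bidisc _ H2])
      (use punctured_bidisc_subset in \<open>auto intro: chart_coefficient_eq_0\<close>)
  fix \<phi> :: "complex \<times> complex \<Rightarrow> complex" assume \<phi>: "\<phi> \<in> test_functions bidisc"
  obtain K where K: "smooth_on UNIV \<phi>" "compact K" "K \<subseteq> bidisc" "\<And>x. x \<notin> K \<Longrightarrow> \<phi> x = 0"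
    using \<phi> by (rule test_functionsE) blast
  obtain C where C: "C \<ge> 0" "\<And>x. norm (\<phi> x) \<le> C"
    using continuous_compact_support_bounded[OF smooth_on_continuous[OF K(1)] K(2,4)] by blast
  have [measurable]: "\<phi> \<in> borel_measurable borel"
    by (rule borel_measurable_continuous_onI[OF smooth_on_continuous[OF K(1)]])
  obtain X :: "nat \<Rightarrow> complex \<Rightarrow> complex" where X: "\<And>N. smooth_on UNIV (X N)"
    "\<And>N. \<exists>e>0. \<forall>w. cmod w < e \<longrightarrow> X N w = 0"
    "\<And>N w. cmod (X N w) \<le> 1"  "\<And>N w. cmod (1 - X N w) \<le> 1"
    "\<And>w. w \<noteq> 0 \<Longrightarrow> (\<lambda>N. X N w) \<longlonglongrightarrow> 1"
    "(\<lambda>N. \<integral>\<^sup>+ w. ennreal ((cmod (dbar1 (X N) w))\<^sup>2) \<partial>lborel) \<longlonglongrightarrow> 0"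
    by (rule small_energy_cutoffs) blast
  have Xm [measurable]: "(\<lambda>q :: complex \<times> complex. X N (snd q)) \<in> borel_measurable borel" for N
    by (rule borel_measurable_continuous_onI[OF smooth_on_continuous[OF smooth_on_comp_snd[OF X(1)]]])
  have dX: "smooth_on UNIV (dbar1 (X N))" for N
    unfolding dbar1_eq_wirtinger by (rule smooth_on_wirtinger[OF open_UNIV X(1)])
  have dXm [measurable]: "(\<lambda>q :: complex \<times> complex. dbar1 (X N) (snd q)) \<in> borel_measurable borel" for N
    by (rule borel_measurable_continuous_onI[OF smooth_on_continuous[OF smooth_on_comp_snd[OF dX]]])
  have dX1 [measurable]: "dbar1 (X N) \<in> borel_measurable borel" for N
    by (rule borel_measurable_continuous_onI[OF smooth_on_continuous[OF dX]])
  have lim1: "(\<lambda>N. LINT q|lborel. ?H q * (X N (snd q) * k q)) \<longlonglongrightarrow> (LINT q|lborel. ?H q * k q)"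
    if k: "k \<in> test_functions bidisc" for k
  proof (rule integral_dominated_convergence[where w = "\<lambda>q. norm (?H q * k q)"])
    have i: "integrable lborel (\<lambda>q. ?H q * k q)"
      using integrable_mult_test_function[where a = 0, OF H test_functions_mono[OF k subset_UNIV]] by simp
    then show "integrable lborel (\<lambda>q. norm (?H q * k q))" by (rule integrable_norm)
    show "(\<lambda>q. ?H q * k q) \<in> borel_measurable lborel" using i by auto
    have "k \<in> borel_measurable borel"
      using k by (rule test_functionsE) (intro borel_measurable_continuous_onI smooth_on_continuous)
    then show "(\<lambda>q. ?H q * (X N (snd q) * k q)) \<in> borel_measurable lborel" for N by simp
    show "AE q in lborel. (\<lambda>N. ?H q * (X N (snd q) * k q)) \<longlonglongrightarrow> ?H q * k q"
    proof (rule AE_I2)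
      fix q
      show "(\<lambda>N. ?H q * (X N (snd q) * k q)) \<longlonglongrightarrow> ?H q * k q"
      proof (cases "snd q = 0")
        case True
        then show ?thesis by (simp add: chart_coefficient_def)
      next
        case False
        from tendsto_mult[OF tendsto_const tendsto_mult[OF X(5)[OF False] tendsto_const]] show ?thesis by simp
      qed
    qed
    show "AE q in lborel. norm (?H q * (X N (snd q) * k q)) \<le> norm (?H q * k q)" for N
    proof (rule AE_I2)
      fix q
      have "cmod (X N (snd q)) * cmod (k q) \<le> 1 * cmod (k q)" by (intro mult_right_mono X(3)) simp
      then show "norm (?H q * (X N (snd q) * k q)) \<le> norm (?H q * k q)"
        by (simp add: norm_mult mult_left_mono)
    qed
  qed
  have lim2: "(\<lambda>N. LINT q|lborel. ?H q * (dbar1 (X N) (snd q) * \<phi> q)) \<longlonglongrightarrow> 0"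
  proof -
    let ?I = "\<integral>\<^sup>+q. ennreal ((cmod (?H q))\<^sup>2) \<partial>lborel"
    have b: "ennreal ((norm (LINT q|lborel. ?H q * (dbar1 (X N) (snd q) * \<phi> q)))\<^sup>2)
      \<le> ?I * ennreal (C\<^sup>2) * 4 * sqint lborel (dbar1 (X N))" for N
    proof -
      have "ennreal ((norm (LINT q|lborel. ?H q * (dbar1 (X N) (snd q) * \<phi> q)))\<^sup>2)
        \<le> ?I * sqint lborel (\<lambda>q. dbar1 (X N) (snd q) * \<phi> q)"
        by (rule norm_integral_mult_square_le) measurable
      also have "sqint lborel (\<lambda>q. dbar1 (X N) (snd q) * \<phi> q)
        \<le> (\<integral>\<^sup>+q. ennreal (C\<^sup>2) * (indicator bidisc q * ennreal ((cmod (dbar1 (X N) (snd q)))\<^sup>2)) \<partial>lborel)"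
      proof (rule nn_integral_mono)
        fix q
        show "ennreal ((cmod (dbar1 (X N) (snd q) * \<phi> q))\<^sup>2)
          \<le> ennreal (C\<^sup>2) * (indicator bidisc q * ennreal ((cmod (dbar1 (X N) (snd q)))\<^sup>2))"
        proof (cases "q \<in> bidisc")
          case True
          have "(cmod (dbar1 (X N) (snd q) * \<phi> q))\<^sup>2 = (cmod (\<phi> q))\<^sup>2 * (cmod (dbar1 (X N) (snd q)))\<^sup>2"
            by (simp add: norm_mult power_mult_distrib)
          also have "\<dots> \<le> C\<^sup>2 * (cmod (dbar1 (X N) (snd q)))\<^sup>2"
            by (intro mult_right_mono power_mono C) auto
          finally have "ennreal ((cmod (dbar1 (X N) (snd q) * \<phi> q))\<^sup>2) \<le> ennreal (C\<^sup>2 * (cmod (dbar1 (X N) (snd q)))\<^sup>2)"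
            by (rule ennreal_leI)
          then show ?thesis using True by (simp add: ennreal_mult)
        next
          case False
          then have "\<phi> q = 0" using K(3,4) by blast
          then show ?thesis by simp
        qed
      qed
      also have "\<dots> = ennreal (C\<^sup>2) * (\<integral>\<^sup>+q. indicator bidisc q * ennreal ((cmod (dbar1 (X N) (snd q)))\<^sup>2) \<partial>lborel)"
        by (rule nn_integral_cmult) measurable
      also have "\<dots> \<le> ennreal (C\<^sup>2) * (4 * sqint lborel (dbar1 (X N)))"
        by (intro mult_left_mono nn_integral_bidisc_snd_le) auto
      finally show ?thesis by (simp only: mult.assoc mult_left_mono zero_le)
    qed
    have "?I * ennreal (C\<^sup>2) * 4 \<noteq> \<infinity>" using H2 by (simp add: ennreal_mult_eq_top_iff)
    then have "(\<lambda>N. ?I * ennreal (C\<^sup>2) * 4 * sqint lborel (dbar1 (X N))) \<longlonglongrightarrow> ?I * ennreal (C\<^sup>2) * 4 * 0"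
      by (intro ennreal_tendsto_cmult X(6)) (simp add: less_top)
    then have lim: "(\<lambda>N. ?I * ennreal (C\<^sup>2) * 4 * sqint lborel (dbar1 (X N))) \<longlonglongrightarrow> 0" by simp
    have "(\<lambda>N. ennreal ((norm (LINT q|lborel. ?H q * (dbar1 (X N) (snd q) * \<phi> q)))\<^sup>2)) \<longlonglongrightarrow> ennreal 0"
      unfolding ennreal_0
      by (rule tendsto_sandwich[OF _ _ tendsto_const lim]) (auto simp: b)
    then have "(\<lambda>N. (norm (LINT q|lborel. ?H q * (dbar1 (X N) (snd q) * \<phi> q)))\<^sup>2) \<longlonglongrightarrow> 0"
      by (subst (asm) tendsto_ennreal_iff) auto
    from tendsto_real_sqrt[OF this] show ?thesis by (simp add: tendsto_norm_zero_iff)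
  qed
  have c: "(LINT q|lborel. ?H q * (X N (snd q) * dzbar \<phi> q)) = 0"
    "(LINT q|lborel. ?H q * (X N (snd q) * dwbar \<phi> q + dbar1 (X N) (snd q) * \<phi> q)) = 0" for N
  proof -
    obtain e where e: "e > 0" "\<And>w. cmod w < e \<Longrightarrow> X N w = 0" using X(2)[of N] by blast
    show "(LINT q|lborel. ?H q * (X N (snd q) * dzbar \<phi> q)) = 0"
      "(LINT q|lborel. ?H q * (X N (snd q) * dwbar \<phi> q + dbar1 (X N) (snd q) * \<phi> q)) = 0"
      using integral_chart_coefficient_cutoff[OF f H \<phi> X(1)[of N] e] by blast+
  qed
  have tz: "dzbar \<phi> \<in> test_functions bidisc" and tw: "dwbar \<phi> \<in> test_functions bidisc"
    unfolding dzbar_eq_wirtinger dwbar_eq_wirtinger by (rule test_functions_wirtinger[OF \<phi>])+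
  have z: "(LINT q|lborel. ?H q * dzbar \<phi> q) = 0"
    using lim1[OF tz] unfolding c(1) by (rule LIMSEQ_unique) (rule tendsto_const)
  have "(LINT q|lborel. ?H q * (X N (snd q) * dwbar \<phi> q)) = - (LINT q|lborel. ?H q * (dbar1 (X N) (snd q) * \<phi> q))" for N
  proof -
    have t1: "(\<lambda>q. X N (snd q) * dwbar \<phi> q) \<in> test_functions UNIV"
      by (rule test_functions_mult[OF smooth_on_comp_snd[OF X(1)] test_functions_mono[OF tw subset_UNIV]])
    have t2: "(\<lambda>q. dbar1 (X N) (snd q) * \<phi> q) \<in> test_functions UNIV"
      by (rule test_functions_mult[OF smooth_on_comp_snd[OF dX] test_functions_mono[OF \<phi> subset_UNIV]])
    have "(LINT q|lborel. ?H q * (X N (snd q) * dwbar \<phi> q)) + (LINT q|lborel. ?H q * (dbar1 (X N) (snd q) * \<phi> q)) = 0"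
      unfolding c(2)[of N, symmetric] distrib_left
      using integrable_mult_test_function[where a = 0, OF H t1] integrable_mult_test_function[where a = 0, OF H t2]
      by (intro Bochner_Integration.integral_add[symmetric]) simp_all
    then show ?thesis by (metis eq_neg_iff_add_eq_0)
  qed
  then have "(\<lambda>N. LINT q|lborel. ?H q * (X N (snd q) * dwbar \<phi> q)) \<longlonglongrightarrow> 0"
    using tendsto_minus[OF lim2] by simp
  then have w: "(LINT q|lborel. ?H q * dwbar \<phi> q) = 0"
    by (rule LIMSEQ_unique[OF lim1[OF tw]])
  show "(LINT q|lborel. ?H q * dzbar \<phi> q) = 0 \<and> (LINT q|lborel. ?H q * dwbar \<phi> q) = 0"
    using z w by blast
qed

section \<open>Holomorphic smoothing on the bidisc\<close>

text \<open>In each coordinate \<open>|u| < (1 - \<delta>) + \<delta> = 1\<close>; this is why the point is contracted by the factor \<open>1 - \<delta>\<close>.\<close>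

lemma cball_subset_bidisc:
  assumes x: "x \<in> bidisc" and \<delta>: "0 < \<delta>" "\<delta> < 1"
  shows "cball ((1 - \<delta>) *\<^sub>R x) \<delta> \<subseteq> bidisc"
proof
  fix u :: "complex \<times> complex" assume "u \<in> cball ((1 - \<delta>) *\<^sub>R x) \<delta>"
  then have u: "norm (u - (1 - \<delta>) *\<^sub>R x) \<le> \<delta>" by (simp add: dist_norm norm_minus_commute)
  have "norm (fst v) \<le> norm v" "norm (snd v) \<le> norm v" for v :: "complex \<times> complex"
    by (cases v, simp add: norm_fst_le norm_snd_le)+
  from order_trans[OF this(1) u] order_trans[OF this(2) u]
  have "norm (fst (u - (1 - \<delta>) *\<^sub>R x)) \<le> \<delta>" "norm (snd (u - (1 - \<delta>) *\<^sub>R x)) \<le> \<delta>" by blast+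
  then have d: "norm (fst u - (1 - \<delta>) *\<^sub>R fst x) \<le> \<delta>" "norm (snd u - (1 - \<delta>) *\<^sub>R snd x) \<le> \<delta>"
    by simp_all
  have *: "norm a < 1" if "norm (a - (1 - \<delta>) *\<^sub>R b) \<le> \<delta>" "norm b < 1" for a b :: complex
  proof -
    have "norm a \<le> norm ((1 - \<delta>) *\<^sub>R b) + norm (a - (1 - \<delta>) *\<^sub>R b)" by (rule norm_triangle_sub)
    also have "\<dots> \<le> (1 - \<delta>) * norm b + \<delta>" using that(1) \<delta> by simp
    also have "\<dots> < (1 - \<delta>) * 1 + \<delta>" using that(2) \<delta> by (intro add_strict_right_mono mult_strict_left_mono) auto
    finally show ?thesis by simp
  qed
  have "norm (fst x) < 1" "norm (snd x) < 1" using x by (auto simp: bidisc_def)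
  with *[OF d(1)] *[OF d(2)] show "u \<in> bidisc" by (cases u) (simp add: bidisc_def)
qed

lemma wirtinger_dilated_conv:
  fixes h \<phi> :: "'a::euclidean_space \<Rightarrow> complex"
  assumes h: "integrable lborel h" and \<phi>: "\<phi> \<in> test_functions UNIV"
  shows "wirtinger a b (dilated_conv h \<phi> r) x
    = - of_real r * (LINT u|lborel. h u * wirtinger a b \<phi> (u - r *\<^sub>R x))"
proof -
  obtain K where K: "smooth_on UNIV \<phi>" using \<phi> by (rule test_functionsE) blast
  let ?D = "\<lambda>y. frechet_derivative \<phi> (at y)"
  have lin: "?D y (- (r *\<^sub>R v)) = - of_real r * ?D y v" for y v
  proof -
    interpret bounded_linear "?D y" by (rule has_derivative_bounded_linear[OF smooth_onD[OF K UNIV_I]])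
    show ?thesis by (simp only: neg scaleR) (simp add: scaleR_conv_of_real)
  qed
  have int: "integrable lborel (\<lambda>u. h u * ?D (u - r *\<^sub>R x) v)" for v
    by (rule integrable_mult_test_function[OF h test_functions_frechet_derivative[OF \<phi>]])
  have J: "dilated_conv h (\<lambda>y. ?D y (- (r *\<^sub>R v))) r x = - of_real r * (LINT u|lborel. h u * ?D (u - r *\<^sub>R x) v)" for v
  proof -
    have "dilated_conv h (\<lambda>y. ?D y (- (r *\<^sub>R v))) r x = (LINT u|lborel. - of_real r * (h u * ?D (u - r *\<^sub>R x) v))"
      unfolding dilated_conv_def lin by (simp only: mult.left_commute)
    then show ?thesis by (simp only: integral_mult_right_zero)
  qed
  have "wirtinger a b (dilated_conv h \<phi> r) x
      = (- of_real r * (LINT u|lborel. h u * ?D (u - r *\<^sub>R x) a) + \<i> * (- of_real r * (LINT u|lborel. h u * ?D (u - r *\<^sub>R x) b))) / 2"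
    by (simp only: wirtinger_has_derivative[OF dilated_conv_has_derivative[OF h \<phi>]] J)
  also have "\<dots> = - of_real r * (((LINT u|lborel. h u * ?D (u - r *\<^sub>R x) a) + \<i> * (LINT u|lborel. h u * ?D (u - r *\<^sub>R x) b)) / 2)"
    by (simp add: distrib_left mult.left_commute)
  also have "((LINT u|lborel. h u * ?D (u - r *\<^sub>R x) a) + \<i> * (LINT u|lborel. h u * ?D (u - r *\<^sub>R x) b)) / 2
      = (LINT u|lborel. (h u * ?D (u - r *\<^sub>R x) a + \<i> * (h u * ?D (u - r *\<^sub>R x) b)) / 2)"
    using int[of a] int[of b] by simp
  also have "\<dots> = (LINT u|lborel. h u * wirtinger a b \<phi> (u - r *\<^sub>R x))"
    by (rule Bochner_Integration.integral_cong) (simp_all add: wirtinger_def distrib_left mult.left_commute)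
  finally show ?thesis .
qed

lemma wirtinger_translate:
  assumes "smooth_on UNIV \<phi>"
  shows "wirtinger a b (\<lambda>u. \<phi> (u - c)) u = wirtinger a b \<phi> (u - c)"
proof -
  have "((\<lambda>u. u - c) has_derivative (\<lambda>v. v)) (at u)" by (auto intro!: derivative_eq_intros)
  from wirtinger_has_derivative[OF has_derivative_compose[OF this smooth_onD[OF assms UNIV_I]]]
  show ?thesis by (simp add: wirtinger_def)
qed

text \<open>The kernel centred at a contracted point of the bidisc is a test function on the bidisc, and differentiating the
  smoothing amounts to differentiating the kernel with respect to \<open>u\<close>, up to the factor \<open>-(1 - \<delta>)\<close>.\<close>

lemma smoothing_dbar_closed:
  assumes ker: "mollifying_kernel \<kappa> \<delta>" and \<delta>: "0 < \<delta>" "\<delta> < 1" and h: "integrable lborel h"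
    and closed: "weakly_dbar_closed bidisc h" and x: "x \<in> bidisc"
  shows "dzbar (dilated_conv h (\<lambda>y. complex_of_real (\<kappa> y)) (1 - \<delta>)) x = 0"
    and "dwbar (dilated_conv h (\<lambda>y. complex_of_real (\<kappa> y)) (1 - \<delta>)) x = 0"
proof -
  interpret mollifying_kernel \<kappa> \<delta> by (rule ker)
  let ?k = "\<lambda>y. complex_of_real (\<kappa> y)" and ?c = "(1 - \<delta>) *\<^sub>R x"
  have ks: "smooth_on UNIV ?k" by (rule smooth_on_linear[OF bounded_linear_of_real open_UNIV smooth])
  have t: "(\<lambda>u. ?k (u - ?c)) \<in> test_functions bidisc"
  proof (rule test_functionsI[OF _ compact_cball cball_subset_bidisc[OF x \<delta>]])
    have "smooth_on UNIV (\<lambda>u. u + (- ?c))"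
      by (rule smooth_on_add[OF open_UNIV smooth_on_ident[OF open_UNIV] smooth_on_const])
    from smooth_on_compose[OF open_UNIV ks this subset_UNIV] show "smooth_on UNIV (\<lambda>u. ?k (u - ?c))" by simp
    show "?k (u - ?c) = 0" if "u \<notin> cball ?c \<delta>" for u
      using that support[of "u - ?c"] by (simp add: dist_norm norm_minus_commute)
  qed
  have z: "(LINT u|lborel. h u * dzbar (\<lambda>u. ?k (u - ?c)) u) = 0"
    and w: "(LINT u|lborel. h u * dwbar (\<lambda>u. ?k (u - ?c)) u) = 0"
    using closed t by (auto simp: weakly_dbar_closed_def)
  show "dzbar (dilated_conv h ?k (1 - \<delta>)) x = 0"
    using z by (simp only: dzbar_eq_wirtinger wirtinger_translate[OF ks] wirtinger_dilated_conv[OF h test_function] mult_zero_right)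
  show "dwbar (dilated_conv h ?k (1 - \<delta>)) x = 0"
    using w by (simp only: dwbar_eq_wirtinger wirtinger_translate[OF ks] wirtinger_dilated_conv[OF h test_function] mult_zero_right)
qed

text \<open>The factor \<open>1/w\<close> is holomorphic.\<close>

lemma dbar1_divide_vanishing:
  assumes X: "smooth_on UNIV X" and w: "w \<noteq> 0"
  shows "dbar1 (\<lambda>w. X w * inverse w) w = dbar1 X w * inverse w"
proof -
  have inv: "smooth_on (- {0}) (inverse :: complex \<Rightarrow> complex)" by (simp add: smooth_on_def Ck_on_inverse)
  have "(inverse has_derivative (\<lambda>v. - (inverse w * v * inverse w))) (at w)" by (rule has_derivative_inverse'[OF w])
  from wirtinger_has_derivative[OF this, of 1 \<i>]
  have "wirtinger 1 \<i> inverse w = (- (inverse w * 1 * inverse w) + \<i> * (- (inverse w * \<i> * inverse w))) / 2" .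
  moreover have "- (c * 1 * c) + \<i> * (- (c * \<i> * c)) = - (c * c) * (1 + \<i> * \<i>)" for c by algebra
  ultimately have "wirtinger 1 \<i> inverse w = - (inverse w * inverse w) * (1 + \<i> * \<i>) / 2" by (simp only:)
  also have "\<dots> = 0" by simp
  finally have "wirtinger 1 \<i> inverse w = 0" .
  moreover have "wirtinger 1 \<i> (\<lambda>w. X w * inverse w) w = X w * wirtinger 1 \<i> inverse w + wirtinger 1 \<i> X w * inverse w"
    by (rule wirtinger_mult[OF smooth_on_subset[OF X subset_UNIV] inv]) (use w in simp)
  ultimately show ?thesis by (simp add: dbar1_eq_wirtinger)
qed

section \<open>Smooth approximants on the triangle\<close>

lemma pullback_triangle_chart: "snd q \<noteq> 0 \<Longrightarrow> pullback \<phi> (triangle_chart q) = \<phi> q"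
  by (simp add: pullback_def triangle_chart_def)

text \<open>Away from \<open>w = 0\<close> the function is a composition of smooth maps, near \<open>w = 0\<close> it is \<open>0\<close>.\<close>

lemma smooth_on_pullback:
  assumes \<Phi>: "smooth_on UNIV \<Phi>" and e: "e > 0" "\<And>q. cmod (snd q) < e \<Longrightarrow> \<Phi> q = 0"
  shows "smooth_on UNIV (pullback \<Phi>)"
proof (rule smooth_on_glue_zero[OF open_snd_nonzero])
  show "smooth_on {p. snd p \<noteq> 0} (pullback \<Phi>)"
    by (rule smooth_on_cong[OF open_snd_nonzero _ smooth_on_ratio[OF \<Phi>]]) (simp add: pullback_def)
  show "closed {p :: complex \<times> complex. e \<le> cmod (snd p)}" by (intro closed_Collect_le continuous_intros)
  show "{p. e \<le> cmod (snd p)} \<subseteq> {p. snd p \<noteq> 0}" using e(1) by auto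
  show "pullback \<Phi> p = 0" if "p \<notin> {p. e \<le> cmod (snd p)}" for p
    using that e(2)[of "(fst p / snd p, snd p)"] by (simp add: pullback_def)
qed

text \<open>With \<open>K\<close> the smoothing of \<open>H\<close> and a cutoff \<open>X\<close>, the approximant is \<open>X(w) w\<^sup>-\<^sup>1 K(z/w, w)\<close>.  In the chart its distance to
  \<open>f\<close> is that of \<open>X K\<close> to \<open>H\<close>, and the norm of its \<open>\<partial>\<^sup>*\<close> is that of \<open>K \<partial>\<^sup>*X\<close>.  The smoothing is fixed first; the
  cutoff is then chosen depending on the bound \<open>B\<close> for \<open>K\<close>.\<close>

lemma dbar_approximants:
  fixes f :: "complex \<times> complex \<Rightarrow> complex"
  assumes f: "f \<in> borel_measurable borel" "\<forall>p. p \<notin> hartogs_triangle \<longrightarrow> f p = 0"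
    "weakly_dbar_closed hartogs_triangle f"
    and f2: "(\<integral>\<^sup>+p. ennreal ((cmod (f p))\<^sup>2) * indicator hartogs_triangle p \<partial>lborel) < \<infinity>" and e: "e > 0"
  obtains F where "smooth_on UNIV F"
    "(\<integral>\<^sup>+p. ennreal ((cmod (F p - f p))\<^sup>2) * indicator hartogs_triangle p \<partial>lborel) < ennreal e"
    "(\<integral>\<^sup>+p. ennreal ((norm (dzbar F p, dwbar F p))\<^sup>2) * indicator hartogs_triangle p \<partial>lborel) < ennreal e"
proof -
  let ?H = "chart_coefficient f"
  have fm [measurable]: "f \<in> borel_measurable borel" by (rule f(1))
  have Hm [measurable]: "?H \<in> borel_measurable borel" by (rule measurable_chart_coefficient[OF f(1)])
  have H2: "sqint lborel ?H < \<infinity>"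
    using f2 by (simp only: nn_integral_norm_chart_coefficient[OF f(1)])
  have H: "integrable lborel ?H"
    by (rule integrable_of_square_integrable[OF Hm borel_bidisc bounded_bidisc _ H2])
      (use punctured_bidisc_subset in \<open>auto intro: chart_coefficient_eq_0\<close>)
  have closed: "weakly_dbar_closed bidisc ?H" by (rule weakly_dbar_closed_chart_coefficient[OF f H2])
  have e4: "e / 4 > 0" using e by simp
  obtain d where d: "d > 0" "\<And>\<kappa> \<delta>. mollifying_kernel \<kappa> \<delta> \<Longrightarrow> 0 < \<delta> \<Longrightarrow> \<delta> < d \<Longrightarrow>
       (\<integral>\<^sup>+x. ennreal (indicator bidisc x * (norm (dilated_conv ?H (\<lambda>y. complex_of_real (\<kappa> y)) (1 - \<delta>) x - ?H x))\<^sup>2) \<partial>lborel) < ennreal (e / 4)"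
    using smoothing_tendsto_L2[OF H H2 bounded_bidisc borel_bidisc e4] by blast
  define \<delta> where "\<delta> = min d 1 / 2"
  have \<delta>: "0 < \<delta>" "\<delta> < 1" "\<delta> < d" using d(1) by (auto simp: \<delta>_def min_def)
  obtain \<kappa> :: "complex \<times> complex \<Rightarrow> real" where "smooth_on UNIV \<kappa>" "\<And>y. \<kappa> y \<ge> 0" "\<And>y. norm y > \<delta> \<Longrightarrow> \<kappa> y = 0"
    "integrable lborel \<kappa>" "(LINT y|lborel. \<kappa> y) = 1"
    using mollifying_kernel_exists[OF \<delta>(1)] by blast
  then have ker: "mollifying_kernel \<kappa> \<delta>" by unfold_locales
  define K where "K = dilated_conv ?H (\<lambda>y. complex_of_real (\<kappa> y)) (1 - \<delta>)"
  have Ks: "smooth_on UNIV K"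
    unfolding K_def by (rule smooth_dilated_conv[OF H mollifying_kernel.test_function[OF ker]])
  have Km [measurable]: "K \<in> borel_measurable borel"
    by (rule borel_measurable_continuous_onI[OF smooth_on_continuous[OF Ks]])
  have KH: "(\<integral>\<^sup>+q. ennreal (indicator bidisc q * (norm (K q - ?H q))\<^sup>2) \<partial>lborel) < ennreal (e / 4)"
    unfolding K_def by (rule d(2)[OF ker \<delta>(1,3)])
  have K0: "dzbar K q = 0" "dwbar K q = 0" if "q \<in> bidisc" for q
    unfolding K_def by (rule smoothing_dbar_closed[OF ker \<delta>(1,2) H closed that])+
  have "compact (closure bidisc)" using bounded_bidisc by simp
  then have "bounded (K ` closure bidisc)"
    by (intro compact_imp_bounded compact_continuous_image continuous_on_subset[OF smooth_on_continuous[OF Ks]]) auto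
  then obtain B where B: "\<And>q. q \<in> bidisc \<Longrightarrow> cmod (K q) \<le> B"
    unfolding bounded_iff using closure_subset by blast
  obtain X :: "nat \<Rightarrow> complex \<Rightarrow> complex" where X: "\<And>N. smooth_on UNIV (X N)"
    "\<And>N. \<exists>e>0. \<forall>w. cmod w < e \<longrightarrow> X N w = 0"
    "\<And>N w. cmod (X N w) \<le> 1"  "\<And>N w. cmod (1 - X N w) \<le> 1"
    "\<And>w. w \<noteq> 0 \<Longrightarrow> (\<lambda>N. X N w) \<longlonglongrightarrow> 1"
    "(\<lambda>N. \<integral>\<^sup>+ w. ennreal ((cmod (dbar1 (X N) w))\<^sup>2) \<partial>lborel) \<longlonglongrightarrow> 0"
    by (rule small_energy_cutoffs) blast
  have Xm [measurable]: "(\<lambda>q :: complex \<times> complex. X N (snd q)) \<in> borel_measurable borel" for N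
    by (rule borel_measurable_continuous_onI[OF smooth_on_continuous[OF smooth_on_comp_snd[OF X(1)]]])
  have dX: "smooth_on UNIV (dbar1 (X N))" for N
    unfolding dbar1_eq_wirtinger by (rule smooth_on_wirtinger[OF open_UNIV X(1)])
  have dXm [measurable]: "dbar1 (X N) \<in> borel_measurable borel" for N
    by (rule borel_measurable_continuous_onI[OF smooth_on_continuous[OF dX]])
  have dXm2 [measurable]: "(\<lambda>q :: complex \<times> complex. dbar1 (X N) (snd q)) \<in> borel_measurable borel" for N
    by (rule borel_measurable_continuous_onI[OF smooth_on_continuous[OF smooth_on_comp_snd[OF dX]]])
  have "(\<lambda>N. \<integral>\<^sup>+q. ennreal ((cmod ((1 - X N (snd q)) * ?H q))\<^sup>2) \<partial>lborel) \<longlonglongrightarrow> (\<integral>\<^sup>+q. 0 \<partial>(lborel :: (complex \<times> complex) measure))"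
  proof (rule nn_integral_dominated_convergence[where w = "\<lambda>q. ennreal ((cmod (?H q))\<^sup>2)"])
    show "AE q in lborel. ennreal ((cmod ((1 - X N (snd q)) * ?H q))\<^sup>2) \<le> ennreal ((cmod (?H q))\<^sup>2)" for N
    proof (rule AE_I2)
      fix q
      have "cmod ((1 - X N (snd q)) * ?H q) \<le> 1 * cmod (?H q)"
        unfolding norm_mult by (intro mult_right_mono X(4)) simp
      then show "ennreal ((cmod ((1 - X N (snd q)) * ?H q))\<^sup>2) \<le> ennreal ((cmod (?H q))\<^sup>2)"
        by (intro ennreal_leI power_mono) auto
    qed
    show "AE q in lborel. (\<lambda>N. ennreal ((cmod ((1 - X N (snd q)) * ?H q))\<^sup>2)) \<longlonglongrightarrow> 0"
    proof (rule AE_I2)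
      fix q
      have "(\<lambda>N. (cmod ((1 - X N (snd q)) * ?H q))\<^sup>2) \<longlonglongrightarrow> 0"
      proof (cases "snd q = 0")
        case True
        then show ?thesis by (simp add: chart_coefficient_def)
      next
        case False
        have "(\<lambda>N. (cmod ((1 - X N (snd q)) * ?H q))\<^sup>2) \<longlonglongrightarrow> (cmod ((1 - 1) * ?H q))\<^sup>2"
          by (intro tendsto_intros X(5) False)
        then show ?thesis by simp
      qed
      from tendsto_ennrealI[OF this] show "(\<lambda>N. ennreal ((cmod ((1 - X N (snd q)) * ?H q))\<^sup>2)) \<longlonglongrightarrow> 0" by simp
    qed
  qed (use H2 in auto)
  then have ev1: "eventually (\<lambda>N. sqint lborel (\<lambda>q. (1 - X N (snd q)) * ?H q) < ennreal (e / 4)) sequentially"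
    using e4 by (intro order_tendstoD(2)) auto
  have "(\<lambda>N. ennreal (B\<^sup>2) * (4 * sqint lborel (dbar1 (X N)))) \<longlonglongrightarrow> ennreal (B\<^sup>2) * (4 * 0)"
    by (intro ennreal_tendsto_cmult X(6)) auto
  then have ev2: "eventually (\<lambda>N. ennreal (B\<^sup>2) * (4 * sqint lborel (dbar1 (X N))) < ennreal e) sequentially"
    using e by (intro order_tendstoD(2)) auto
  obtain N where N: "sqint lborel (\<lambda>q. (1 - X N (snd q)) * ?H q) < ennreal (e / 4)"
    "ennreal (B\<^sup>2) * (4 * sqint lborel (dbar1 (X N))) < ennreal e"
    using eventually_happens[OF eventually_conj[OF ev1 ev2]] by auto
  obtain t where t: "t > 0" "\<And>w. cmod w < t \<Longrightarrow> X N w = 0" using X(2)[of N] by blast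
  define m where "m w = X N w * inverse w" for w
  have m: "smooth_on UNIV m"
    unfolding m_def[abs_def] by (rule smooth_on_divide_vanishing[OF X(1) smooth_on_ident[OF open_UNIV] _ t]) auto
  define \<Phi> where "\<Phi> q = m (snd q) * K q" for q
  have \<Phi>: "smooth_on UNIV \<Phi>"
    unfolding \<Phi>_def[abs_def] by (rule smooth_on_mult[OF open_UNIV smooth_on_comp_snd[OF m] Ks])
  define F where "F = pullback \<Phi>"
  have F: "smooth_on UNIV F"
    unfolding F_def by (rule smooth_on_pullback[OF \<Phi> t(1)]) (simp add: \<Phi>_def m_def t(2))
  have dF: "dzbar F (triangle_chart q) = 0" "dwbar F (triangle_chart q) = dbar1 (X N) (snd q) * inverse (snd q) * K q"
    if q: "q \<in> punctured_bidisc" for q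
  proof -
    have w: "snd q \<noteq> 0" and qb: "q \<in> bidisc" using q by (auto simp: punctured_bidisc_def bidisc_def)
    have z: "dzbar \<Phi> q = 0"
      using wirtinger_mult[OF smooth_on_comp_snd[OF m] Ks UNIV_I, of "(1, 0)" "(\<i>, 0)" q]
        wirtinger_comp_snd(1)[OF m UNIV_I, of q] K0(1)[OF qb]
      by (simp add: \<Phi>_def[abs_def] dzbar_eq_wirtinger)
    have "dwbar \<Phi> q = dbar1 m (snd q) * K q"
      using wirtinger_mult[OF smooth_on_comp_snd[OF m] Ks UNIV_I, of "(0, 1)" "(0, \<i>)" q]
        wirtinger_comp_snd(2)[OF m UNIV_I, of q] K0(2)[OF qb]
      by (simp add: \<Phi>_def[abs_def] dwbar_eq_wirtinger)
    also have "dbar1 m (snd q) = dbar1 (X N) (snd q) * inverse (snd q)"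
      unfolding m_def[abs_def] by (rule dbar1_divide_vanishing[OF X(1) w])
    finally have "dwbar \<Phi> q = dbar1 (X N) (snd q) * inverse (snd q) * K q" .
    with z show "dzbar F (triangle_chart q) = 0" "dwbar F (triangle_chart q) = dbar1 (X N) (snd q) * inverse (snd q) * K q"
      unfolding F_def by (simp_all add: pullback_wirtinger[OF \<Phi> w])
  qed
  have [measurable]: "F \<in> borel_measurable borel"
    by (rule borel_measurable_continuous_onI[OF smooth_on_continuous[OF F]])
  have [measurable]: "dzbar F \<in> borel_measurable borel" "dwbar F \<in> borel_measurable borel"
    unfolding dzbar_eq_wirtinger dwbar_eq_wirtinger
    by (rule borel_measurable_continuous_onI[OF smooth_on_continuous[OF smooth_on_wirtinger[OF open_UNIV F]]])+
  show ?thesis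
  proof (rule that[OF F])
    have "(\<integral>\<^sup>+p. ennreal ((cmod (F p - f p))\<^sup>2) * indicator hartogs_triangle p \<partial>lborel)
        = (\<integral>\<^sup>+q. ennreal (indicator punctured_bidisc q * (cmod (snd q))\<^sup>2) * ennreal ((cmod (F (triangle_chart q) - f (triangle_chart q)))\<^sup>2) \<partial>lborel)"
      by (rule nn_integral_hartogs_triangle) measurable
    also have "\<dots> \<le> (\<integral>\<^sup>+q. 2 * ennreal (indicator bidisc q * (norm (K q - ?H q))\<^sup>2) + 2 * ennreal ((cmod ((1 - X N (snd q)) * ?H q))\<^sup>2) \<partial>lborel)"
    proof (rule nn_integral_mono)
      fix q
      show "ennreal (indicator punctured_bidisc q * (cmod (snd q))\<^sup>2) * ennreal ((cmod (F (triangle_chart q) - f (triangle_chart q)))\<^sup>2)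
        \<le> 2 * ennreal (indicator bidisc q * (norm (K q - ?H q))\<^sup>2) + 2 * ennreal ((cmod ((1 - X N (snd q)) * ?H q))\<^sup>2)"
      proof (cases "q \<in> punctured_bidisc")
        case True
        then have w: "snd q \<noteq> 0" and qb: "q \<in> bidisc" by (auto simp: punctured_bidisc_def bidisc_def)
        have "snd q * (F (triangle_chart q) - f (triangle_chart q)) = X N (snd q) * K q - ?H q"
          using w True by (simp add: F_def pullback_triangle_chart \<Phi>_def m_def chart_coefficient_def right_diff_distrib)
        then have "(cmod (snd q))\<^sup>2 * (cmod (F (triangle_chart q) - f (triangle_chart q)))\<^sup>2 = (cmod (X N (snd q) * K q - ?H q))\<^sup>2"
          by (metis norm_mult power_mult_distrib)
        also have "\<dots> \<le> 2 * (cmod (X N (snd q) * K q - X N (snd q) * ?H q))\<^sup>2 + 2 * (cmod (X N (snd q) * ?H q - ?H q))\<^sup>2"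
          by (rule norm_diff_square_le)
        also have "cmod (X N (snd q) * ?H q - ?H q) = cmod ((1 - X N (snd q)) * ?H q)"
          by (subst norm_minus_commute) (simp add: left_diff_distrib)
        also have "(cmod (X N (snd q) * K q - X N (snd q) * ?H q))\<^sup>2 \<le> (cmod (K q - ?H q))\<^sup>2"
        proof (rule power_mono)
          have "cmod (X N (snd q) * (K q - ?H q)) \<le> 1 * cmod (K q - ?H q)"
            unfolding norm_mult by (intro mult_right_mono X(3)) simp
          then show "cmod (X N (snd q) * K q - X N (snd q) * ?H q) \<le> cmod (K q - ?H q)" by (simp add: right_diff_distrib)
        qed simp
        finally have le: "(cmod (snd q))\<^sup>2 * (cmod (F (triangle_chart q) - f (triangle_chart q)))\<^sup>2
            \<le> 2 * (cmod (K q - ?H q))\<^sup>2 + 2 * (cmod ((1 - X N (snd q)) * ?H q))\<^sup>2" by simp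
        have "ennreal (indicator punctured_bidisc q * (cmod (snd q))\<^sup>2) * ennreal ((cmod (F (triangle_chart q) - f (triangle_chart q)))\<^sup>2)
            = ennreal ((cmod (snd q))\<^sup>2 * (cmod (F (triangle_chart q) - f (triangle_chart q)))\<^sup>2)"
          using True by (simp add: ennreal_mult)
        also have "\<dots> \<le> ennreal (2 * (cmod (K q - ?H q))\<^sup>2 + 2 * (cmod ((1 - X N (snd q)) * ?H q))\<^sup>2)"
          by (rule ennreal_leI[OF le])
        also have "\<dots> = 2 * ennreal (indicator bidisc q * (norm (K q - ?H q))\<^sup>2) + 2 * ennreal ((cmod ((1 - X N (snd q)) * ?H q))\<^sup>2)"
          using qb by (simp add: ennreal_plus ennreal_mult)
        finally show ?thesis .
      qed simp
    qed
    also have "\<dots> = 2 * (\<integral>\<^sup>+q. ennreal (indicator bidisc q * (norm (K q - ?H q))\<^sup>2) \<partial>lborel) + 2 * sqint lborel (\<lambda>q. (1 - X N (snd q)) * ?H q)"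
      by (simp add: nn_integral_add nn_integral_cmult)
    also have "\<dots> < 2 * ennreal (e / 4) + 2 * ennreal (e / 4)"
      using KH N(1) by (intro add_strict_mono ennreal_mult_strict_left_mono) auto
    also have "\<dots> = ennreal e"
      using e by (simp add: ennreal_plus[symmetric] ennreal_mult[symmetric] ennreal_numeral[symmetric] del: ennreal_plus ennreal_numeral)
    finally show "(\<integral>\<^sup>+p. ennreal ((cmod (F p - f p))\<^sup>2) * indicator hartogs_triangle p \<partial>lborel) < ennreal e" .
    have "(\<integral>\<^sup>+p. ennreal ((norm (dzbar F p, dwbar F p))\<^sup>2) * indicator hartogs_triangle p \<partial>lborel)
        = (\<integral>\<^sup>+q. ennreal (indicator punctured_bidisc q * (cmod (snd q))\<^sup>2)
             * ennreal ((norm (dzbar F (triangle_chart q), dwbar F (triangle_chart q)))\<^sup>2) \<partial>lborel)"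
      by (rule nn_integral_hartogs_triangle) measurable
    also have "\<dots> \<le> (\<integral>\<^sup>+q. ennreal (B\<^sup>2) * (indicator bidisc q * ennreal ((cmod (dbar1 (X N) (snd q)))\<^sup>2)) \<partial>lborel)"
    proof (rule nn_integral_mono)
      fix q
      show "ennreal (indicator punctured_bidisc q * (cmod (snd q))\<^sup>2)
             * ennreal ((norm (dzbar F (triangle_chart q), dwbar F (triangle_chart q)))\<^sup>2)
        \<le> ennreal (B\<^sup>2) * (indicator bidisc q * ennreal ((cmod (dbar1 (X N) (snd q)))\<^sup>2))"
      proof (cases "q \<in> punctured_bidisc")
        case True
        then have w: "snd q \<noteq> 0" and qb: "q \<in> bidisc" by (auto simp: punctured_bidisc_def bidisc_def)
        have "(cmod (snd q))\<^sup>2 * (norm (dzbar F (triangle_chart q), dwbar F (triangle_chart q)))\<^sup>2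
            = (cmod (K q))\<^sup>2 * (cmod (dbar1 (X N) (snd q)))\<^sup>2"
          using w by (simp add: dF[OF True] norm_Pair norm_mult norm_inverse power_mult_distrib power_inverse)
        also have "\<dots> \<le> B\<^sup>2 * (cmod (dbar1 (X N) (snd q)))\<^sup>2"
          by (intro mult_right_mono power_mono B qb) auto
        finally have "ennreal ((cmod (snd q))\<^sup>2 * (norm (dzbar F (triangle_chart q), dwbar F (triangle_chart q)))\<^sup>2)
            \<le> ennreal (B\<^sup>2 * (cmod (dbar1 (X N) (snd q)))\<^sup>2)" by (rule ennreal_leI)
        then show ?thesis using True qb by (simp add: ennreal_mult)
      qed simp
    qed
    also have "\<dots> = ennreal (B\<^sup>2) * (\<integral>\<^sup>+q. indicator bidisc q * ennreal ((cmod (dbar1 (X N) (snd q)))\<^sup>2) \<partial>lborel)"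
      by (rule nn_integral_cmult) measurable
    also have "\<dots> \<le> ennreal (B\<^sup>2) * (4 * sqint lborel (dbar1 (X N)))"
      by (intro mult_left_mono nn_integral_bidisc_snd_le) auto
    also have "\<dots> < ennreal e" by (rule N(2))
    finally show "(\<integral>\<^sup>+p. ennreal ((norm (dzbar F p, dwbar F p))\<^sup>2) * indicator hartogs_triangle p \<partial>lborel) < ennreal e" .
  qed
qed

section \<open>The two kernels\<close>

lemma measurable_lebesgue_on:
  fixes f :: "'a::euclidean_space \<Rightarrow> 'b::euclidean_space"
  assumes "f \<in> borel_measurable borel"
  shows "f \<in> borel_measurable (lebesgue_on \<Omega>)"
  by (rule measurable_restrict_space1) (rule measurable_completion, use assms in simp)

lemma nn_integral_lebesgue_on_borel:
  fixes f :: "'a::euclidean_space \<Rightarrow> ennreal"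
  assumes [measurable]: "f \<in> borel_measurable borel" "S \<in> sets borel"
  shows "(\<integral>\<^sup>+x. f x \<partial>lebesgue_on S) = (\<integral>\<^sup>+x. f x * indicator S x \<partial>lborel)"
  by (subst nn_integral_restrict_space, simp, subst nn_integral_completion) simp_all

lemma L2_nn_integral:
  assumes "f \<in> L2 \<Omega>"
  shows "sqint (lebesgue_on \<Omega>) f = ennreal ((L2_norm \<Omega> f)\<^sup>2)"
  using assms unfolding L2_def L2_norm_def
  by (subst nn_integral_eq_integral) auto

lemma L2_norm_le:
  assumes "sqint (lebesgue_on \<Omega>) f \<le> ennreal (e\<^sup>2)" "e \<ge> 0"
  shows "L2_norm \<Omega> f \<le> e"
proof -
  have "(LINT x|lebesgue_on \<Omega>. (norm (f x))\<^sup>2) \<le> e\<^sup>2"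
    by (rule integral_real_bounded[OF _ assms(1)]) simp
  then have "L2_norm \<Omega> f \<le> sqrt (e\<^sup>2)" unfolding L2_norm_def by (rule real_sqrt_le_mono)
  then show ?thesis using assms(2) by simp
qed

lemma L2_norm_nonneg: "L2_norm \<Omega> f \<ge> 0"
  unfolding L2_norm_def by simp

lemma L2_diff:
  assumes f: "f \<in> L2 \<Omega>" and g: "g \<in> L2 \<Omega>"
  shows "(\<lambda>x. f x - g x) \<in> L2 \<Omega>"
proof -
  have m [measurable]: "f \<in> borel_measurable (lebesgue_on \<Omega>)" "g \<in> borel_measurable (lebesgue_on \<Omega>)"
    using f g by (auto simp: L2_def)
  have "integrable (lebesgue_on \<Omega>) (\<lambda>x. (norm (f x - g x))\<^sup>2)"
  proof (rule Bochner_Integration.integrable_bound)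
    show "integrable (lebesgue_on \<Omega>) (\<lambda>x. 2 * (norm (f x))\<^sup>2 + 2 * (norm (g x))\<^sup>2)"
      using f g by (auto simp: L2_def)
    show "AE x in lebesgue_on \<Omega>. norm ((norm (f x - g x))\<^sup>2) \<le> norm (2 * (norm (f x))\<^sup>2 + 2 * (norm (g x))\<^sup>2)"
    proof (rule AE_I2)
      fix x show "norm ((norm (f x - g x))\<^sup>2) \<le> norm (2 * (norm (f x))\<^sup>2 + 2 * (norm (g x))\<^sup>2)"
        using norm_diff_square_le[of "f x" "g x" 0] by simp
    qed
  qed measurable
  then show ?thesis unfolding L2_def by simp
qed

lemma L2_mult_integrable:
  fixes f g :: "'a::euclidean_space \<Rightarrow> complex"
  assumes f: "f \<in> L2 \<Omega>" and g: "g \<in> L2 \<Omega>"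
  shows "integrable (lebesgue_on \<Omega>) (\<lambda>x. f x * g x)"
proof (rule Bochner_Integration.integrable_bound)
  have [measurable]: "f \<in> borel_measurable (lebesgue_on \<Omega>)" "g \<in> borel_measurable (lebesgue_on \<Omega>)"
    using f g by (auto simp: L2_def)
  show "(\<lambda>x. f x * g x) \<in> borel_measurable (lebesgue_on \<Omega>)" by measurable
  show "integrable (lebesgue_on \<Omega>) (\<lambda>x. (norm (f x))\<^sup>2 + (norm (g x))\<^sup>2)" using f g by (auto simp: L2_def)
  show "AE x in lebesgue_on \<Omega>. norm (f x * g x) \<le> norm ((norm (f x))\<^sup>2 + (norm (g x))\<^sup>2)"
  proof (rule AE_I2)
    fix x
    have "2 * (norm (f x) * norm (g x)) \<le> (norm (f x))\<^sup>2 + (norm (g x))\<^sup>2"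
      using sum_squares_bound[of "norm (f x)" "norm (g x)"] by simp
    moreover have "0 \<le> norm (f x) * norm (g x)" by simp
    ultimately show "norm (f x * g x) \<le> norm ((norm (f x))\<^sup>2 + (norm (g x))\<^sup>2)" unfolding norm_mult real_norm_def by linarith
  qed
qed

lemma L2_Cauchy_Schwarz:
  fixes f g :: "'a::euclidean_space \<Rightarrow> complex"
  assumes f: "f \<in> L2 \<Omega>" and g: "g \<in> L2 \<Omega>"
  shows "norm (LINT x|lebesgue_on \<Omega>. f x * g x) \<le> L2_norm \<Omega> f * L2_norm \<Omega> g"
proof -
  have "ennreal ((norm (LINT x|lebesgue_on \<Omega>. f x * g x))\<^sup>2) \<le> ennreal ((L2_norm \<Omega> f)\<^sup>2) * ennreal ((L2_norm \<Omega> g)\<^sup>2)"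
    using norm_integral_mult_square_le[of f "lebesgue_on \<Omega>" g] f g L2_nn_integral[OF f] L2_nn_integral[OF g]
    by (simp add: L2_def)
  also have "\<dots> = ennreal ((L2_norm \<Omega> f * L2_norm \<Omega> g)\<^sup>2)" by (simp add: power_mult_distrib ennreal_mult)
  finally have "(norm (LINT x|lebesgue_on \<Omega>. f x * g x))\<^sup>2 \<le> (L2_norm \<Omega> f * L2_norm \<Omega> g)\<^sup>2"
    by (subst (asm) ennreal_le_iff) auto
  then show ?thesis
    by (rule power2_le_imp_le) (intro mult_nonneg_nonneg L2_norm_nonneg)
qed

text \<open>Norm convergence implies weak convergence, which is all that the distributional equation needs.\<close>

lemma L2_pairing_tendsto:
  fixes u :: "nat \<Rightarrow> 'a::euclidean_space \<Rightarrow> complex"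
  assumes u: "\<And>n. u n \<in> L2 \<Omega>" "v \<in> L2 \<Omega>" "L2_tendsto \<Omega> u v" and \<psi>: "\<psi> \<in> L2 \<Omega>"
  shows "(\<lambda>n. LINT x|lebesgue_on \<Omega>. u n x * \<psi> x) \<longlonglongrightarrow> (LINT x|lebesgue_on \<Omega>. v x * \<psi> x)"
proof (rule LIM_zero_cancel, rule Lim_null_comparison)
  show "(\<lambda>n. L2_norm \<Omega> (\<lambda>x. u n x - v x) * L2_norm \<Omega> \<psi>) \<longlonglongrightarrow> 0"
    using tendsto_mult_right[OF u(3)[unfolded L2_tendsto_def], of "L2_norm \<Omega> \<psi>"] by simp
  have "norm ((LINT x|lebesgue_on \<Omega>. u n x * \<psi> x) - (LINT x|lebesgue_on \<Omega>. v x * \<psi> x))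
      \<le> L2_norm \<Omega> (\<lambda>x. u n x - v x) * L2_norm \<Omega> \<psi>" for n
  proof -
    have "(LINT x|lebesgue_on \<Omega>. u n x * \<psi> x) - (LINT x|lebesgue_on \<Omega>. v x * \<psi> x) = (LINT x|lebesgue_on \<Omega>. (u n x - v x) * \<psi> x)"
      unfolding left_diff_distrib
      by (rule Bochner_Integration.integral_diff[symmetric, OF L2_mult_integrable[OF u(1) \<psi>] L2_mult_integrable[OF u(2) \<psi>]])
    then show ?thesis using L2_Cauchy_Schwarz[OF L2_diff[OF u(1)[of n] u(2)] \<psi>] by simp
  qed
  then show "eventually (\<lambda>n. norm ((LINT x|lebesgue_on \<Omega>. u n x * \<psi> x) - (LINT x|lebesgue_on \<Omega>. v x * \<psi> x))
      \<le> L2_norm \<Omega> (\<lambda>x. u n x - v x) * L2_norm \<Omega> \<psi>) sequentially" by simp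
qed

lemma continuous_in_L2:
  fixes f :: "'a::euclidean_space \<Rightarrow> 'b::euclidean_space"
  assumes f: "continuous_on UNIV f" and \<Omega>: "bounded \<Omega>" "\<Omega> \<in> sets borel"
  shows "f \<in> L2 \<Omega>"
proof -
  have m: "f \<in> borel_measurable borel" by (rule borel_measurable_continuous_onI[OF f])
  have c2: "continuous_on UNIV (\<lambda>x. (norm (f x))\<^sup>2)" by (intro continuous_intros f)
  have m2: "(\<lambda>x. (norm (f x))\<^sup>2) \<in> borel_measurable borel" by (rule borel_measurable_continuous_onI[OF c2])
  have "integrable lborel (\<lambda>x. indicator (closure \<Omega>) x *\<^sub>R (norm (f x))\<^sup>2)"
    using \<Omega>(1) by (intro borel_integrable_compact continuous_on_subset[OF c2]) auto
  then have "integrable lborel (\<lambda>x. indicator \<Omega> x *\<^sub>R (indicator (closure \<Omega>) x *\<^sub>R (norm (f x))\<^sup>2))"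
    by (rule integrable_mult_indicator[rotated]) (simp add: \<Omega>)
  also have "(\<lambda>x. indicator \<Omega> x *\<^sub>R (indicator (closure \<Omega>) x *\<^sub>R (norm (f x))\<^sup>2)) = (\<lambda>x. indicator \<Omega> x *\<^sub>R (norm (f x))\<^sup>2)"
    using closure_subset[of \<Omega>] by (auto simp: fun_eq_iff split: split_indicator)
  finally have "integrable (lebesgue_on \<Omega>) (\<lambda>x. (norm (f x))\<^sup>2)"
    by (subst integrable_lebesgue_on_borel[OF m2 \<Omega>(2)])
  then show ?thesis unfolding L2_def using measurable_lebesgue_on[OF m] by simp
qed

lemma test_function_in_L2:
  assumes "\<phi> \<in> test_functions \<Omega>" "bounded \<Omega>" "\<Omega> \<in> sets borel"
  shows "\<phi> \<in> L2 \<Omega>"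
  using assms(1) by (rule test_functionsE) (rule continuous_in_L2[OF smooth_on_continuous assms(2,3)])

lemma integral_lebesgue_on_supported:
  fixes f :: "'a::euclidean_space \<Rightarrow> complex"
  assumes "f \<in> borel_measurable borel" "\<Omega> \<in> sets borel" "\<And>x. x \<notin> \<Omega> \<Longrightarrow> f x = 0"
  shows "(LINT x|lebesgue_on \<Omega>. f x) = (LINT x|lborel. f x)"
proof -
  have "(\<lambda>x. indicator \<Omega> x *\<^sub>R f x) = f" using assms(3) by (auto simp: fun_eq_iff split: split_indicator)
  then show ?thesis by (simp add: integral_lebesgue_on_borel[OF assms(1,2)])
qed

text \<open>For smooth functions the distributional derivative is the classical one.\<close>

lemma smooth_in_dbar:
  assumes \<Omega>: "bounded \<Omega>" "\<Omega> \<in> sets borel" and F: "smooth_on UNIV F"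
  shows "(F, \<lambda>p. (dzbar F p, dwbar F p)) \<in> dbar \<Omega>"
proof -
  have c: "continuous_on UNIV (wirtinger a b F)" for a b
    by (rule smooth_on_continuous[OF smooth_on_wirtinger[OF open_UNIV F]])
  have G: "(\<lambda>p. (dzbar F p, dwbar F p)) \<in> L2 \<Omega>"
    unfolding dzbar_eq_wirtinger dwbar_eq_wirtinger
    by (rule continuous_in_L2[OF _ \<Omega>]) (intro continuous_on_Pair c)
  have parts: "(LINT p|lebesgue_on \<Omega>. wirtinger a b F p * \<phi> p) = - (LINT p|lebesgue_on \<Omega>. F p * wirtinger a b \<phi> p)"
    if \<phi>: "\<phi> \<in> test_functions \<Omega>" for \<phi> a b
  proof -
    obtain K where K: "smooth_on UNIV \<phi>" "compact K" "K \<subseteq> \<Omega>" "\<And>x. x \<notin> K \<Longrightarrow> \<phi> x = 0"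
      using \<phi> by (rule test_functionsE) blast
    have s: "LINT p|lebesgue_on \<Omega>. k p * \<psi> p = LINT p|lborel. k p * \<psi> p"
      if k: "smooth_on UNIV k" and \<psi>: "\<psi> \<in> test_functions \<Omega>" for k \<psi> :: "complex \<times> complex \<Rightarrow> complex"
    proof (rule integral_lebesgue_on_supported[OF _ \<Omega>(2)])
      obtain L where L: "smooth_on UNIV \<psi>" "L \<subseteq> \<Omega>" "\<And>x. x \<notin> L \<Longrightarrow> \<psi> x = 0"
        using \<psi> by (rule test_functionsE) blast
      show "(\<lambda>p. k p * \<psi> p) \<in> borel_measurable borel"
        by (rule borel_measurable_continuous_onI[OF smooth_on_continuous[OF smooth_on_mult[OF open_UNIV k L(1)]]])
      show "k x * \<psi> x = 0" if "x \<notin> \<Omega>" for x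
        using L(2) L(3)[of x] that by auto
    qed
    show ?thesis
      unfolding s[OF smooth_on_wirtinger[OF open_UNIV F] \<phi>] s[OF F test_functions_wirtinger[OF \<phi>]]
      by (rule integral_wirtinger_by_parts[OF F test_functions_mono[OF \<phi> subset_UNIV]])
  qed
  have "distributional_dbar \<Omega> F (\<lambda>p. (dzbar F p, dwbar F p))"
    unfolding distributional_dbar_def fst_conv snd_conv dzbar_eq_wirtinger dwbar_eq_wirtinger
    using parts by blast
  then show ?thesis unfolding dbar_def using G continuous_in_L2[OF smooth_on_continuous[OF F] \<Omega>] by simp
qed

lemma Ker_dbar_s_subset:
  assumes \<Omega>: "bounded \<Omega>" "\<Omega> \<in> sets borel"
  shows "Ker (dbar_s \<Omega>) \<subseteq> Ker (dbar \<Omega>)"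
proof
  fix f assume "f \<in> Ker (dbar_s \<Omega>)"
  then obtain F G where f: "f \<in> L2 \<Omega>" and zero: "(\<lambda>_. 0 :: complex \<times> complex) \<in> L2 \<Omega>"
    and FG: "\<And>n. (F n, G n) \<in> dbar \<Omega>" and lim: "L2_tendsto \<Omega> F f" "L2_tendsto \<Omega> G (\<lambda>_. 0)"
    unfolding Ker_def dbar_s_def by blast
  have F: "F n \<in> L2 \<Omega>" and G: "G n \<in> L2 \<Omega>" and dist: "distributional_dbar \<Omega> (F n) (G n)" for n
    using FG[of n] by (auto simp: dbar_def)
  have part: "(\<lambda>n. LINT p|lebesgue_on \<Omega>. P (G n p) * \<phi> p) \<longlonglongrightarrow> 0"
    if P: "P = fst \<or> P = snd" and \<phi>: "\<phi> \<in> L2 \<Omega>" for P :: "complex \<times> complex \<Rightarrow> complex" and \<phi>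
  proof -
    have le: "norm (P q) \<le> norm q" for q
      using P by (cases q) (auto simp: norm_fst_le norm_snd_le)
    have Pc: "continuous_on UNIV P" using P by (auto intro: continuous_intros)
    have PG: "(\<lambda>p. P (G n p)) \<in> L2 \<Omega>" for n
    proof -
      have gm: "G n \<in> borel_measurable (lebesgue_on \<Omega>)" and gi: "integrable (lebesgue_on \<Omega>) (\<lambda>x. (norm (G n x))\<^sup>2)"
        using G[of n] by (auto simp: L2_def)
      have m [measurable]: "(\<lambda>p. P (G n p)) \<in> borel_measurable (lebesgue_on \<Omega>)"
        by (rule measurable_compose[OF gm borel_measurable_continuous_onI[OF Pc]])
      have "integrable (lebesgue_on \<Omega>) (\<lambda>x. (norm (P (G n x)))\<^sup>2)"
      proof (rule Bochner_Integration.integrable_bound[OF gi])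
        show "AE x in lebesgue_on \<Omega>. norm ((norm (P (G n x)))\<^sup>2) \<le> norm ((norm (G n x))\<^sup>2)"
          by (intro AE_I2) (simp add: le power_mono)
      qed measurable
      with m show ?thesis by (simp add: L2_def)
    qed
    have bound: "norm (LINT p|lebesgue_on \<Omega>. P (G n p) * \<phi> p) \<le> L2_norm \<Omega> (\<lambda>x. G n x - 0) * L2_norm \<Omega> \<phi>" for n
    proof -
      have "L2_norm \<Omega> (\<lambda>p. P (G n p)) \<le> L2_norm \<Omega> (G n)"
        unfolding L2_norm_def
      proof (rule real_sqrt_le_mono, rule integral_mono)
        show "integrable (lebesgue_on \<Omega>) (\<lambda>x. (norm (P (G n x)))\<^sup>2)" "integrable (lebesgue_on \<Omega>) (\<lambda>x. (norm (G n x))\<^sup>2)"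
          using PG[of n] G[of n] by (simp_all add: L2_def)
        show "(norm (P (G n x)))\<^sup>2 \<le> (norm (G n x))\<^sup>2" for x by (intro power_mono le) simp
      qed
      then have "L2_norm \<Omega> (\<lambda>p. P (G n p)) * L2_norm \<Omega> \<phi> \<le> L2_norm \<Omega> (G n) * L2_norm \<Omega> \<phi>"
        by (rule mult_right_mono) (rule L2_norm_nonneg)
      with L2_Cauchy_Schwarz[OF PG \<phi>, of n] show ?thesis by simp
    qed
    have lim0: "(\<lambda>n. L2_norm \<Omega> (\<lambda>x. G n x - 0) * L2_norm \<Omega> \<phi>) \<longlonglongrightarrow> 0"
      using tendsto_mult_right[OF lim(2)[unfolded L2_tendsto_def], of "L2_norm \<Omega> \<phi>"] by simp
    show ?thesis
    proof (rule Lim_null_comparison[OF _ lim0])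
      show "eventually (\<lambda>n. norm (LINT p|lebesgue_on \<Omega>. P (G n p) * \<phi> p)
          \<le> L2_norm \<Omega> (\<lambda>x. G n x - 0) * L2_norm \<Omega> \<phi>) sequentially"
        using bound by (rule always_eventually[OF allI])
    qed
  qed
  have "distributional_dbar \<Omega> f (\<lambda>_. 0)"
    unfolding distributional_dbar_def
  proof
    fix \<phi> :: "complex \<times> complex \<Rightarrow> complex" assume \<phi>: "\<phi> \<in> test_functions \<Omega>"
    have \<phi>2: "\<phi> \<in> L2 \<Omega>" by (rule test_function_in_L2[OF \<phi> \<Omega>])
    have z2: "dzbar \<phi> \<in> L2 \<Omega>" "dwbar \<phi> \<in> L2 \<Omega>"
      unfolding dzbar_eq_wirtinger dwbar_eq_wirtinger by (rule test_function_in_L2[OF test_functions_wirtinger[OF \<phi>] \<Omega>])+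
    have eq: "(LINT p|lebesgue_on \<Omega>. F n p * dzbar \<phi> p) = - (LINT p|lebesgue_on \<Omega>. fst (G n p) * \<phi> p)"
      "(LINT p|lebesgue_on \<Omega>. F n p * dwbar \<phi> p) = - (LINT p|lebesgue_on \<Omega>. snd (G n p) * \<phi> p)" for n
      using dist[of n] \<phi> by (auto simp: distributional_dbar_def)
    have l0: "(\<lambda>n. LINT p|lebesgue_on \<Omega>. F n p * dzbar \<phi> p) \<longlonglongrightarrow> 0" "(\<lambda>n. LINT p|lebesgue_on \<Omega>. F n p * dwbar \<phi> p) \<longlonglongrightarrow> 0"
      using tendsto_minus[OF part[of fst \<phi>, OF _ \<phi>2]] tendsto_minus[OF part[of snd \<phi>, OF _ \<phi>2]] by (simp_all add: eq)
    have "(LINT p|lebesgue_on \<Omega>. f p * dzbar \<phi> p) = 0"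
      by (rule LIMSEQ_unique[OF L2_pairing_tendsto[of F \<Omega> f, OF F f lim(1) z2(1)] l0(1)])
    moreover have "(LINT p|lebesgue_on \<Omega>. f p * dwbar \<phi> p) = 0"
      by (rule LIMSEQ_unique[OF L2_pairing_tendsto[of F \<Omega> f, OF F f lim(1) z2(2)] l0(2)])
    ultimately
    show "(LINT p|lebesgue_on \<Omega>. fst (0 :: complex \<times> complex) * \<phi> p) = - (LINT p|lebesgue_on \<Omega>. f p * dzbar \<phi> p) \<and>
        (LINT p|lebesgue_on \<Omega>. snd (0 :: complex \<times> complex) * \<phi> p) = - (LINT p|lebesgue_on \<Omega>. f p * dwbar \<phi> p)"
      by simp
  qed
  then show "f \<in> Ker (dbar \<Omega>)" using f zero by (simp add: Ker_def dbar_def)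
qed

text \<open>Fubini for the product of two Borel measures asks for a Borel function; elements of \<open>L2\<close> are only Lebesgue
  measurable.\<close>

lemma borel_representative:
  fixes f :: "'a::euclidean_space \<Rightarrow> complex"
  assumes f: "f \<in> borel_measurable (lebesgue_on \<Omega>)" and \<Omega>: "\<Omega> \<in> sets borel"
  obtains g where "g \<in> borel_measurable borel" "\<forall>x. x \<notin> \<Omega> \<longrightarrow> g x = 0" "AE x in lebesgue_on \<Omega>. f x = g x"
proof -
  define f0 where "f0 x = (if x \<in> \<Omega> then f x else 0)" for x
  have f0 [measurable]: "f0 \<in> borel_measurable lebesgue"
    unfolding f0_def[abs_def] using f \<Omega> by (subst borel_measurable_if) simp_all
  have "(\<lambda>x. Re (f0 x)) \<in> borel_measurable lebesgue" "(\<lambda>x. Im (f0 x)) \<in> borel_measurable lebesgue" by measurable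
  then obtain r i where [measurable]: "r \<in> borel_measurable lborel" "i \<in> borel_measurable lborel"
    and ae: "AE x in lborel. Re (f0 x) = r x" "AE x in lborel. Im (f0 x) = i x"
    using completion_ex_borel_measurable_real by metis
  define g where "g x = indicator \<Omega> x *\<^sub>R Complex (r x) (i x)" for x
  note [measurable] = \<Omega>
  have g: "g \<in> borel_measurable borel"
  proof -
    have "r \<in> borel_measurable borel" "i \<in> borel_measurable borel" by simp_all
    then show ?thesis unfolding g_def[abs_def] by measurable
  qed
  have "AE x in lborel. f0 x = Complex (r x) (i x)"
    using ae by eventually_elim (simp add: complex_eq_iff)
  then have "AE x in lebesgue. f0 x = Complex (r x) (i x)" by (rule AE_completion)
  then have "AE x in lebesgue. x \<in> \<Omega> \<longrightarrow> f x = g x"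
    by eventually_elim (auto simp add: f0_def g_def)
  then have "AE x in lebesgue_on \<Omega>. f x = g x"
    using \<Omega> by (subst AE_restrict_space_iff) auto
  moreover have "\<forall>x. x \<notin> \<Omega> \<longrightarrow> g x = 0" by (simp add: g_def)
  ultimately show ?thesis using g by (intro that)
qed

lemma bounded_hartogs_triangle: "bounded hartogs_triangle"
proof (rule bounded_subset[OF bounded_bidisc])
  show "hartogs_triangle \<subseteq> bidisc" by (auto simp: hartogs_triangle_def bidisc_def)
qed

text \<open>Pass to a Borel representative vanishing off the triangle and take approximants with errors \<open>1/(n + 1)\<close>.\<close>

lemma Ker_dbar_subset: "Ker (dbar hartogs_triangle) \<subseteq> Ker (dbar_s hartogs_triangle)"
proof
  let ?T = hartogs_triangle
  note T = bounded_hartogs_triangle borel_hartogs_triangle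
  fix f0 assume "f0 \<in> Ker (dbar ?T)"
  then have f0: "f0 \<in> L2 ?T" and zero: "(\<lambda>_. 0 :: complex \<times> complex) \<in> L2 ?T" and dist: "distributional_dbar ?T f0 (\<lambda>_. 0)"
    by (auto simp: Ker_def dbar_def)
  have f0m: "f0 \<in> borel_measurable (lebesgue_on ?T)" using f0 by (simp add: L2_def)
  obtain f where f: "f \<in> borel_measurable borel" "\<forall>p. p \<notin> ?T \<longrightarrow> f p = 0" and ae: "AE p in lebesgue_on ?T. f0 p = f p"
    using borel_representative[OF f0m T(2)] by blast
  have pair: "(LINT p|lborel. f p * \<psi> p) = (LINT p|lebesgue_on ?T. f0 p * \<psi> p)" if \<psi>: "\<psi> \<in> borel_measurable borel" for \<psi>
  proof -
    have m: "(\<lambda>p. f p * \<psi> p) \<in> borel_measurable borel" using f(1) \<psi> by (rule borel_measurable_times)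
    have "(LINT p|lborel. f p * \<psi> p) = (LINT p|lebesgue_on ?T. f p * \<psi> p)"
    proof (rule integral_lebesgue_on_supported[OF m T(2), symmetric])
      fix p assume "p \<notin> ?T"
      then have "f p = 0" using f(2) by blast
      then show "f p * \<psi> p = 0" by simp
    qed
    also have "\<dots> = (LINT p|lebesgue_on ?T. f0 p * \<psi> p)"
    proof (rule integral_cong_AE[OF measurable_lebesgue_on[OF m]])
      show "(\<lambda>p. f0 p * \<psi> p) \<in> borel_measurable (lebesgue_on ?T)"
        by (rule borel_measurable_times[OF f0m measurable_lebesgue_on[OF \<psi>]])
      show "AE p in lebesgue_on ?T. f p * \<psi> p = f0 p * \<psi> p" using ae by eventually_elim simp
    qed
    finally show ?thesis .
  qed
  have closed: "weakly_dbar_closed ?T f"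
    unfolding weakly_dbar_closed_def
  proof
    fix \<phi> :: "complex \<times> complex \<Rightarrow> complex" assume \<phi>: "\<phi> \<in> test_functions ?T"
    have "(LINT p|lebesgue_on ?T. f0 p * dzbar \<phi> p) = 0 \<and> (LINT p|lebesgue_on ?T. f0 p * dwbar \<phi> p) = 0"
      using dist \<phi> by (auto simp: distributional_dbar_def)
    then show "(LINT p|lborel. f p * dzbar \<phi> p) = 0 \<and> (LINT p|lborel. f p * dwbar \<phi> p) = 0"
      by (simp only: pair[OF measurable_test_wirtinger(1)[OF \<phi>]] pair[OF measurable_test_wirtinger(2)[OF \<phi>]])
  qed
  have f2: "(\<integral>\<^sup>+p. ennreal ((cmod (f p))\<^sup>2) * indicator ?T p \<partial>lborel) < \<infinity>"
  proof -
    have "(\<lambda>p. ennreal ((cmod (f p))\<^sup>2)) \<in> borel_measurable borel" using f(1) by measurable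
    from nn_integral_lebesgue_on_borel[OF this T(2)]
    have "(\<integral>\<^sup>+p. ennreal ((cmod (f p))\<^sup>2) * indicator ?T p \<partial>lborel) = sqint (lebesgue_on ?T) f" by simp
    also have "\<dots> = sqint (lebesgue_on ?T) f0"
    proof (rule nn_integral_cong_AE)
      show "AE p in lebesgue_on ?T. ennreal ((cmod (f p))\<^sup>2) = ennreal ((cmod (f0 p))\<^sup>2)"
        using ae by eventually_elim simp
    qed
    also have "\<dots> = ennreal ((L2_norm ?T f0)\<^sup>2)" by (rule L2_nn_integral[OF f0])
    finally show ?thesis by simp
  qed
  define e where "e n = 1 / real (Suc n)" for n
  have e: "e n > 0" for n by (simp add: e_def)
  have "\<forall>n. \<exists>F. smooth_on UNIV F \<and>
      (\<integral>\<^sup>+p. ennreal ((cmod (F p - f p))\<^sup>2) * indicator ?T p \<partial>lborel) < ennreal ((e n)\<^sup>2) \<and>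
      (\<integral>\<^sup>+p. ennreal ((norm (dzbar F p, dwbar F p))\<^sup>2) * indicator ?T p \<partial>lborel) < ennreal ((e n)\<^sup>2)"
  proof
    fix n
    have "(e n)\<^sup>2 > 0" using e[of n] by simp
    from dbar_approximants[OF f closed f2 this]
    show "\<exists>F. smooth_on UNIV F \<and>
      (\<integral>\<^sup>+p. ennreal ((cmod (F p - f p))\<^sup>2) * indicator ?T p \<partial>lborel) < ennreal ((e n)\<^sup>2) \<and>
      (\<integral>\<^sup>+p. ennreal ((norm (dzbar F p, dwbar F p))\<^sup>2) * indicator ?T p \<partial>lborel) < ennreal ((e n)\<^sup>2)" by blast
  qed
  from choice[OF this] obtain F where F: "\<And>n. smooth_on UNIV (F n)"
    "\<And>n. (\<integral>\<^sup>+p. ennreal ((cmod (F n p - f p))\<^sup>2) * indicator ?T p \<partial>lborel) < ennreal ((e n)\<^sup>2)"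
    "\<And>n. (\<integral>\<^sup>+p. ennreal ((norm (dzbar (F n) p, dwbar (F n) p))\<^sup>2) * indicator ?T p \<partial>lborel) < ennreal ((e n)\<^sup>2)"
    by blast
  define G where "G n p = (dzbar (F n) p, dwbar (F n) p)" for n p
  have FG: "(F n, G n) \<in> dbar ?T" for n
    unfolding G_def[abs_def] by (rule smooth_in_dbar[OF T F(1)])
  have Fm: "F n \<in> borel_measurable borel" for n
    by (rule borel_measurable_continuous_onI[OF smooth_on_continuous[OF F(1)]])
  have Gm: "G n \<in> borel_measurable borel" for n
    unfolding G_def[abs_def] dzbar_eq_wirtinger dwbar_eq_wirtinger
    by (intro borel_measurable_continuous_onI continuous_on_Pair smooth_on_continuous smooth_on_wirtinger open_UNIV F(1))
  have F_le: "L2_norm ?T (\<lambda>p. F n p - f0 p) \<le> e n" for n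
  proof (rule L2_norm_le)
    have "sqint (lebesgue_on ?T) (\<lambda>p. F n p - f0 p) = sqint (lebesgue_on ?T) (\<lambda>p. F n p - f p)"
    proof (rule nn_integral_cong_AE)
      show "AE p in lebesgue_on ?T. ennreal ((cmod (F n p - f0 p))\<^sup>2) = ennreal ((cmod (F n p - f p))\<^sup>2)"
        using ae by eventually_elim simp
    qed
    also have "\<dots> = (\<integral>\<^sup>+p. ennreal ((cmod (F n p - f p))\<^sup>2) * indicator ?T p \<partial>lborel)"
      using Fm[of n] f(1) by (intro nn_integral_lebesgue_on_borel T) measurable
    also have "\<dots> \<le> ennreal ((e n)\<^sup>2)" using F(2)[of n] by (rule less_imp_le)
    finally show "sqint (lebesgue_on ?T) (\<lambda>p. F n p - f0 p) \<le> ennreal ((e n)\<^sup>2)" .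
  qed (use e in \<open>simp add: less_imp_le\<close>)
  have G_le: "L2_norm ?T (G n) \<le> e n" for n
  proof (rule L2_norm_le)
    have "sqint (lebesgue_on ?T) (G n) = (\<integral>\<^sup>+p. ennreal ((norm (G n p))\<^sup>2) * indicator ?T p \<partial>lborel)"
      using Gm[of n] by (intro nn_integral_lebesgue_on_borel T) measurable
    also have "\<dots> \<le> ennreal ((e n)\<^sup>2)" using F(3)[of n] by (simp add: G_def less_imp_le)
    finally show "sqint (lebesgue_on ?T) (G n) \<le> ennreal ((e n)\<^sup>2)" .
  qed (use e in \<open>simp add: less_imp_le\<close>)
  have e0: "e \<longlonglongrightarrow> 0" unfolding e_def[abs_def] by (rule LIMSEQ_Suc[OF lim_const_over_n])
  have lim: "L2_tendsto ?T F f0" "L2_tendsto ?T G (\<lambda>_. 0)"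
    unfolding L2_tendsto_def
    by (rule tendsto_sandwich[OF _ _ tendsto_const e0]; simp add: L2_norm_nonneg F_le G_le)+
  have "F n \<in> smooth_up_to_boundary ?T" for n
    using F(1)[of n] by (auto simp: smooth_up_to_boundary_def smooth_on_UNIV_iff)
  with FG lim have "(f0, \<lambda>_. 0) \<in> dbar_s ?T"
    unfolding dbar_s_def using f0 zero by blast
  then show "f0 \<in> Ker (dbar_s ?T)" by (simp add: Ker_def)
qed

theorem proposition3p6:
  "Ker (dbar_s hartogs_triangle) = Ker (dbar hartogs_triangle)"
  using Ker_dbar_s_subset[OF bounded_hartogs_triangle borel_hartogs_triangle] Ker_dbar_subset by (rule subset_antisym)

end
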